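(* Let $R$ be a countable Borel equivalence relation on a standard measure space $(X,\mu)$ such that $\mu$ is $R$-invariant and $R$-ergodic and $R$ is not $\mu$-amenable, and let $G$ be a countable dense subgroup of $[R]$ (with respect to the uniform topology). Then for $\mu$-almost every $x\in X$ there exists a symmetric non-degenerate probability measure $\nu_x$ on $G$ such that for every natural number $n$ the action of $G$ on the set of $n$-tuples of points from the orbit of $x$ is $\nu_x$-Liouville, but there is no symmetric non-degenerate probability measure $\nu$ on $G$ such that the action of $G$ on almost every orbit is $\nu$-Liouville.
   Context: A standard measure space $(X,\mu)$ is a standard Borel space $X$ with a non-atomic Borel probability measure $\mu$. A countable Borel equivalence relation on $X$ is an equivalence relation $R\subseteq X\times X$ that is Borel with all classes countable. $[R]_B$ is the group of Borel automorphisms of $X$ whose graph is contained in $R$; $\mu$ is $R$-invariant if it is preserved by $[R]_B$, and $R$-ergodic if every $R$-invariant Borel set is null or co-null. The full group $[R]$ is the group of Borel automorphisms of $X$ preserving the measure class of $\mu$ (identified when they agree $\mu$-a.e.) whose graph is contained in $R$ on a set of full measure. The uniform topology on $[R]$ is generated by the metric $d(g,h)=\mu(\{x\in X\mid g(x)\neq h(x)\})$. A countable $G\le[R]$ acts genuinely on an $R$-invariant Borel set of full measure, after choosing representatives; orbits are taken with respect to this action. $R$ is $\mu$-amenable if there are Borel functions $l_n\colon R\to\mathbb{R}_{\ge0}$ ($n\in\mathbb N$) such that $\|l_n(x,\cdot)\|_1=1$ for $\mu$-almost every $x$ and, on an invariant Borel set of full $\mu$-measure, $\|l_n(x,\cdot)-l_n(y,\cdot)\|_1\to0$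 for all $(x,y)\in R$. A probability measure $\nu$ on a countable group $G$ is symmetric if $\nu(g)=\nu(g^{-1})$ for all $g$, and non-degenerate if its support generates $G$ as a semigroup. For an action of $G$ on a set $Y$, $f\colon Y\to\mathbb R$ is $\nu$-harmonic if $f(y)=\sum_{g\in G}f(gy)\nu(g)$ for all $y\in Y$; the action is $\nu$-Liouville if every bounded $\nu$-harmonic function on $Y$ is constant. $G$ acts on tuples diagonally.
   Formalization: The n-tuples of points from the orbit are taken with pairwise distinct entries; with repetitions allowed the claim fails for n ≥ 2, since the indicator of tuples with a repeated entry is invariant, hence bounded, harmonic and non-constant. *)

theory Defs
  imports "HOL-Probability.Probability" "HOL-Algebra.Group_Action"
begin

section \<open>Standard measure spaces\<close>

definition standard_borel :: "'a measure \<Rightarrow> bool" where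
  "standard_borel M \<longleftrightarrow>
     (\<exists>T. topspace T = space M \<and> completely_metrizable_space T \<and> second_countable T \<and>
          sets M = sigma_sets (space M) {U. openin T U})"

definition non_atomic :: "'a measure \<Rightarrow> bool" where
  "non_atomic M \<longleftrightarrow>
     (\<forall>A\<in>sets M. emeasure M A > 0 \<longrightarrow>
        (\<exists>B\<in>sets M. B \<subseteq> A \<and> 0 < emeasure M B \<and> emeasure M B < emeasure M A))"

definition standard_measure_space :: "'a measure \<Rightarrow> bool" where
  "standard_measure_space M \<longleftrightarrow> standard_borel M \<and> prob_space M \<and> non_atomic M"


section \<open>Countable Borel equivalence relations\<close>

definition countable_borel_equiv :: "'a measure \<Rightarrow> 'a rel \<Rightarrow> bool" where
  "countable_borel_equiv M R \<longleftrightarrow>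
     equiv (space M) R \<and> R \<in> sets (M \<Otimes>\<^sub>M M) \<and> (\<forall>x\<in>space M. countable (R `` {x}))"

text \<open>Functions are total in HOL; the values of an automorphism outside \<open>space M\<close> are irrelevant.\<close>

definition borel_automorphisms :: "'a measure \<Rightarrow> ('a \<Rightarrow> 'a) set" where
  "borel_automorphisms M =
     {T \<in> M \<rightarrow>\<^sub>M M. bij_betw T (space M) (space M) \<and> the_inv_into (space M) T \<in> M \<rightarrow>\<^sub>M M}"

definition borel_full_group :: "'a measure \<Rightarrow> 'a rel \<Rightarrow> ('a \<Rightarrow> 'a) set" where
  "borel_full_group M R = {T \<in> borel_automorphisms M. \<forall>x\<in>space M. (x, T x) \<in> R}"

definition invariant_measure :: "'a measure \<Rightarrow> 'a rel \<Rightarrow> bool" where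
  "invariant_measure M R \<longleftrightarrow> (\<forall>T\<in>borel_full_group M R. distr M M T = M)"

definition invariant_borel_set :: "'a measure \<Rightarrow> 'a rel \<Rightarrow> 'a set \<Rightarrow> bool" where
  "invariant_borel_set M R A \<longleftrightarrow> A \<in> sets M \<and> R `` A \<subseteq> A"

definition ergodic_measure :: "'a measure \<Rightarrow> 'a rel \<Rightarrow> bool" where
  "ergodic_measure M R \<longleftrightarrow>
     (\<forall>A. invariant_borel_set M R A \<longrightarrow> A \<in> null_sets M \<or> space M - A \<in> null_sets M)"

text \<open>The \<open>\<ell>\<^sup>1\<close>-norm takes values in \<open>[0,\<infinity>]\<close>, so that a non-summable function has norm \<open>\<infinity>\<close>.\<close>

definition l1_norm :: "'b set \<Rightarrow> ('b \<Rightarrow> real) \<Rightarrow> ennreal" where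
  "l1_norm S f = (\<integral>\<^sup>+ y. ennreal \<bar>f y\<bar> \<partial>count_space S)"

definition amenable_equiv :: "'a measure \<Rightarrow> 'a rel \<Rightarrow> bool" where
  "amenable_equiv M R \<longleftrightarrow>
     (\<exists>l :: nat \<Rightarrow> 'a \<times> 'a \<Rightarrow> real.
        (\<forall>n. l n \<in> borel_measurable (restrict_space (M \<Otimes>\<^sub>M M) R)) \<and>
        (\<forall>n. \<forall>p\<in>R. 0 \<le> l n p) \<and>
        (\<forall>n. AE x in M. l1_norm (R `` {x}) (\<lambda>z. l n (x, z)) = 1) \<and>
        (\<exists>A. invariant_borel_set M R A \<and> space M - A \<in> null_sets M \<and>
             (\<forall>(x, y)\<in>R. x \<in> A \<longrightarrow>
                (\<lambda>n. l1_norm (R `` {x}) (\<lambda>z. l n (x, z) - l n (y, z))) \<longlonglongrightarrow> 0)))"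


section \<open>The full group and its uniform topology\<close>

text \<open>A Borel automorphism preserves the measure class iff \<open>M\<close> and its push-forward have
  the same null sets.\<close>

definition full_group_maps :: "'a measure \<Rightarrow> 'a rel \<Rightarrow> ('a \<Rightarrow> 'a) set" where
  "full_group_maps M R =
     {T \<in> borel_automorphisms M.
        null_sets (distr M M T) = null_sets M \<and> (AE x in M. (x, T x) \<in> R)}"

definition ae_eq_rel :: "'a measure \<Rightarrow> 'a rel \<Rightarrow> ('a \<Rightarrow> 'a) rel" where
  "ae_eq_rel M R =
     {(S, T). S \<in> full_group_maps M R \<and> T \<in> full_group_maps M R \<and> (AE x in M. S x = T x)}"

definition full_group :: "'a measure \<Rightarrow> 'a rel \<Rightarrow> ('a \<Rightarrow> 'a) set monoid" where
  "full_group M R =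
     \<lparr>carrier = full_group_maps M R // ae_eq_rel M R,
      monoid.mult = (\<lambda>a b. \<Union>S\<in>a. \<Union>T\<in>b. ae_eq_rel M R `` {S \<circ> T}),
      one = ae_eq_rel M R `` {id}\<rparr>"

definition uniform_dist :: "'a measure \<Rightarrow> ('a \<Rightarrow> 'a) set \<Rightarrow> ('a \<Rightarrow> 'a) set \<Rightarrow> real" where
  "uniform_dist M a b =
     measure M {x \<in> space M. (SOME S. S \<in> a) x \<noteq> (SOME T. T \<in> b) x}"

definition uniform_topology :: "'a measure \<Rightarrow> 'a rel \<Rightarrow> ('a \<Rightarrow> 'a) set topology" where
  "uniform_topology M R = Metric_space.mtopology (carrier (full_group M R)) (uniform_dist M)"

abbreviation subgroup_of_full_group ::
    "'a measure \<Rightarrow> 'a rel \<Rightarrow> ('a \<Rightarrow> 'a) set set \<Rightarrow> ('a \<Rightarrow> 'a) set monoid" where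
  "subgroup_of_full_group M R G \<equiv> (full_group M R)\<lparr>carrier := G\<rparr>"

text \<open>A choice \<open>\<phi>\<close> of representatives of the elements of \<open>G\<close> that is a genuine action of \<open>G\<close> on the
  conull \<open>R\<close>-invariant Borel set \<open>E\<close>.  Elements of \<open>Bij E\<close> are extensional, whence \<open>restrict\<close>.\<close>

definition genuine_action ::
    "'a measure \<Rightarrow> 'a rel \<Rightarrow> ('a \<Rightarrow> 'a) set set \<Rightarrow> 'a set \<Rightarrow> (('a \<Rightarrow> 'a) set \<Rightarrow> 'a \<Rightarrow> 'a) \<Rightarrow> bool" where
  "genuine_action M R G E \<phi> \<longleftrightarrow>
     invariant_borel_set M R E \<and> space M - E \<in> null_sets M \<and>
     group_action (subgroup_of_full_group M R G) E \<phi> \<and>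
     (\<forall>g\<in>G. \<exists>T\<in>g. \<phi> g = restrict T E)"


section \<open>Liouville actions\<close>

inductive_set semigroup_generated :: "('g, 'm) monoid_scheme \<Rightarrow> 'g set \<Rightarrow> 'g set"
  for H and S where
  incl: "s \<in> S \<Longrightarrow> s \<in> semigroup_generated H S"
| mult: "a \<in> semigroup_generated H S \<Longrightarrow> b \<in> semigroup_generated H S \<Longrightarrow>
           a \<otimes>\<^bsub>H\<^esub> b \<in> semigroup_generated H S"

definition symmetric_measure :: "('g, 'm) monoid_scheme \<Rightarrow> 'g pmf \<Rightarrow> bool" where
  "symmetric_measure H \<nu> \<longleftrightarrow> (\<forall>g\<in>carrier H. pmf \<nu> g = pmf \<nu> (inv\<^bsub>H\<^esub> g))"

definition nondegenerate_measure :: "('g, 'm) monoid_scheme \<Rightarrow> 'g pmf \<Rightarrow> bool" where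
  "nondegenerate_measure H \<nu> \<longleftrightarrow> semigroup_generated H (set_pmf \<nu>) = carrier H"

definition harmonic ::
    "('g, 'm) monoid_scheme \<Rightarrow> ('g \<Rightarrow> 'y \<Rightarrow> 'y) \<Rightarrow> 'y set \<Rightarrow> 'g pmf \<Rightarrow> ('y \<Rightarrow> real) \<Rightarrow> bool" where
  "harmonic H act Y \<nu> f \<longleftrightarrow>
     (\<forall>y\<in>Y. ((\<lambda>g. f (act g y) * pmf \<nu> g) has_sum f y) (carrier H))"

definition liouville ::
    "('g, 'm) monoid_scheme \<Rightarrow> ('g \<Rightarrow> 'y \<Rightarrow> 'y) \<Rightarrow> 'y set \<Rightarrow> 'g pmf \<Rightarrow> bool" where
  "liouville H act Y \<nu> \<longleftrightarrow>
     (\<forall>f. harmonic H act Y \<nu> f \<and> bounded (f ` Y) \<longrightarrow> f constant_on Y)"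

text \<open>Tuples have pairwise distinct entries: the indicator of the set of tuples with a repeated
  entry is invariant under the diagonal action, hence harmonic for every measure, so for
  \<open>n \<ge> 2\<close> the action on all \<open>n\<close>-tuples over a set with at least \<open>n\<close> points is never Liouville.\<close>

definition tuples :: "nat \<Rightarrow> 'y set \<Rightarrow> 'y list set" where
  "tuples n Y = {ys. length ys = n \<and> distinct ys \<and> set ys \<subseteq> Y}"

definition diagonal_action :: "('g \<Rightarrow> 'y \<Rightarrow> 'y) \<Rightarrow> 'g \<Rightarrow> 'y list \<Rightarrow> 'y list" where
  "diagonal_action act g = map (act g)"

end

theory Submission
  imports Defs
begin

text \<open>For the positive part, swapping a small set \<open>D\<close> with \<open>g D\<close> is an element of the full group, so by
  density the action of \<open>G\<close> on almost every orbit realises every permutation of every finite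
  subset.  Averaging over such realisations gives finitely supported symmetric measures that move all
  tuples from a given finite set to the same distribution; a rapidly chosen mixture of them is
  \<open>\<nu>\<close>-Liouville on tuples, because with high probability the walk makes such an erasing step
  before it leaves the finite set on which this step was built.

  For the negative part, the Liouville property forces the Cesaro averages of the transition
  probabilities from two points of an orbit to become asymptotically equal, and these averages are
  then Borel functions witnessing amenability, provided that orbits and classes agree outside an
  invariant null set.  This needs enough elements of \<open>[R]\<^sub>B\<close>.  They come from a Lusin-Novikov
  uniformisation valid almost everywhere, in which the Cantor-Bendixson argument is replaced by
  minimising the measures of projections.\<close>

section \<open>Borel sets with countable sections\<close>

text \<open>Density in the uniform metric controls one element of [R] at a time and only up to small
  measure, whereas statements about orbits concern all group elements at once. In the positive part
  countability of \<open>G\<close> and finiteness of the tuples make up for this. In the negative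
  part the orbits have to fill whole classes, so countably many elements of [R] must exhaust
  \<open>R\<close> almost everywhere; this is why a uniformisation is needed. Its sections are coded
  by trees on the naturals because a branch holds a point together with a witness for its
  membership, and because projections of such trees are measurable for the completion by an argument
  with outer measures alone. The measure of the positive part depends on the point since its steps
  erase finite subsets of one particular orbit. Each level must cope with everything that the lower
  levels can reach, so the levels arise by recursion; a small share of each level is left to a
  prescribed group element and its inverse, which makes the support the whole group.\<close>

definition initial_segment :: "(nat \<Rightarrow> 'b) \<Rightarrow> nat \<Rightarrow> 'b list" where
  "initial_segment w n = map w [0..<n]"

lemma length_initial_segment [simp]: "length (initial_segment w n) = n"
  by (simp add: initial_segment_def)

lemma nth_initial_segment [simp]: "i < n \<Longrightarrow> initial_segment w n ! i = w i"
  by (simp add: initial_segment_def)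

lemma initial_segment_0 [simp]: "initial_segment w 0 = []"
  by (simp add: initial_segment_def)

lemma initial_segment_Suc: "initial_segment w (Suc n) = initial_segment w n @ [w n]"
  by (simp add: initial_segment_def)

lemma take_initial_segment: "take m (initial_segment w n) = initial_segment w (min m n)"
  by (simp add: initial_segment_def take_map min_def)

abbreviation baire_sets :: "(nat \<Rightarrow> nat) measure" where
  "baire_sets \<equiv> Pi\<^sub>M UNIV (\<lambda>_. count_space UNIV)"

text \<open>At the point \<open>x\<close> a family \<open>T\<close> of sets stands for the tree of all \<open>s\<close> with \<open>x \<in> T s\<close>.  In its
  branches the even coordinates carry a point of a section and the odd ones a witness for membership.\<close>

definition tree_body :: "(nat list \<Rightarrow> 'a set) \<Rightarrow> 'a \<Rightarrow> (nat \<Rightarrow> nat) set" where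
  "tree_body T x = {w. \<forall>n. x \<in> T (initial_segment w n)}"

definition evens :: "(nat \<Rightarrow> nat) \<Rightarrow> nat \<Rightarrow> nat" where
  "evens w = (\<lambda>n. w (2 * n))"

text \<open>Closed sections whose trees vary measurably with \<open>x\<close>. \<open>T\<close> need
  not be closed under initial segments, since \<open>tree_body\<close> tests every initial
  segment.\<close>

definition closed_sections :: "'a measure \<Rightarrow> ('a \<Rightarrow> (nat \<Rightarrow> nat) \<Rightarrow> bool) \<Rightarrow> bool" where
  "closed_sections M Q \<longleftrightarrow>
     (\<exists>T. range T \<subseteq> sets M \<and> (\<forall>x\<in>space M. \<forall>w. Q x w \<longleftrightarrow> w \<in> tree_body T x))"

lemma closed_sectionsI:
  assumes "\<And>s. T s \<in> sets M"
    and "\<And>x w. x \<in> space M \<Longrightarrow> Q x w \<longleftrightarrow> (\<forall>n. x \<in> T (initial_segment w n))"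
  shows "closed_sections M Q"
  using assms unfolding closed_sections_def tree_body_def by (intro exI[of _ T]) auto

lemma closed_sectionsE:
  assumes "closed_sections M Q"
  obtains T where "\<And>s. T s \<in> sets M"
    and "\<And>x w. x \<in> space M \<Longrightarrow> Q x w \<longleftrightarrow> (\<forall>n. x \<in> T (initial_segment w n))"
proof -
  from assms obtain T where "range T \<subseteq> sets M" "\<forall>x\<in>space M. \<forall>w. Q x w \<longleftrightarrow> w \<in> tree_body T x"
    unfolding closed_sections_def by blast
  then show thesis by (intro that[of T]) (auto simp: tree_body_def)
qed

lemma closed_sections_const: "A \<in> sets M \<Longrightarrow> closed_sections M (\<lambda>x w. x \<in> A)"
  by (rule closed_sectionsI[of "\<lambda>_. A"]) auto

lemma closed_sections_coord: "closed_sections M (\<lambda>x w. w k = j)"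
proof (rule closed_sectionsI[of "\<lambda>s. if k < length s \<longrightarrow> s ! k = j then space M else {}"])
  fix x w assume "x \<in> space M"
  then show "(w k = j) = (\<forall>n. x \<in> (if k < length (initial_segment w n) \<longrightarrow>
      initial_segment w n ! k = j then space M else {}))"
    by (auto dest: spec[of _ "Suc k"])
qed auto

text \<open>The first \<open>n\<close> entries of \<open>w \<circ> \<sigma> i\<close> can be read
  off a long enough initial segment of \<open>w\<close>. A node too short to determine them imposes
  no condition, so it carries all of \<open>space M\<close>.\<close>

lemma closed_sections_reindex:
  assumes "\<And>i. closed_sections M (Q i)"
  shows "closed_sections M (\<lambda>x w. \<forall>i::nat. Q i x (w \<circ> \<sigma> i))"
proof -
  have "\<exists>T. (\<forall>s. T s \<in> sets M) \<and>
    (\<forall>x w. x \<in> space M \<longrightarrow> Q i x w \<longleftrightarrow> (\<forall>n. x \<in> T (initial_segment w n)))" for i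
    using closed_sectionsE[OF assms[of i]] by metis
  then obtain T where T: "\<And>i s. T i s \<in> sets M"
    "\<And>i x w. x \<in> space M \<Longrightarrow> Q i x w \<longleftrightarrow> (\<forall>n. x \<in> T i (initial_segment w n))"
    by metis
  let ?c = "\<lambda>i n s. \<forall>m<n. \<sigma> i m < length s"
  define S where "S s i n = (if ?c i n s then T i (map (\<lambda>m. s ! \<sigma> i m) [0..<n]) else space M)" for s i n
  define T' where "T' s = (\<Inter>i. \<Inter>n. S s i n)" for s
  have S: "S s i n \<in> sets M" for s i n using T(1) by (simp add: S_def)
  show ?thesis
  proof (rule closed_sectionsI[of T'])
    show "T' s \<in> sets M" for s
      unfolding T'_def by (intro sets.countable_INT image_subsetI S) auto
    fix x and w :: "nat \<Rightarrow> nat" assume x: "x \<in> space M"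
    have *: "map (\<lambda>m. initial_segment w N ! \<sigma> i m) [0..<n] = initial_segment (w \<circ> \<sigma> i) n"
      if "?c i n (initial_segment w N)" for i n N
      using that by (auto simp: list_eq_iff_nth_eq)
    \<comment> \<open>Beyond the largest index \<open>\<sigma> i m\<close> with \<open>m < n\<close>
      all entries in question are present. For \<open>n = 0\<close> there are none, and the value of
      \<open>Max\<close> on the empty set does not matter.\<close>
    have **: "\<exists>N. ?c i n (initial_segment w N)" for i n
      by (rule exI[of _ "Suc (Max (\<sigma> i ` {..<n}))"]) (auto simp: less_Suc_eq_le)
    show "(\<forall>i. Q i x (w \<circ> \<sigma> i)) = (\<forall>n. x \<in> T' (initial_segment w n))"
    proof
      assume "\<forall>i. Q i x (w \<circ> \<sigma> i)"
      then show "\<forall>n. x \<in> T' (initial_segment w n)"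
        using x T(2) * by (auto simp: T'_def S_def)
    next
      assume r: "\<forall>n. x \<in> T' (initial_segment w n)"
      show "\<forall>i. Q i x (w \<circ> \<sigma> i)"
      proof
        fix i
        have "x \<in> T i (initial_segment (w \<circ> \<sigma> i) n)" for n
          proof -
          obtain N where N: "?c i n (initial_segment w N)" using ** by blast
          have "x \<in> T' (initial_segment w N)" using r by blast
          then have "x \<in> S (initial_segment w N) i n" unfolding T'_def by blast
          then show ?thesis using N *[OF N] unfolding S_def by simp
        qed
        then show "Q i x (w \<circ> \<sigma> i)" using T(2) x by blast
      qed
    qed
  qed
qed

text \<open>The premise \<open>w k = i\<close> is decided by one coordinate, hence clopen. The case
  distinction becomes a conjunction over all \<open>i\<close> of implications with clopen premise,
  and such a conjunction is again closed.\<close>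

lemma closed_sections_cases:
  assumes "\<And>i. closed_sections M (Q i)"
  shows "closed_sections M (\<lambda>x w. Q (w k) x (w \<circ> \<sigma>))"
proof -
  have "closed_sections M (\<lambda>x w. w k = i \<longrightarrow> Q i x (w \<circ> \<sigma>))" for i
  proof -
    have "closed_sections M (\<lambda>x w. Q i x (w \<circ> \<sigma>))"
      using closed_sections_reindex[of M "\<lambda>_. Q i" "\<lambda>_. \<sigma>"] assms by simp
    then obtain T where T: "\<And>s. T s \<in> sets M"
      "\<And>x w. x \<in> space M \<Longrightarrow> Q i x (w \<circ> \<sigma>) \<longleftrightarrow> (\<forall>n. x \<in> T (initial_segment w n))"
      by (elim closed_sectionsE) blast
    \<comment> \<open>Nodes of length at most \<open>k\<close> cannot see \<open>w k\<close> and
      stay unconstrained, so a longer node has to test all of its own initial segments.\<close>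
    show ?thesis
    proof (rule closed_sectionsI[of "\<lambda>s. if k < length s \<and> s ! k = i then (\<Inter>n\<in>{..length s}. T (take n s)) else space M"])
      fix x w assume x: "x \<in> space M"
      have "(w k = i \<longrightarrow> (\<forall>n. x \<in> T (initial_segment w n))) =
        (\<forall>n. k < n \<and> w k = i \<longrightarrow> (\<forall>m\<le>n. x \<in> T (initial_segment w m)))" (is "?l = ?r")
      proof
        assume r: ?r
        show ?l
        proof (intro impI allI)
          fix n assume "w k = i"
          then show "x \<in> T (initial_segment w n)"
            using r[rule_format, of "Suc (max k n)" n] by simp
        qed
      qed blast
      then show "(w k = i \<longrightarrow> Q i x (w \<circ> \<sigma>)) = (\<forall>n. x \<in> (if k < length (initial_segment w n) \<and>
        initial_segment w n ! k = i then (\<Inter>m\<in>{..length (initial_segment w n)}. T (take m (initial_segment w n))) else space M))"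
        using x T(2) by (auto simp: take_initial_segment min_def)
    qed (use T in auto)
  qed
  then have "closed_sections M (\<lambda>x w. \<forall>i. w k = i \<longrightarrow> Q i x (w \<circ> \<sigma>))"
    using closed_sections_reindex[of M "\<lambda>i x w. w k = i \<longrightarrow> Q i x (w \<circ> \<sigma>)" "\<lambda>_. id"] by simp
  then show ?thesis by simp
qed

section \<open>Analytic sets over a measurable parameter\<close>

definition closed_projection :: "'a measure \<Rightarrow> ('a \<times> (nat \<Rightarrow> nat)) set \<Rightarrow> bool" where
  "closed_projection M B \<longleftrightarrow> (\<exists>Q. closed_sections M Q \<and>
     B = {(x, y). x \<in> space M \<and> (\<exists>w. Q x w \<and> evens w = y)})"

text \<open>Coordinate 1 names a member of the union; the witness for that member occupies the
  remaining odd coordinates, shifted by two.\<close>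

lemma closed_projection_Union:
  assumes "\<And>i. closed_projection M (B i)"
  shows "closed_projection M (\<Union>i::nat. B i)"
proof -
  have "\<forall>i. \<exists>Q. closed_sections M Q \<and> B i = {(x, y). x \<in> space M \<and> (\<exists>w. Q x w \<and> evens w = y)}"
    using assms unfolding closed_projection_def by blast
  then obtain Q where
    QB: "\<forall>i. closed_sections M (Q i) \<and> B i = {(x, y). x \<in> space M \<and> (\<exists>w. Q i x w \<and> evens w = y)}"
    by (rule exE[OF choice])
  have Q: "closed_sections M (Q i)" for i
    using spec[OF QB] by (rule conjunct1)
  have B: "B i = {(x, y). x \<in> space M \<and> (\<exists>w. Q i x w \<and> evens w = y)}" for i
    using spec[OF QB] by (rule conjunct2)
  define \<sigma> :: "nat \<Rightarrow> nat" where "\<sigma> n = (if even n then n else n + 2)" for n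
  have "closed_sections M (\<lambda>x w. Q (w 1) x (w \<circ> \<sigma>))"
    using closed_sections_cases[OF Q] .
  moreover have "(\<Union>i. B i) = {(x, y). x \<in> space M \<and> (\<exists>w. Q (w 1) x (w \<circ> \<sigma>) \<and> evens w = y)}"
  proof (intro equalityI subsetI; clarsimp simp: B)
    fix x w i assume Q: "Q i x w"
    let ?w = "\<lambda>n. if even n then w n else if n = 1 then i else w (n - 2)"
    have "?w \<circ> \<sigma> = w" by (rule ext) (auto simp: \<sigma>_def)
    moreover have "evens ?w = evens w" by (rule ext) (simp add: evens_def)
    ultimately show "\<exists>wa. Q (wa (Suc 0)) x (wa \<circ> \<sigma>) \<and> evens wa = evens w"
      using Q by (intro exI[of _ ?w]) simp
  next
    fix x w assume "Q (w (Suc 0)) x (w \<circ> \<sigma>)"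
    moreover have "evens (w \<circ> \<sigma>) = evens w" by (auto simp: \<sigma>_def evens_def)
    ultimately show "\<exists>xa wa. Q xa x wa \<and> evens wa = evens w" by blast
  qed
  ultimately show ?thesis unfolding closed_projection_def by blast
qed

text \<open>All members share the even coordinates, while \<open>prod_encode\<close> splits the odd
  ones into infinitely many rows, one witness for each member.\<close>

lemma closed_projection_Inter:
  assumes "\<And>i. closed_projection M (B i)"
  shows "closed_projection M (\<Inter>i::nat. B i)"
proof -
  have "\<forall>i. \<exists>Q. closed_sections M Q \<and> B i = {(x, y). x \<in> space M \<and> (\<exists>w. Q x w \<and> evens w = y)}"
    using assms unfolding closed_projection_def by blast
  then obtain Q where
    QB: "\<forall>i. closed_sections M (Q i) \<and> B i = {(x, y). x \<in> space M \<and> (\<exists>w. Q i x w \<and> evens w = y)}"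
    by (rule exE[OF choice])
  have Q: "closed_sections M (Q i)" for i
    using spec[OF QB] by (rule conjunct1)
  have B: "B i = {(x, y). x \<in> space M \<and> (\<exists>w. Q i x w \<and> evens w = y)}" for i
    using spec[OF QB] by (rule conjunct2)
  define \<sigma> :: "nat \<Rightarrow> nat \<Rightarrow> nat" where
    "\<sigma> i n = (if even n then n else 2 * prod_encode (i, n div 2) + 1)" for i n
  have "closed_sections M (\<lambda>x w. \<forall>i. Q i x (w \<circ> \<sigma> i))"
    using closed_sections_reindex[OF Q] .
  moreover have "(\<Inter>i. B i) = {(x, y). x \<in> space M \<and> (\<exists>w. (\<forall>i. Q i x (w \<circ> \<sigma> i)) \<and> evens w = y)}"
  proof (rule Set.set_eqI)
    fix p :: "'a \<times> (nat \<Rightarrow> nat)"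
    obtain x y where p: "p = (x, y)" by (cases p)
    have "(\<forall>i. \<exists>w. Q i x w \<and> evens w = y) \<longleftrightarrow> (\<exists>w. (\<forall>i. Q i x (w \<circ> \<sigma> i)) \<and> evens w = y)"
    proof
      assume "\<forall>i. \<exists>w. Q i x w \<and> evens w = y"
      then obtain v where v: "\<And>i. Q i x (v i)" "\<And>i. evens (v i) = y" by metis
      let ?w = "\<lambda>n. if even n then y (n div 2) else
        (case prod_decode (n div 2) of (i, m) \<Rightarrow> v i (2 * m + 1))"
      have "?w \<circ> \<sigma> i = v i" for i
      proof
        fix n show "(?w \<circ> \<sigma> i) n = v i n"
          using fun_cong[OF v(2)[of i], of "n div 2"]
          by (cases "even n") (auto simp: \<sigma>_def evens_def elim!: oddE)
      qed
      moreover have "evens ?w = y" by (simp add: evens_def)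
      ultimately show "\<exists>w. (\<forall>i. Q i x (w \<circ> \<sigma> i)) \<and> evens w = y"
        using v by (intro exI[of _ ?w]) simp
    next
      have "evens (w \<circ> \<sigma> i) = evens w" for w i by (auto simp: \<sigma>_def evens_def)
      then show "\<forall>i. \<exists>w. Q i x w \<and> evens w = y"
        if "\<exists>w. (\<forall>i. Q i x (w \<circ> \<sigma> i)) \<and> evens w = y"
        using that by blast
    qed
    then show "p \<in> (\<Inter>i. B i) \<longleftrightarrow>
        p \<in> {(x, y). x \<in> space M \<and> (\<exists>w. (\<forall>i. Q i x (w \<circ> \<sigma> i)) \<and> evens w = y)}"
      by (simp add: B p)
  qed
  ultimately show ?thesis unfolding closed_projection_def by blast
qed

lemma evens_surj: "\<exists>w. evens w = y"
  by (rule exI[of _ "\<lambda>n. y (n div 2)"]) (simp add: evens_def)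

lemma closed_projection_fst: "A \<in> sets M \<Longrightarrow> closed_projection M (A \<times> UNIV)"
  unfolding closed_projection_def
  using sets.sets_into_space[of A M] evens_surj
  by (intro exI[of _ "\<lambda>x w. x \<in> A"] conjI closed_sections_const) auto

lemma closed_projection_snd: "closed_projection M (space M \<times> {y. y k = j})"
  unfolding closed_projection_def
proof (intro exI[of _ "\<lambda>x w. w (2 * k) = j"] conjI closed_sections_coord)
  show "space M \<times> {y. y k = j} = {(x, y). x \<in> space M \<and> (\<exists>w. w (2 * k) = j \<and> evens w = y)}"
    using evens_surj by (auto simp: evens_def) metis
qed

text \<open>The sets that are closed projections together with their complements form a
  sigma-algebra for which both coordinate maps are measurable; the complement of a cylinder in the
  second factor is the union of the other cylinders. Membership in a measurable set thus becomes the
  existence of a branch.\<close>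

lemma closed_projection_sets:
  assumes "B \<in> sets (M \<Otimes>\<^sub>M baire_sets)"
  shows "closed_projection M B"
proof -
  define \<Omega> :: "('a \<times> (nat \<Rightarrow> nat)) set" where "\<Omega> = space M \<times> UNIV"
  define \<A> where "\<A> = {B. B \<subseteq> \<Omega> \<and> closed_projection M B \<and> closed_projection M (\<Omega> - B)}"
  have sa: "sigma_algebra \<Omega> \<A>"
  proof -
    have 1: "{} \<in> \<A>"
      using closed_projection_fst[of "{}" M] closed_projection_fst[of "space M" M]
      by (simp add: \<A>_def \<Omega>_def)
    have 2: "\<Omega> - B \<in> \<A>" if "B \<in> \<A>" for B
      using that by (auto simp: \<A>_def double_diff)
    have 3: "(\<Union>i. B i) \<in> \<A>" if B: "range B \<subseteq> \<A>" for B :: "nat \<Rightarrow> _"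
    proof -
      have Bi: "B i \<subseteq> \<Omega>" "closed_projection M (B i)" "closed_projection M (\<Omega> - B i)" for i
        using subsetD[OF B, of "B i"] unfolding \<A>_def by simp_all
      have "closed_projection M (\<Union>i. B i)"
        by (rule closed_projection_Union) (rule Bi)
      moreover have "closed_projection M (\<Inter>i. \<Omega> - B i)"
        by (rule closed_projection_Inter) (rule Bi)
      moreover have "\<Omega> - (\<Union>i. B i) = (\<Inter>i. \<Omega> - B i)" by auto
      moreover have "(\<Union>i. B i) \<subseteq> \<Omega>" by (rule UN_least) (rule Bi)
      ultimately show ?thesis unfolding \<A>_def mem_Collect_eq by metis
    qed
    show ?thesis
      unfolding sigma_algebra_iff2 using 1 2 3 by (auto simp: \<A>_def)
  qed
  have S: "sets (sigma \<Omega> \<A>) = \<A>" "space (sigma \<Omega> \<A>) = \<Omega>"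
    using sigma_algebra.sets_measure_of_eq[OF sa] sigma_algebra.space_measure_of_eq[OF sa] by auto
  have "fst \<in> sigma \<Omega> \<A> \<rightarrow>\<^sub>M M"
  proof (rule measurableI)
    fix A assume A: "A \<in> sets M"
    have "fst -` A \<inter> \<Omega> = A \<times> UNIV" "\<Omega> - A \<times> UNIV = (space M - A) \<times> UNIV"
      using sets.sets_into_space[OF A] by (auto simp: \<Omega>_def)
    then show "fst -` A \<inter> space (sigma \<Omega> \<A>) \<in> sets (sigma \<Omega> \<A>)"
      using closed_projection_fst[OF A] closed_projection_fst[of "space M - A" M] A
        sets.sets_into_space[OF A] unfolding S by (auto simp: \<A>_def \<Omega>_def)
  qed (use S(2) \<Omega>_def in auto)
  moreover have "snd \<in> sigma \<Omega> \<A> \<rightarrow>\<^sub>M baire_sets"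
  proof (rule measurable_PiM_single')
    fix k :: nat
    show "(\<lambda>p. snd p k) \<in> sigma \<Omega> \<A> \<rightarrow>\<^sub>M count_space UNIV"
    proof (rule measurable_count_space_eq2_countable[THEN iffD2], intro conjI ballI)
      fix j :: nat
      define C where "C i = (if i = j then {} else space M \<times> {y. y k = i})" for i :: nat
      have "closed_projection M (C i)" for i
        using closed_projection_snd[of M k i] closed_projection_fst[of "{}" M] by (simp add: C_def)
      then have "closed_projection M (\<Union>i. C i)" by (rule closed_projection_Union)
      moreover have "\<Omega> - space M \<times> {y. y k = j} = (\<Union>i. C i)"
        by (auto simp: \<Omega>_def C_def split: if_splits)
      moreover have "(\<lambda>p. snd p k) -` {j} \<inter> \<Omega> = space M \<times> {y. y k = j}"
        by (auto simp: \<Omega>_def)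
      ultimately show "(\<lambda>p. snd p k) -` {j} \<inter> space (sigma \<Omega> \<A>) \<in> sets (sigma \<Omega> \<A>)"
        using closed_projection_snd[of M k j] unfolding S by (auto simp: \<A>_def \<Omega>_def)
    qed auto
  qed (auto simp: S)
  ultimately have "(\<lambda>p. (fst p, snd p)) \<in> sigma \<Omega> \<A> \<rightarrow>\<^sub>M M \<Otimes>\<^sub>M baire_sets"
    by (rule measurable_Pair)
  from measurable_sets[OF this assms] have "B \<inter> \<Omega> \<in> \<A>"
    by (simp add: S)
  moreover have "B \<subseteq> \<Omega>"
    using sets.sets_into_space[OF assms] by (auto simp: space_pair_measure \<Omega>_def)
  ultimately show ?thesis by (simp add: \<A>_def Int_absorb2)
qed

section \<open>Measurability of projections for a complete measure\<close>

definition tree_sect :: "(nat list \<Rightarrow> 'a set) \<Rightarrow> nat list \<Rightarrow> 'a \<Rightarrow> (nat \<Rightarrow> nat) set" where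
  "tree_sect T s x = {w \<in> tree_body T x. initial_segment w (length s) = s}"

definition tree_proj :: "'a measure \<Rightarrow> (nat list \<Rightarrow> 'a set) \<Rightarrow> nat list \<Rightarrow> 'a set" where
  "tree_proj M T s = {x \<in> space M. tree_sect T s x \<noteq> {}}"

text \<open>Koenig's lemma for a tree whose entries at level \<open>i\<close> are bounded by
  \<open>b i\<close>. A node is \<open>good\<close> if it has admissible extensions of every
  length.\<close>

lemma bounded_branch:
  assumes "\<And>k. \<exists>s. length s = k \<and> (\<forall>i<k. s ! i \<le> b i) \<and> (\<forall>n\<le>k. P (take n s))"
  shows "\<exists>w::nat \<Rightarrow> nat. (\<forall>i. w i \<le> b i) \<and> (\<forall>n. P (initial_segment w n))"
proof -
  define ok where "ok s \<longleftrightarrow> (\<forall>i<length s. s ! i \<le> b i) \<and> (\<forall>n\<le>length s. P (take n s))" for s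
  define good where "good s \<longleftrightarrow> (\<forall>k\<ge>length s. \<exists>t. length t = k \<and> ok t \<and> take (length s) t = s)" for s
  have ok_take: "ok (take n t)" if "ok t" for n t
  proof -
    have "take m (take n t) = take m t" if "m \<le> length (take n t)" for m
      using that by (auto simp: take_take min_def split: if_splits)
    then show ?thesis using that unfolding ok_def by simp
  qed
  have g0: "good []"
    unfolding good_def
  proof (intro allI impI)
    fix k
    obtain s where "length s = k" "\<forall>i<k. s ! i \<le> b i" "\<forall>n\<le>k. P (take n s)"
      using assms[of k] by blast
    then show "\<exists>t. length t = k \<and> ok t \<and> take (length []) t = []"
      unfolding ok_def by (intro exI[of _ s]) simp
  qed
  have step: "\<exists>j. good (s @ [j])" if "good s" for s
  proof (rule ccontr)
    assume "\<nexists>j. good (s @ [j])"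
    then have ng: "\<not> good (s @ [j])" for j by blast
    have "\<forall>j. \<exists>k. k \<ge> Suc (length s) \<and>
        (\<forall>t. length t = k \<longrightarrow> ok t \<longrightarrow> take (Suc (length s)) t \<noteq> s @ [j])"
    proof
      fix j
      show "\<exists>k. k \<ge> Suc (length s) \<and>
        (\<forall>t. length t = k \<longrightarrow> ok t \<longrightarrow> take (Suc (length s)) t \<noteq> s @ [j])"
        using ng[of j] unfolding good_def length_append_singleton by blast
    qed
    then obtain k where kk: "\<forall>j. k j \<ge> Suc (length s) \<and>
        (\<forall>t. length t = k j \<longrightarrow> ok t \<longrightarrow> take (Suc (length s)) t \<noteq> s @ [j])"
      by (rule exE[OF choice])
    have k: "k j \<ge> Suc (length s)"
      "length t = k j \<Longrightarrow> ok t \<Longrightarrow> take (Suc (length s)) t \<noteq> s @ [j]" for j t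
      using spec[OF kk, of j] by auto
    \<comment> \<open>If no child of \<open>s\<close> is \<open>good\<close>, child \<open>j\<close>
      has no admissible extension of length \<open>k j\<close>. Only the finitely many
      \<open>j \<le> b (length s)\<close> can occur, and an admissible extension of \<open>s\<close>
      of length \<open>K\<close> passes through one of them.\<close>
    define K where "K = Max (k ` {..b (length s)})"
    have K: "k j \<le> K" if "j \<le> b (length s)" for j
      unfolding K_def using that by (intro Max_ge) auto
    have "K \<ge> Suc (length s)" using k(1)[of 0] K[of 0] by simp
    then obtain t where t: "length t = K" "ok t" "take (length s) t = s"
      using that \<open>good s\<close> unfolding good_def by (metis Suc_leD)
    define j where "j = t ! length s"
    have j: "j \<le> b (length s)" using t \<open>K \<ge> Suc (length s)\<close> unfolding ok_def j_def by auto
    have "take (Suc (length s)) (take (k j) t) = s @ [j]"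
      using t k(1)[of j] \<open>K \<ge> Suc (length s)\<close>
      by (simp add: min_def take_Suc_conv_app_nth j_def)
    moreover have "length (take (k j) t) = k j" using K[OF j] t by simp
    ultimately show False using k(2)[of "take (k j) t" j] ok_take[OF t(2)] by blast
  qed
  have "\<exists>f. \<forall>n. (length (f n) = n \<and> good (f n)) \<and> (\<exists>j. f (Suc n) = f n @ [j])"
    using g0 step by (intro dependent_nat_choice) (auto, metis length_append_singleton)
  then obtain f where f: "\<And>n. length (f n) = n" "\<And>n. good (f n)" "\<And>n. \<exists>j. f (Suc n) = f n @ [j]"
    by blast
  define w where "w n = f (Suc n) ! n" for n
  have w: "initial_segment w n = f n" for n
  proof (induction n)
    case (Suc n)
    obtain j where j: "f (Suc n) = f n @ [j]" using f(3) by blast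
    then have "w n = j" by (simp add: w_def nth_append f(1))
    then show ?case using j Suc by (simp add: initial_segment_Suc)
  next
    case 0
    show ?case using f(1)[of 0] by simp
  qed
  have okf: "ok (f n)" for n
    using f(1)[of n] f(2)[of n] unfolding good_def by (metis order_refl take_all_iff)
  have "w i \<le> b i" for i
    using okf[of "Suc i"] f(1)[of "Suc i"] unfolding ok_def w_def by simp
  moreover have "P (initial_segment w n)" for n
    using okf[of n] f(1)[of n] unfolding ok_def w by (metis order_refl take_all_iff)
  ultimately show ?thesis by blast
qed

text \<open>The projection of a closed set along a non-compact fibre is exhausted from inside by
  projections of its compact parts, since outer measures are continuous along increasing unions.\<close>

lemma tree_proj_inner_approx:
  assumes T: "\<And>s. T s \<in> sets M"
    and a: "a < outer_measure_of M (tree_proj M T [])"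
    and "finite_measure M"
  obtains K where "K \<in> sets M" "K \<subseteq> tree_proj M T []" "a \<le> emeasure M K"
proof -
  interpret finite_measure M by fact
  \<comment> \<open>Only the first \<open>length l\<close> entries of a branch are bounded. As the
    bound on the next entry grows, these sets exhaust \<open>E l\<close>, so an outer measure above
    \<open>a\<close> survives a suitable choice of each bound in turn.\<close>
  define E where "E l = {x\<in>space M. \<exists>w\<in>tree_body T x. \<forall>i<length l. w i \<le> l ! i}" for l :: "nat list"
  have Esp: "E l \<subseteq> space M" for l by (auto simp: E_def)
  have E0: "E [] = tree_proj M T []" by (auto simp: E_def tree_proj_def tree_sect_def)
  have step: "\<exists>m. a < outer_measure_of M (E (l @ [m]))" if "a < outer_measure_of M (E l)" for l
  proof -
    have "E l = (\<Union>m. E (l @ [m]))"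
    proof (intro equalityI subsetI)
      fix x assume "x \<in> E l"
      then obtain w where "x \<in> space M" "w \<in> tree_body T x" "\<forall>i<length l. w i \<le> l ! i"
        unfolding E_def by blast
      then have "x \<in> E (l @ [w (length l)])"
        by (auto simp: E_def nth_append less_Suc_eq intro!: bexI[of _ w])
      then show "x \<in> (\<Union>m. E (l @ [m]))" by blast
    next
      fix x assume "x \<in> (\<Union>m. E (l @ [m]))"
      then obtain m w where w: "x \<in> space M" "w \<in> tree_body T x"
          "\<And>i. i < Suc (length l) \<Longrightarrow> w i \<le> (l @ [m]) ! i"
        unfolding E_def by auto
      have "w i \<le> l ! i" if "i < length l" for i
        using w(3)[of i] that by (simp add: nth_append)
      then show "x \<in> E l" using w unfolding E_def by blast
    qed
    moreover have "incseq (\<lambda>m. E (l @ [m]))"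
    proof (rule incseq_SucI)
      fix m
      have "(l @ [m]) ! i \<le> (l @ [Suc m]) ! i" if "i < length (l @ [m])" for i
        using that by (cases "i < length l") (auto simp: nth_append)
      then show "E (l @ [m]) \<subseteq> E (l @ [Suc m])"
        unfolding E_def by (auto dest: order_trans)
    qed
    ultimately have "outer_measure_of M (E l) = (SUP m. outer_measure_of M (E (l @ [m])))"
      using SUP_outer_measure_of_incseq[of "\<lambda>m. E (l @ [m])" M] Esp by metis
    with that show ?thesis by (simp add: less_SUP_iff)
  qed
  have "\<exists>f. \<forall>n. (length (f n) = n \<and> a < outer_measure_of M (E (f n))) \<and> (\<exists>j. f (Suc n) = f n @ [j])"
    using a step by (intro dependent_nat_choice) (auto simp: E0, metis length_append_singleton)
  then obtain f where f: "\<And>n. length (f n) = n" "\<And>n. a < outer_measure_of M (E (f n))"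
      "\<And>n. \<exists>j. f (Suc n) = f n @ [j]"
    by blast
  define b where "b n = f (Suc n) ! n" for n
  have b: "f n = initial_segment b n" for n
  proof (induction n)
    case (Suc n)
    obtain j where j: "f (Suc n) = f n @ [j]" using f(3) by blast
    then have "b n = j" by (simp add: b_def nth_append f(1))
    then show ?case using j Suc by (simp add: initial_segment_Suc)
  next
    case 0
    show ?case using f(1)[of 0] by simp
  qed
  define L where "L k = {s. length s = k \<and> (\<forall>i<k. s ! i \<le> b i)}" for k
  have finL: "finite (L k)" for k
  proof -
    have "L k \<subseteq> {s. set s \<subseteq> {..\<Sum>i<k. b i} \<and> length s = k}"
    proof
      fix s assume s: "s \<in> L k"
      have "s ! i \<le> (\<Sum>i<k. b i)" if "i < k" for i
        using s that member_le_sum[of i "{..<k}" b] unfolding L_def by fastforce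
      then show "s \<in> {s. set s \<subseteq> {..\<Sum>i<k. b i} \<and> length s = k}"
        using s unfolding L_def by (fastforce simp: in_set_conv_nth)
    qed
    then show ?thesis
      using finite_lists_length_eq[of "{..\<Sum>i<k. b i}" k] finite_subset by blast
  qed
  \<comment> \<open>A measurable set containing \<open>E (f k)\<close>: it asks for a bounded
    sequence of length \<open>k\<close> instead of a branch. Finiteness of the measure carries the
    estimate to the intersection, where \<open>bounded_branch\<close> recovers a branch.\<close>
  define S where "S k = (\<Union>s\<in>L k. \<Inter>n\<in>{..k}. T (take n s))" for k
  have S: "S k \<in> sets M" for k
    unfolding S_def using finL T by (intro sets.finite_UN sets.finite_INT) auto
  have dec: "decseq S"
  proof (rule decseq_SucI)
    fix k show "S (Suc k) \<subseteq> S k"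
    proof
      fix x assume "x \<in> S (Suc k)"
      then obtain s where s: "s \<in> L (Suc k)" "\<And>n. n \<le> Suc k \<Longrightarrow> x \<in> T (take n s)"
        unfolding S_def by auto
      then have "take k s \<in> L k" by (auto simp: L_def)
      moreover have "x \<in> T (take n (take k s))" if "n \<le> k" for n
        using s(2)[of n] that by (simp add: min_absorb1)
      ultimately show "x \<in> S k" unfolding S_def by blast
    qed
  qed
  have ES: "E (f k) \<subseteq> S k" for k
  proof
    fix x assume "x \<in> E (f k)"
    then obtain w where w: "w \<in> tree_body T x" "\<forall>i<k. w i \<le> b i"
      unfolding E_def b by auto
    then have "initial_segment w k \<in> L k" by (simp add: L_def)
    moreover have "\<forall>n\<le>k. x \<in> T (take n (initial_segment w k))"
      using w(1) by (simp add: take_initial_segment tree_body_def)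
    ultimately show "x \<in> S k" unfolding S_def by blast
  qed
  have "a \<le> emeasure M (S k)" for k
  proof -
    have "a < outer_measure_of M (E (f k))" by (rule f)
    also have "\<dots> \<le> outer_measure_of M (S k)" by (rule outer_measure_of_mono[OF ES])
    finally show ?thesis using S by simp
  qed
  then have "a \<le> (INF k. emeasure M (S k))" by (rule INF_greatest)
  also have "\<dots> = emeasure M (\<Inter>k. S k)"
    using S dec by (intro INF_emeasure_decseq) auto
  finally have "a \<le> emeasure M (\<Inter>k. S k)" .
  moreover have "(\<Inter>k. S k) \<subseteq> tree_proj M T []"
  proof
    fix x assume x: "x \<in> (\<Inter>k. S k)"
    then have "x \<in> S 0" by blast
    then have "x \<in> space M" using S sets.sets_into_space by blast
    have "\<exists>s. length s = k \<and> (\<forall>i<k. s ! i \<le> b i) \<and> (\<forall>n\<le>k. x \<in> T (take n s))" for k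
    proof -
      have "x \<in> S k" using x by blast
      then obtain s where "s \<in> L k" "x \<in> (\<Inter>n\<in>{..k}. T (take n s))" unfolding S_def by blast
      then show ?thesis unfolding L_def by (intro exI[of _ s]) simp
    qed
    from bounded_branch[OF this] obtain w where "\<forall>n. x \<in> T (initial_segment w n)" by blast
    then show "x \<in> tree_proj M T []"
      using \<open>x \<in> space M\<close> by (auto simp: tree_proj_def tree_sect_def tree_body_def)
  qed
  moreover have "(\<Inter>k. S k) \<in> sets M" using S by (intro sets.countable_INT) auto
  ultimately show thesis using that by blast
qed

text \<open>The projection lies between a measurable hull of the same outer measure and measurable
  subsets of almost that measure. The gap is null, and completeness makes what remains of the
  projection measurable.\<close>

lemma tree_proj_sets_Nil:
  assumes T: "\<And>s. T s \<in> sets M" and "finite_measure M" "complete_measure M"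
  shows "tree_proj M T [] \<in> sets M"
proof -
  interpret finite_measure M by fact
  interpret complete_measure M by fact
  let ?P = "tree_proj M T []"
  have Psp: "?P \<subseteq> space M" by (auto simp: tree_proj_def)
  obtain B where B: "B \<in> sets M" "?P \<subseteq> B" "outer_measure_of M ?P = emeasure M B"
    using outer_measure_of_attain[OF Psp] by blast
  define \<L> where "\<L> = {K \<in> sets M. K \<subseteq> ?P}"
  have "\<exists>K\<in>sets M. K \<subseteq> ?P \<and> measure M B \<le> measure M K + 1 / Suc n" for n
  proof (cases "measure M B \<le> 1 / Suc n")
    case True
    then show ?thesis by (intro bexI[of _ "{}"]) auto
  next
    case False
    then have "0 < measure M B" by (smt (verit) divide_nonneg_nonneg of_nat_0_le_iff)
    then have lt: "ennreal (measure M B - 1 / Suc n) < outer_measure_of M ?P"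
      unfolding B(3) emeasure_eq_measure using False by (intro ennreal_lessI) auto
    obtain K where K: "K \<in> sets M" "K \<subseteq> ?P" "ennreal (measure M B - 1 / Suc n) \<le> emeasure M K"
      by (rule tree_proj_inner_approx[OF T lt \<open>finite_measure M\<close>])
    from K(3) have "measure M B - 1 / Suc n \<le> measure M K"
      unfolding emeasure_eq_measure ennreal_le_iff[OF measure_nonneg] .
    then have "measure M B \<le> measure M K + 1 / Suc n" by linarith
    then show ?thesis using K(1,2) by blast
  qed
  then obtain K where K: "\<And>n. K n \<in> sets M" "\<And>n. K n \<subseteq> ?P"
    "\<And>n. measure M B \<le> measure M (K n) + 1 / Suc n" by metis
  define L where "L = (\<Union>n. K n)"
  have L: "L \<in> sets M" "L \<subseteq> ?P" using K unfolding L_def by auto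
  have "measure M B \<le> measure M L + 1 / Suc n" for n
    using K(3)[of n] finite_measure_mono[of "K n" L] L(1) by (fastforce simp: L_def)
  then have "measure M B \<le> measure M L + 0"
    by (intro LIMSEQ_le_const[OF tendsto_add[OF tendsto_const LIMSEQ_Suc[OF lim_1_over_n]]]) auto
  moreover have "measure M (B - L) = measure M B - measure M L"
    using L B by (intro finite_measure_Diff) auto
  ultimately have "measure M (B - L) = 0" using measure_nonneg[of M "B - L"] by linarith
  then have "B - L \<in> null_sets M" using B L by (auto simp: null_sets_def emeasure_eq_measure)
  then have "?P - L \<in> sets M" using B(2) by (intro complete[of _ "B - L"]) auto
  then have "L \<union> (?P - L) \<in> sets M" by (rule sets.Un[OF L(1)])
  moreover have "L \<union> (?P - L) = ?P" using L(2) by blast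
  ultimately show ?thesis by simp
qed

lemma tree_proj_sets:
  assumes T: "\<And>s. T s \<in> sets M" and M: "finite_measure M" "complete_measure M"
  shows "tree_proj M T s \<in> sets M"
proof -
  \<comment> \<open>Discarding the nodes incomparable with \<open>s\<close> leaves exactly the
    branches through \<open>s\<close>, which reduces the claim to the root.\<close>
  define T' where "T' t = (if take (length t) s = take (length s) t then T t else {})" for t
  have "tree_sect T s x = tree_body T' x" for x
  proof -
    have "(initial_segment w (length s) = s) = (\<forall>n. take n s = take (length s) (initial_segment w n))" for w
    proof
      assume "initial_segment w (length s) = s"
      then have "take n s = initial_segment w (min n (length s))" for n
        by (metis take_initial_segment)
      then show "\<forall>n. take n s = take (length s) (initial_segment w n)"
        by (simp add: take_initial_segment min.commute)
    next
      assume "\<forall>n. take n s = take (length s) (initial_segment w n)"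
      from spec[OF this, of "length s"] show "initial_segment w (length s) = s"
        by (simp add: take_initial_segment)
    qed
    then show ?thesis
      unfolding tree_sect_def tree_body_def T'_def by auto
  qed
  then have "tree_proj M T s = tree_proj M T' []"
    by (simp add: tree_proj_def tree_sect_def)
  also have "\<dots> \<in> sets M"
    using T M by (intro tree_proj_sets_Nil) (auto simp: T'_def)
  finally show ?thesis .
qed

section \<open>Nodes that determine the point of the section\<close>

definition single_nodes :: "'a measure \<Rightarrow> (nat list \<Rightarrow> 'a set) \<Rightarrow> nat list \<Rightarrow> 'a set" where
  "single_nodes M T s = {x \<in> space M. is_singleton (evens ` tree_sect T s x)}"

definition single_value :: "'a measure \<Rightarrow> (nat list \<Rightarrow> 'a set) \<Rightarrow> nat list \<Rightarrow> 'a \<Rightarrow> nat \<Rightarrow> nat" where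
  "single_value M T s x =
     (if x \<in> single_nodes M T s then the_elem (evens ` tree_sect T s x) else (\<lambda>_. 0))"

lemma single_value_eq:
  "x \<in> single_nodes M T s \<Longrightarrow> evens ` tree_sect T s x = {single_value M T s x}"
  by (simp add: single_nodes_def single_value_def is_singleton_the_elem)

lemma single_nodesI:
  assumes "x \<in> space M" "w \<in> tree_sect T s x"
    and "\<And>w'. w' \<in> tree_sect T s x \<Longrightarrow> evens w' = evens w"
  shows "x \<in> single_nodes M T s"
proof -
  have "evens ` tree_sect T s x \<subseteq> {evens w}"
  proof (rule image_subsetI)
    fix w' assume "w' \<in> tree_sect T s x"
    from assms(3)[OF this] show "evens w' \<in> {evens w}" by (rule ssubst) (rule singletonI)
  qed
  then have "evens ` tree_sect T s x = {evens w}" using imageI[OF assms(2), of evens] by blast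
  then show ?thesis using assms(1) by (simp add: single_nodes_def)
qed

lemma tree_sect_antimono:
  assumes "take (length s) u = s" "length s \<le> length u"
  shows "tree_sect T u x \<subseteq> tree_sect T s x"
proof
  fix w assume w: "w \<in> tree_sect T u x"
  have "initial_segment w (length s) = take (length s) (initial_segment w (length u))"
    using assms(2) by (simp add: take_initial_segment min_absorb1)
  then show "w \<in> tree_sect T s x" using w assms(1) by (simp add: tree_sect_def)
qed

lemma tree_sect_split:
  assumes "w \<in> tree_sect T s x"
  shows "w \<in> tree_sect T (initial_segment w n) x"
  using assms by (simp add: tree_sect_def)

lemma initial_segment_extends:
  assumes "w \<in> tree_sect T s x" "length s \<le> n"
  shows "take (length s) (initial_segment w n) = s"
  using assms by (simp add: tree_sect_def take_initial_segment min_absorb1)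

lemma evens_tree_sect:
  assumes "w \<in> tree_sect T u x" "2 * k < length u"
  shows "evens w k = u ! (2 * k)"
proof -
  have "initial_segment w (length u) ! (2 * k) = w (2 * k)" using assms(2) by simp
  then show ?thesis using assms(1) by (simp add: tree_sect_def evens_def)
qed

text \<open>Two branches through \<open>s\<close> with different even parts separate at a finite
  level. Failure of single-valuedness is therefore a countable union of intersections of
  projections, which is what makes these sets measurable.\<close>

lemma single_nodes_eq:
  "single_nodes M T s = tree_proj M T s -
     (\<Union>(u, v, k) \<in> {(u, v, k). take (length s) u = s \<and> take (length s) v = s \<and>
        length s \<le> length u \<and> length s \<le> length v \<and>
        2 * k < length u \<and> 2 * k < length v \<and> u ! (2 * k) \<noteq> v ! (2 * k)}.
      tree_proj M T u \<inter> tree_proj M T v)" (is "_ = _ - (\<Union>p\<in>?I. ?F p)")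
proof (rule Set.set_eqI)
  fix x
  have "x \<notin> single_nodes M T s \<longleftrightarrow> (\<exists>u v k. (u, v, k) \<in> ?I \<and> x \<in> tree_proj M T u \<inter> tree_proj M T v)"
    if x: "x \<in> tree_proj M T s"
  proof
    assume ns: "x \<notin> single_nodes M T s"
    obtain w where w: "w \<in> tree_sect T s x" "x \<in> space M"
      using x by (auto simp: tree_proj_def)
    obtain w' where w': "w' \<in> tree_sect T s x" "evens w' \<noteq> evens w"
      using single_nodesI[OF w(2,1)] ns by metis
    from w'(2) obtain k where k: "evens w' k \<noteq> evens w k" by (auto simp: fun_eq_iff)
    define n where "n = max (length s) (Suc (2 * k))"
    let ?u = "initial_segment w n" and ?v = "initial_segment w' n"
    have n: "length s \<le> n" "2 * k < n" by (auto simp: n_def)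
    have "(?u, ?v, k) \<in> ?I"
      using initial_segment_extends[OF w(1) n(1)] initial_segment_extends[OF w'(1) n(1)] n k
      by (simp add: evens_def)
    moreover have "x \<in> tree_proj M T ?u \<inter> tree_proj M T ?v"
      using tree_sect_split[OF w(1), of n] tree_sect_split[OF w'(1), of n] w(2)
      unfolding tree_proj_def by blast
    ultimately show "\<exists>u v k. (u, v, k) \<in> ?I \<and> x \<in> tree_proj M T u \<inter> tree_proj M T v"
      by blast
  next
    assume "\<exists>u v k. (u, v, k) \<in> ?I \<and> x \<in> tree_proj M T u \<inter> tree_proj M T v"
    then obtain u v k where I: "take (length s) u = s" "take (length s) v = s"
        "length s \<le> length u" "length s \<le> length v"
        "2 * k < length u" "2 * k < length v" "u ! (2 * k) \<noteq> v ! (2 * k)"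
        and uv: "x \<in> tree_proj M T u" "x \<in> tree_proj M T v"
      by auto
    from uv obtain w w' where w: "w \<in> tree_sect T u x" "w' \<in> tree_sect T v x"
      by (auto simp: tree_proj_def)
    have "evens w \<noteq> evens w'"
      using evens_tree_sect[OF w(1) I(5)] evens_tree_sect[OF w(2) I(6)] I(7) by auto
    moreover have "w \<in> tree_sect T s x" by (rule subsetD[OF tree_sect_antimono[OF I(1,3)] w(1)])
    moreover have "w' \<in> tree_sect T s x" by (rule subsetD[OF tree_sect_antimono[OF I(2,4)] w(2)])
    ultimately show "x \<notin> single_nodes M T s"
      using single_value_eq[of x M T s] by (metis image_eqI singletonD)
  qed
  moreover have "x \<in> single_nodes M T s \<Longrightarrow> x \<in> tree_proj M T s"
    by (auto simp: single_nodes_def tree_proj_def is_singleton_def)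
  ultimately show "x \<in> single_nodes M T s \<longleftrightarrow> x \<in> tree_proj M T s - (\<Union>p\<in>?I. ?F p)"
    by fast
qed

lemma single_nodes_sets:
  assumes T: "\<And>s. T s \<in> sets M" and M: "finite_measure M" "complete_measure M"
  shows "single_nodes M T s \<in> sets M"
proof -
  have "tree_proj M T u \<in> sets M" for u by (rule tree_proj_sets[OF T M])
  then show ?thesis
    unfolding single_nodes_eq by (intro sets.Diff sets.countable_UN') (auto intro!: sets.Int)
qed

text \<open>At a single-valued node, coordinate \<open>k\<close> of the value is \<open>j\<close>
  exactly if a branch passes through some node that extends \<open>s\<close> and has entry
  \<open>j\<close> at place \<open>2 * k\<close>; this is a condition on countably many
  projections.\<close>

lemma single_value_measurable:
  assumes T: "\<And>s. T s \<in> sets M" and M: "finite_measure M" "complete_measure M"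
  shows "single_value M T s \<in> M \<rightarrow>\<^sub>M baire_sets"
proof (rule measurable_PiM_single'[where f = "\<lambda>k x. single_value M T s x k"])
  fix k :: nat
  let ?I = "\<lambda>j. {u. take (length s) u = s \<and> length s \<le> length u \<and> 2 * k < length u \<and> u ! (2 * k) = j}"
  have P: "tree_proj M T u \<in> sets M" for u by (rule tree_proj_sets[OF T M])
  have S: "single_nodes M T s \<in> sets M" by (rule single_nodes_sets[OF T M])
  have eq: "(\<lambda>x. single_value M T s x k) -` {j} \<inter> space M =
      (single_nodes M T s \<inter> (\<Union>u\<in>?I j. tree_proj M T u)) \<union> (if j = 0 then space M - single_nodes M T s else {})" for j
  proof -
    have *: "single_value M T s x k = j \<longleftrightarrow> (\<exists>u\<in>?I j. x \<in> tree_proj M T u)"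
      if x: "x \<in> single_nodes M T s" for x
    proof
      assume j: "single_value M T s x k = j"
      obtain w where w: "w \<in> tree_sect T s x" "evens w = single_value M T s x"
        using single_value_eq[OF x] by blast
      define n where "n = max (length s) (Suc (2 * k))"
      have n: "length s \<le> n" "2 * k < n" by (auto simp: n_def)
      have "initial_segment w n \<in> ?I j"
        using initial_segment_extends[OF w(1) n(1)] n j fun_cong[OF w(2), of k] by (simp add: evens_def)
      moreover have "x \<in> tree_proj M T (initial_segment w n)"
        using tree_sect_split[OF w(1), of n] x unfolding tree_proj_def single_nodes_def by blast
      ultimately show "\<exists>u\<in>?I j. x \<in> tree_proj M T u" by blast
    next
      assume "\<exists>u\<in>?I j. x \<in> tree_proj M T u"
      then obtain u w where u: "take (length s) u = s" "length s \<le> length u" "2 * k < length u" "u ! (2 * k) = j"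
        and w: "w \<in> tree_sect T u x"
        by (auto simp: tree_proj_def)
      have "evens w = single_value M T s x"
        using subsetD[OF tree_sect_antimono[OF u(1,2)] w] single_value_eq[OF x] by blast
      then show "single_value M T s x k = j"
        using evens_tree_sect[OF w u(3)] u(4) by simp
    qed
    have sub: "single_nodes M T s \<subseteq> space M" by (auto simp: single_nodes_def)
    have "x \<in> (\<lambda>x. single_value M T s x k) -` {j} \<inter> space M \<longleftrightarrow>
      x \<in> (single_nodes M T s \<inter> (\<Union>u\<in>?I j. tree_proj M T u)) \<union> (if j = 0 then space M - single_nodes M T s else {})" for x
    proof (cases "x \<in> single_nodes M T s")
      case True
      then show ?thesis using *[OF True] sub by auto
    next
      case False
      then show ?thesis by (auto simp: single_value_def)
    qed
    then show ?thesis by blast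
  qed
  show "(\<lambda>x. single_value M T s x k) \<in> M \<rightarrow>\<^sub>M count_space UNIV"
  proof (subst measurable_count_space_eq2_countable, intro conjI ballI)
    fix j
    have "single_nodes M T s \<inter> (\<Union>u\<in>?I j. tree_proj M T u) \<in> sets M"
      by (intro sets.Int S sets.countable_UN') (use P in auto)
    then show "(\<lambda>x. single_value M T s x k) -` {j} \<inter> space M \<in> sets M"
      unfolding eq using S by auto
  qed auto
qed auto

text \<open>A diagonal argument: if \<open>y\<close> enumerates the even parts, each node with a
  branch has an extension all of whose branches miss \<open>y n\<close>. Doing this for every
  \<open>n\<close> in turn leads to a branch whose even part the enumeration omits.\<close>

lemma no_single_node_uncountable:
  assumes c: "countable (evens ` tree_body T x)"
    and br: "\<And>s w. w \<in> tree_sect T s x \<Longrightarrow> \<exists>w'\<in>tree_sect T s x. evens w' \<noteq> evens w"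
  shows "tree_body T x = {}"
proof (rule ccontr)
  assume ne: "tree_body T x \<noteq> {}"
  then obtain y :: "nat \<Rightarrow> nat \<Rightarrow> nat" where y: "evens ` tree_body T x = range y"
    using c by (metis image_is_empty range_from_nat_into)
  \<comment> \<open>Besides disagreeing with \<open>y n\<close> at an even place, \<open>u\<close>
    is strictly longer than \<open>s\<close>, so that the nodes chosen converge to a branch.\<close>
  let ?R = "\<lambda>n s u. take (length s) u = s \<and> length s < length u \<and>
      (\<exists>k. 2 * k < length u \<and> u ! (2 * k) \<noteq> y n k)"
  have step: "\<exists>u. tree_sect T u x \<noteq> {} \<and> ?R n s u" if ns: "tree_sect T s x \<noteq> {}" for s n
  proof -
    have "\<exists>w\<in>tree_sect T s x. evens w \<noteq> y n" using ns br by (metis ex_in_conv)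
    then obtain w k where w: "w \<in> tree_sect T s x" "evens w k \<noteq> y n k" by blast
    define m where "m = max (Suc (length s)) (Suc (2 * k))"
    have m: "length s < m" "2 * k < m" by (auto simp: m_def)
    then have "?R n s (initial_segment w m)"
      using w(2) initial_segment_extends[OF w(1), of m] by (auto simp: evens_def)
    moreover have "tree_sect T (initial_segment w m) x \<noteq> {}"
      using tree_sect_split[OF w(1)] by blast
    ultimately show ?thesis by blast
  qed
  have s0: "tree_sect T [] x \<noteq> {}" using ne by (simp add: tree_sect_def)
  have "\<exists>u. \<forall>n. tree_sect T (u n) x \<noteq> {} \<and> ?R n (u n) (u (Suc n))"
    using s0 step by (intro dependent_nat_choice) blast+
  then obtain u where u: "\<And>n. tree_sect T (u n) x \<noteq> {}" "\<And>n. ?R n (u n) (u (Suc n))" by blast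
  have len: "n \<le> length (u n)" for n
  proof (induction n)
    case (Suc n)
    then show ?case using u(2)[of n] by simp
  qed simp
  have ext: "take (length (u n)) (u (n + m)) = u n \<and> length (u n) \<le> length (u (n + m))" for n m
  proof (induction m)
    case (Suc m)
    have a: "take (length (u (n + m))) (u (Suc (n + m))) = u (n + m)" "length (u (n + m)) < length (u (Suc (n + m)))"
      using u(2)[of "n + m"] by blast+
    have "take (length (u n)) (u (Suc (n + m))) = take (length (u n)) (take (length (u (n + m))) (u (Suc (n + m))))"
      using Suc by (simp add: min_absorb1)
    then show ?case using a Suc by simp
  qed simp
  define w where "w i = u (Suc i) ! i" for i
  have w: "w i = u n ! i" if "i < length (u n)" for i n
  proof (cases "n \<le> Suc i")
    case True
    then obtain m where "Suc i = n + m" using le_Suc_ex by blast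
    then show ?thesis using ext[of n m] that unfolding w_def by (metis nth_take)
  next
    case False
    then obtain m where "n = Suc i + m" using le_Suc_ex by (metis nat_le_linear)
    then show ?thesis using ext[of "Suc i" m] len[of "Suc i"] unfolding w_def by (metis Suc_le_lessD nth_take)
  qed
  have seg: "initial_segment w n = take n (u n)" for n
    using len[of n] w[of _ n] by (auto simp: list_eq_iff_nth_eq)
  \<comment> \<open>Each \<open>u n\<close> lies on a true branch \<open>v\<close>, which supplies
    the membership for all initial segments of \<open>u n\<close>.\<close>
  have "x \<in> T (initial_segment w n)" for n
  proof -
    obtain v where v: "v \<in> tree_body T x" "initial_segment v (length (u n)) = u n"
      using u(1)[of n] by (auto simp: tree_sect_def)
    have "initial_segment w n = take n (initial_segment v (length (u n)))" by (simp add: seg v(2))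
    also have "\<dots> = initial_segment v n" using len[of n] by (simp add: take_initial_segment min_absorb1)
    finally show ?thesis using v(1) by (simp add: tree_body_def)
  qed
  then have "w \<in> tree_body T x" by (simp add: tree_body_def)
  then obtain n where n: "evens w = y n" using y by blast
  obtain k where "2 * k < length (u (Suc n))" "u (Suc n) ! (2 * k) \<noteq> y n k" using u(2)[of n] by blast
  then have "evens w k \<noteq> y n k" using w[of "2 * k" "Suc n"] by (simp add: evens_def)
  then show False using n by simp
qed

text \<open>The countable family \<open>\<F>\<close> of measurable partial sections accounts for
  every branch lost between \<open>T0\<close> and \<open>T\<close>, and takes values only in the
  projection of the original body. Once the body of \<open>T\<close> is almost surely empty,
  \<open>\<F>\<close> is a uniformisation almost everywhere.\<close>

definition graph_cover ::
    "'a measure \<Rightarrow> (nat list \<Rightarrow> 'a set) \<Rightarrow> (nat list \<Rightarrow> 'a set) \<Rightarrow>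
      ('a set \<times> ('a \<Rightarrow> nat \<Rightarrow> nat)) set \<Rightarrow> bool" where
  "graph_cover M T0 T \<F> \<longleftrightarrow> countable \<F> \<and>
     (\<forall>D f. (D, f) \<in> \<F> \<longrightarrow>
        D \<in> sets M \<and> f \<in> M \<rightarrow>\<^sub>M baire_sets \<and> (\<forall>x\<in>D. f x \<in> evens ` tree_body T0 x)) \<and>
     (\<forall>x\<in>space M. tree_body T x \<subseteq> tree_body T0 x) \<and>
     (\<forall>x\<in>space M. \<forall>w\<in>tree_body T0 x - tree_body T x. \<exists>D f. (D, f) \<in> \<F> \<and> x \<in> D \<and> evens w = f x)"

definition graph_reduction ::
    "'a measure \<Rightarrow> (nat list \<Rightarrow> 'a set) \<Rightarrow> (nat list \<Rightarrow> 'a set) \<Rightarrow> bool" where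
  "graph_reduction M T0 T \<longleftrightarrow> (\<forall>s. T s \<in> sets M) \<and> (\<exists>\<F>. graph_cover M T0 T \<F>)"

lemma graph_coverD:
  assumes "graph_cover M T0 T \<F>"
  shows "countable \<F>"
    and "(D, f) \<in> \<F> \<Longrightarrow> D \<in> sets M"
    and "(D, f) \<in> \<F> \<Longrightarrow> f \<in> M \<rightarrow>\<^sub>M baire_sets"
    and "(D, f) \<in> \<F> \<Longrightarrow> x \<in> D \<Longrightarrow> f x \<in> evens ` tree_body T0 x"
    and "x \<in> space M \<Longrightarrow> tree_body T x \<subseteq> tree_body T0 x"
    and "x \<in> space M \<Longrightarrow> w \<in> tree_body T0 x \<Longrightarrow> w \<notin> tree_body T x \<Longrightarrow>
           \<exists>D f. (D, f) \<in> \<F> \<and> x \<in> D \<and> evens w = f x"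
  using assms unfolding graph_cover_def by (metis, metis, metis, metis, metis, auto)

lemma graph_reduction_sets: "graph_reduction M T0 T \<Longrightarrow> T s \<in> sets M"
  by (simp add: graph_reduction_def)

lemma graph_reduction_body:
  assumes "graph_reduction M T0 T" "x \<in> space M"
  shows "tree_body T x \<subseteq> tree_body T0 x"
  using assms graph_coverD(5) unfolding graph_reduction_def by metis

lemma graph_reduction_refl:
  assumes "\<And>s. T s \<in> sets M"
  shows "graph_reduction M T T"
proof -
  have "graph_cover M T T {}" by (simp add: graph_cover_def)
  then show ?thesis using assms unfolding graph_reduction_def by metis
qed

lemma tree_body_Inter: "tree_body (\<lambda>s. \<Inter>i. T i s) x = (\<Inter>i. tree_body (T i) x)"
  by (auto simp: tree_body_def)

text \<open>A branch missing from the intersection is missing from some \<open>T i\<close> and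
  covered by the family of that \<open>T i\<close>. This closure property stands in for the limit
  stages of a transfinite derivation.\<close>

lemma graph_reduction_Inter:
  assumes "\<And>i::nat. graph_reduction M T0 (T i)"
  shows "graph_reduction M T0 (\<lambda>s. \<Inter>i. T i s)"
proof -
  have "\<forall>i. \<exists>\<F>. graph_cover M T0 (T i) \<F>" using assms by (simp add: graph_reduction_def)
  then obtain \<F> where F: "\<forall>i. graph_cover M T0 (T i) (\<F> i)" by (rule exE[OF choice])
  note D = graph_coverD[OF spec[OF F]]
  have "graph_cover M T0 (\<lambda>s. \<Inter>i. T i s) (\<Union>i. \<F> i)"
    unfolding graph_cover_def
  proof (intro conjI allI impI ballI)
    show "countable (\<Union>i. \<F> i)" using D(1) by simp
    show "tree_body (\<lambda>s. \<Inter>i. T i s) x \<subseteq> tree_body T0 x" if "x \<in> space M" for x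
      using D(5)[OF that, of 0] by (auto simp: tree_body_Inter)
    show "\<exists>D f. (D, f) \<in> (\<Union>i. \<F> i) \<and> x \<in> D \<and> evens w = f x"
      if x: "x \<in> space M" and n: "w \<in> tree_body T0 x - tree_body (\<lambda>s. \<Inter>i. T i s) x" for x w
    proof -
      obtain i where i: "w \<notin> tree_body (T i) x" using n by (auto simp: tree_body_Inter)
      have "\<exists>D f. (D, f) \<in> \<F> i \<and> x \<in> D \<and> evens w = f x"
        using D(6)[OF x _ i] n by simp
      then show ?thesis by auto
    qed
    fix E f assume "(E, f) \<in> (\<Union>i. \<F> i)"
    then obtain i where i: "(E, f) \<in> \<F> i" by auto
    show "E \<in> sets M" "f \<in> M \<rightarrow>\<^sub>M baire_sets" by (rule D(2)[OF i] D(3)[OF i])+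
    show "f x \<in> evens ` tree_body T0 x" if "x \<in> E" for x
      by (rule D(4)[OF i that])
  qed
  moreover have "(\<Inter>i. T i s) \<in> sets M" for s
    using graph_reduction_sets[OF assms] by (intro sets.countable_INT) auto
  ultimately show ?thesis unfolding graph_reduction_def by metis
qed

text \<open>Every branch removed here passes through a single-valued node, so its even part is the
  value of that node; countably many nodes contribute countably many sections.\<close>

lemma graph_reduction_derivative:
  assumes red: "graph_reduction M T0 T" and M: "finite_measure M" "complete_measure M"
  shows "graph_reduction M T0 (\<lambda>s. T s - single_nodes M T s)"
proof -
  have T: "\<And>s. T s \<in> sets M" by (rule graph_reduction_sets[OF red])
  from red obtain \<F> where F: "graph_cover M T0 T \<F>" by (auto simp: graph_reduction_def)
  note D = graph_coverD[OF F]
  let ?G = "range (\<lambda>s. (single_nodes M T s, single_value M T s))"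
  have S: "single_nodes M T s \<in> sets M" for s by (rule single_nodes_sets[OF T M])
  have "graph_cover M T0 (\<lambda>s. T s - single_nodes M T s) (\<F> \<union> ?G)"
    unfolding graph_cover_def
  proof (intro conjI allI impI ballI)
    show "countable (\<F> \<union> ?G)" using D(1) by simp
    show "tree_body (\<lambda>s. T s - single_nodes M T s) x \<subseteq> tree_body T0 x" if "x \<in> space M" for x
      using D(5)[OF that] by (auto simp: tree_body_def)
    show "\<exists>D f. (D, f) \<in> \<F> \<union> ?G \<and> x \<in> D \<and> evens w = f x"
      if x: "x \<in> space M" and n: "w \<in> tree_body T0 x - tree_body (\<lambda>s. T s - single_nodes M T s) x" for x w
    proof (cases "w \<in> tree_body T x")
      case False
      then show ?thesis using D(6)[OF x _ False] n by auto
    next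
      case True
      then obtain k where k: "x \<in> single_nodes M T (initial_segment w k)"
        using n by (auto simp: tree_body_def)
      have "w \<in> tree_sect T (initial_segment w k) x" using True by (simp add: tree_sect_def)
      then have "evens w = single_value M T (initial_segment w k) x"
        using single_value_eq[OF k] by (metis image_eqI singletonD)
      then show ?thesis using k by auto
    qed
    fix E f assume Df: "(E, f) \<in> \<F> \<union> ?G"
    show "E \<in> sets M" using Df D(2) S by auto
    show "f \<in> M \<rightarrow>\<^sub>M baire_sets" using Df D(3) single_value_measurable[OF T M] by auto
    show "f x \<in> evens ` tree_body T0 x" if x: "x \<in> E" for x
    proof (cases "(E, f) \<in> \<F>")
      case True
      then show ?thesis using D(4) x by simp
    next
      case False
      then obtain s where s: "E = single_nodes M T s" "f = single_value M T s" using Df by auto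
      then have x': "x \<in> single_nodes M T s" using x by simp
      have "tree_sect T s x \<subseteq> tree_body T0 x"
        using D(5)[of x] x' by (auto simp: tree_sect_def single_nodes_def)
      then have "evens ` tree_sect T s x \<subseteq> evens ` tree_body T0 x" by (rule image_mono)
      then show ?thesis using single_value_eq[OF x'] s by simp
    qed
  qed
  moreover have "T s - single_nodes M T s \<in> sets M" for s using T S by auto
  ultimately show ?thesis unfolding graph_reduction_def by metis
qed

text \<open>A reduction that minimises the measures of the projections of all nodes at once is not
  changed, up to null sets, by removing single-valued nodes.  Its body is then almost surely empty,
  because a nonempty body all of whose nodes carry two values has an uncountable projection.\<close>

lemma graph_reduction_empty:
  assumes T0: "\<And>s. T0 s \<in> sets M" and M: "finite_measure M" "complete_measure M"
    and c: "\<And>x. x \<in> space M \<Longrightarrow> countable (evens ` tree_body T0 x)"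
  obtains T where "graph_reduction M T0 T" "AE x in M. tree_body T x = {}"
proof -
  interpret finite_measure M by fact
  define m where "m s = (INF T\<in>{T. graph_reduction M T0 T}. measure M (tree_proj M T s))" for s
  have bdd: "bdd_below ((\<lambda>T. measure M (tree_proj M T s)) ` {T. graph_reduction M T0 T})" for s
    by (rule bdd_belowI2[of _ 0]) simp
  have ne: "{T. graph_reduction M T0 T} \<noteq> {}"
    using graph_reduction_refl[of T0 M, OF T0] by (metis (mono_tags) empty_Collect_eq)
  have m_le: "m s \<le> measure M (tree_proj M T s)" if "graph_reduction M T0 T" for T s
    unfolding m_def by (rule cINF_lower[OF bdd]) (use that in simp)
  have "\<exists>T. graph_reduction M T0 T \<and> measure M (tree_proj M T s) < m s + 1 / Suc n" for s n
  proof (rule ccontr)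
    assume "\<not> ?thesis"
    then have "m s + 1 / Suc n \<le> m s"
      unfolding m_def by (intro cINF_greatest[OF ne]) (auto simp: not_less m_def)
    then show False by simp
  qed
  \<comment> \<open>The index \<open>i\<close> codes a node and an accuracy, so that one countable
    intersection is optimal at all nodes simultaneously.\<close>
  then have "\<forall>i. \<exists>T. graph_reduction M T0 T \<and> measure M (tree_proj M T (from_nat (fst (prod_decode i))))
      < m (from_nat (fst (prod_decode i))) + 1 / Suc (snd (prod_decode i))"
    by simp
  then obtain T where T: "\<forall>i. graph_reduction M T0 (T i) \<and>
      measure M (tree_proj M (T i) (from_nat (fst (prod_decode i))))
      < m (from_nat (fst (prod_decode i))) + 1 / Suc (snd (prod_decode i))"
    by (rule exE[OF choice])
  define U where "U s = (\<Inter>i. T i s)" for s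
  have redT: "graph_reduction M T0 (T i)" for i using T by simp
  have redU: "graph_reduction M T0 U"
    unfolding U_def by (rule graph_reduction_Inter[OF redT])
  have setsT: "T i s \<in> sets M" for i s by (rule graph_reduction_sets[OF redT])
  have setsU: "U s \<in> sets M" for s by (rule graph_reduction_sets[OF redU])
  have U_le: "measure M (tree_proj M U s) \<le> m s" for s
  proof (rule field_le_epsilon)
    fix e :: real assume "0 < e"
    then obtain n where n: "1 / Suc n < e" using nat_approx_posE by blast
    let ?i = "prod_encode (to_nat s, n)"
    have sub: "tree_proj M U s \<subseteq> tree_proj M (T ?i) s"
      unfolding tree_proj_def tree_sect_def U_def tree_body_Inter by auto
    have "measure M (tree_proj M U s) \<le> measure M (tree_proj M (T ?i) s)"
      by (rule finite_measure_mono[OF sub tree_proj_sets[OF setsT M]])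
    also have "\<dots> < m s + 1 / Suc n" using spec[OF T, of ?i] by simp
    finally show "measure M (tree_proj M U s) \<le> m s + e" using n by simp
  qed
  define V where "V s = U s - single_nodes M U s" for s
  have redV: "graph_reduction M T0 V"
    unfolding V_def by (rule graph_reduction_derivative[OF redU M])
  have setsV: "V s \<in> sets M" for s by (rule graph_reduction_sets[OF redV])
  \<comment> \<open>\<open>V\<close> is a reduction too, so its projections have measure at least
    \<open>m s\<close>, while those of \<open>U\<close> have at most this measure. The inclusion
    leaves only a null set between them.\<close>
  have "AE x in M. x \<in> tree_proj M U s \<longrightarrow> x \<in> tree_proj M V s" for s
  proof -
    have sub: "tree_proj M V s \<subseteq> tree_proj M U s"
      unfolding tree_proj_def tree_sect_def tree_body_def V_def by auto
    have sets: "tree_proj M V s \<in> sets M" "tree_proj M U s \<in> sets M"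
      by (rule tree_proj_sets[OF setsV M] tree_proj_sets[OF setsU M])+
    have "measure M (tree_proj M U s) \<le> measure M (tree_proj M V s)"
      using U_le[of s] m_le[OF redV, of s] by linarith
    moreover have "measure M (tree_proj M U s - tree_proj M V s) = measure M (tree_proj M U s) - measure M (tree_proj M V s)"
      by (rule finite_measure_Diff[OF sets(2,1) sub])
    ultimately have "measure M (tree_proj M U s - tree_proj M V s) = 0"
      using measure_nonneg[of M "tree_proj M U s - tree_proj M V s"] by linarith
    then have "tree_proj M U s - tree_proj M V s \<in> null_sets M"
      using sets by (simp add: null_sets_def emeasure_eq_measure)
    from AE_not_in[OF this] show ?thesis by eventually_elim blast
  qed
  then have "AE x in M. \<forall>s. x \<in> tree_proj M U s \<longrightarrow> x \<in> tree_proj M V s"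
    by (simp add: AE_all_countable)
  moreover have "AE x in M. x \<in> space M" by (rule AE_space)
  ultimately have "AE x in M. tree_body U x = {}"
  proof eventually_elim
    case (elim x)
    show ?case
    proof (rule no_single_node_uncountable)
      have "tree_body U x \<subseteq> tree_body T0 x"
        by (rule graph_reduction_body[OF redU elim(2)])
      then show "countable (evens ` tree_body U x)"
        using c[OF elim(2)] by (meson countable_subset image_mono)
      fix s w assume w: "w \<in> tree_sect U s x"
      then have "x \<in> tree_proj M U s" using elim(2) by (auto simp: tree_proj_def)
      then have "x \<in> tree_proj M V s" using elim(1) by blast
      then obtain v where v: "v \<in> tree_body V x" "initial_segment v (length s) = s"
        by (auto simp: tree_proj_def tree_sect_def)
      have "x \<in> V (initial_segment v (length s))" using v(1) unfolding tree_body_def by blast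
      then have ns: "x \<notin> single_nodes M U s" using v(2) by (simp add: V_def)
      show "\<exists>w'\<in>tree_sect U s x. evens w' \<noteq> evens w"
        using single_nodesI[OF elim(2) w] ns by metis
    qed
  qed
  then show thesis by (rule that[OF redU])
qed

section \<open>From the completion back to Borel sets\<close>

lemma completion_baire_measurable:
  assumes f: "f \<in> completion M \<rightarrow>\<^sub>M baire_sets" and D: "D \<in> sets (completion M)"
  shows "\<exists>E g. E \<in> sets M \<and> g \<in> M \<rightarrow>\<^sub>M baire_sets \<and> E \<subseteq> D \<and> (AE x in M. x \<in> D \<longrightarrow> x \<in> E) \<and>
    (\<forall>x\<in>E. g x = f x)"
proof -
  have "\<exists>h\<in>borel_measurable M. AE x in M. real (f x k) = h x" for k
  proof (rule completion_ex_borel_measurable_real)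
    have "(\<lambda>x. f x k) \<in> completion M \<rightarrow>\<^sub>M count_space UNIV"
      using measurable_component_singleton[of k UNIV "\<lambda>_. count_space UNIV"] f
      by (intro measurable_compose[OF f]) auto
    then show "(\<lambda>x. real (f x k)) \<in> borel_measurable (completion M)"
      by (rule measurable_compose) simp
  qed
  then obtain h where h: "\<And>k. h k \<in> borel_measurable M" "\<And>k. AE x in M. real (f x k) = h k x"
    by metis
  \<comment> \<open>The coordinates were replaced by real-valued functions; the floor returns to the
    naturals and loses nothing where \<open>h k x\<close> equals \<open>f x k\<close>.\<close>
  define g where "g x k = nat \<lfloor>h k x\<rfloor>" for x k
  have g: "g \<in> M \<rightarrow>\<^sub>M baire_sets"
  proof (rule measurable_PiM_single'[where f = "\<lambda>k x. g x k"])
    show "(\<lambda>x. g x k) \<in> M \<rightarrow>\<^sub>M count_space UNIV" for k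
      unfolding g_def using h(1)[of k] by measurable
  qed auto
  have "AE x in M. \<forall>k. real (f x k) = h k x" using h(2) by (simp add: AE_all_countable)
  then have "AE x in M. f x = g x"
    by eventually_elim (auto simp: g_def fun_eq_iff; metis floor_of_nat nat_int)
  then obtain N where N: "{x \<in> space M. \<not> f x = g x} \<subseteq> N" "N \<in> null_sets M"
    by (rule AE_E3) (auto simp: null_sets_def)
  \<comment> \<open>Both exceptional sets are cut off, the null part of \<open>D\<close> and a null
    set containing the points where \<open>f\<close> and \<open>g\<close> differ. Equality on
    \<open>E\<close> is then exact.\<close>
  define E where "E = main_part M D - N"
  have "AE x in M. x \<notin> null_part M D" by (rule AE_notin_null_part[OF D])
  moreover have "AE x in M. x \<notin> N" by (rule AE_not_in[OF N(2)])
  ultimately have "AE x in M. x \<in> D \<longrightarrow> x \<in> E"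
  proof eventually_elim
    case (elim x)
    then show ?case using main_part_null_part_Un[OF D] unfolding E_def by blast
  qed
  moreover have "E \<in> sets M" using N(2) D by (auto simp: E_def)
  moreover have "E \<subseteq> D" using main_part_null_part_Un[OF D] unfolding E_def by blast
  moreover have "g x = f x" if "x \<in> E" for x
  proof -
    have "x \<in> space M" using that \<open>E \<in> sets M\<close> sets.sets_into_space by blast
    then show ?thesis using N(1) that unfolding E_def by (metis (mono_tags, lifting) DiffD2 mem_Collect_eq subsetD)
  qed
  ultimately show ?thesis using g by (intro exI[of _ E] exI[of _ g]) simp
qed

text \<open>Projections are measurable only for the completion, so the reduction takes place there;
  afterwards each of the countably many partial sections is shrunk to a Borel one at the cost of a
  null set. Membership in \<open>B\<close> stays exact on every \<open>D k\<close>, only the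
  exhaustion holds almost everywhere.\<close>

theorem ae_countable_section_uniformization:
  assumes M: "finite_measure M" and B: "B \<in> sets (M \<Otimes>\<^sub>M baire_sets)"
    and c: "\<And>x. x \<in> space M \<Longrightarrow> countable {y. (x, y) \<in> B}"
  shows "\<exists>(D :: nat \<Rightarrow> 'a set) f. (\<forall>k. D k \<in> sets M \<and> f k \<in> M \<rightarrow>\<^sub>M baire_sets \<and> (\<forall>x\<in>D k. (x, f k x) \<in> B)) \<and>
    (AE x in M. \<forall>y. (x, y) \<in> B \<longrightarrow> (\<exists>k. x \<in> D k \<and> y = f k x))"
proof -
  interpret finite_measure M by fact
  obtain Q where Q: "closed_sections M Q"
    and BQ: "B = {(x, y). x \<in> space M \<and> (\<exists>w. Q x w \<and> evens w = y)}"
    using closed_projection_sets[OF B] unfolding closed_projection_def by (elim exE conjE) (rule that)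
  obtain T0 where T0': "range T0 \<subseteq> sets M"
    and QT: "\<forall>x\<in>space M. \<forall>w. Q x w \<longleftrightarrow> w \<in> tree_body T0 x"
    using Q unfolding closed_sections_def by metis
  have T0: "\<And>s. T0 s \<in> sets M" using T0' by auto
  have BT: "(x, y) \<in> B \<longleftrightarrow> y \<in> evens ` tree_body T0 x" if "x \<in> space M" for x y
    using that QT by (auto simp: BQ)
  let ?N = "completion M"
  have N: "finite_measure ?N" "complete_measure ?N"
    by (auto intro!: finite_measureI completion.complete_measure_axioms)
  have z: "(\<lambda>_ _. 0) \<in> ?N \<rightarrow>\<^sub>M baire_sets" by (rule measurable_const) (simp add: space_PiM)
  have T0N: "T0 s \<in> sets ?N" for s using T0 by simp
  have cN: "countable (evens ` tree_body T0 x)" if "x \<in> space ?N" for x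
  proof -
    have x: "x \<in> space M" using that by simp
    have "evens ` tree_body T0 x = {y. (x, y) \<in> B}" using BT[OF x] by auto
    then show ?thesis using c[OF x] by simp
  qed
  obtain T where T: "graph_reduction ?N T0 T" "AE x in ?N. tree_body T x = {}"
    by (rule graph_reduction_empty[OF T0N N cN])
  obtain \<F> where F: "graph_cover ?N T0 T \<F>" using T(1) by (auto simp: graph_reduction_def)
  \<comment> \<open>A dummy section with empty domain makes the family nonempty, so that the
    naturals enumerate it.\<close>
  define \<F>' where "\<F>' = insert ({}, \<lambda>_ _. 0) \<F>"
  define p where "p = from_nat_into \<F>'"
  have cF: "countable \<F>'" using graph_coverD(1)[OF F] by (simp add: \<F>'_def)
  have p: "p k \<in> \<F>'" "\<exists>k. q = p k" if "q \<in> \<F>'" for k q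
    unfolding p_def using from_nat_into[of \<F>'] from_nat_into_surj[OF cF that] that by auto
  have pF: "p k \<in> \<F>'" for k by (rule p(1)[of "({}, \<lambda>_ _. 0)"]) (simp add: \<F>'_def)
  have "\<forall>k. \<exists>q. fst q \<in> sets M \<and> snd q \<in> M \<rightarrow>\<^sub>M baire_sets \<and> fst q \<subseteq> fst (p k) \<and>
    (AE x in M. x \<in> fst (p k) \<longrightarrow> x \<in> fst q) \<and> (\<forall>x\<in>fst q. snd q x = snd (p k) x)"
  proof
    fix k
    obtain D f where Df: "p k = (D, f)" by (cases "p k")
    have "D \<in> sets ?N" "f \<in> ?N \<rightarrow>\<^sub>M baire_sets"
      using pF[of k] graph_coverD(2,3)[OF F, of D f] z unfolding Df \<F>'_def by auto
    from completion_baire_measurable[OF this(2,1)] show "\<exists>q. fst q \<in> sets M \<and> snd q \<in> M \<rightarrow>\<^sub>M baire_sets \<and> fst q \<subseteq> fst (p k) \<and>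
      (AE x in M. x \<in> fst (p k) \<longrightarrow> x \<in> fst q) \<and> (\<forall>x\<in>fst q. snd q x = snd (p k) x)"
      unfolding Df by auto
  qed
  then obtain q where q: "\<forall>k. fst (q k) \<in> sets M \<and> snd (q k) \<in> M \<rightarrow>\<^sub>M baire_sets \<and> fst (q k) \<subseteq> fst (p k) \<and>
    (AE x in M. x \<in> fst (p k) \<longrightarrow> x \<in> fst (q k)) \<and> (\<forall>x\<in>fst (q k). snd (q k) x = snd (p k) x)"
    by (rule exE[OF choice])
  show ?thesis
  proof (intro exI[of _ "\<lambda>k. fst (q k)"] exI[of _ "\<lambda>k. snd (q k)"] conjI allI ballI)
    show "fst (q k) \<in> sets M" "snd (q k) \<in> M \<rightarrow>\<^sub>M baire_sets" for k using q by auto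
    show "(x, snd (q k) x) \<in> B" if x: "x \<in> fst (q k)" for k x
    proof -
      obtain D f where Df: "p k = (D, f)" by (cases "p k")
      have xD: "x \<in> D" "snd (q k) x = f x" using spec[OF q, of k] x Df by auto
      have "x \<in> space M" using spec[OF q, of k] x sets.sets_into_space by auto
      have "(D, f) \<in> \<F>" using pF[of k] xD(1) unfolding Df \<F>'_def by auto
      from graph_coverD(4)[OF F this xD(1)] show ?thesis using BT[OF \<open>x \<in> space M\<close>] xD(2) by simp
    qed
    have "AE x in M. tree_body T x = {}" using T(2) by (simp add: AE_completion_iff)
    moreover have "AE x in M. \<forall>k. x \<in> fst (p k) \<longrightarrow> x \<in> fst (q k)"
      using q by (simp add: AE_all_countable)
    moreover have "AE x in M. x \<in> space M" by (rule AE_space)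
    ultimately show "AE x in M. \<forall>y. (x, y) \<in> B \<longrightarrow> (\<exists>k. x \<in> fst (q k) \<and> y = snd (q k) x)"
    proof eventually_elim
      case (elim x)
      show ?case
      proof (intro allI impI)
        fix y assume "(x, y) \<in> B"
        then obtain w where w: "w \<in> tree_body T0 x" "y = evens w" using BT[OF elim(3)] by auto
        obtain D f where Df: "(D, f) \<in> \<F>" "x \<in> D" "evens w = f x"
          using graph_coverD(6)[OF F _ w(1)] elim(1,3) by auto
        obtain k where k: "(D, f) = p k" using p(2)[of "(D, f)"] Df(1) by (auto simp: \<F>'_def)
        then have "x \<in> fst (q k)" using elim(2) Df(2) by (metis fst_conv)
        moreover have "y = snd (q k) x"
          using spec[OF q, of k] calculation w(2) Df(3) k by (metis snd_conv)
        ultimately show "\<exists>k. x \<in> fst (q k) \<and> y = snd (q k) x" by auto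
      qed
    qed
  qed
qed

section \<open>The theorem of Feldman and Moore almost everywhere\<close>

text \<open>The space is a measurable retract of Baire space: \<open>e x\<close> lists for each
  \<open>k\<close> the first dense point closer to \<open>x\<close> than \<open>(1/2) ^ k\<close>,
  and \<open>\<psi>\<close> takes the limit of the points listed.\<close>

lemma standard_borel_coding:
  assumes M: "standard_borel M" and ne: "space M \<noteq> {}"
  obtains e \<psi> where "e \<in> M \<rightarrow>\<^sub>M baire_sets" "\<psi> \<in> baire_sets \<rightarrow>\<^sub>M M" "\<forall>x\<in>space M. \<psi> (e x) = x"
proof -
  obtain T where T: "topspace T = space M" "completely_metrizable_space T" "second_countable T"
      "sets M = sigma_sets (space M) {U. openin T U}"
    using M unfolding standard_borel_def by blast
  obtain S d where Sd: "Metric_space S d" "Metric_space.mcomplete S d" "T = Metric_space.mtopology S d"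
    using T(2) unfolding completely_metrizable_space_def by blast
  interpret Metric_space S d by fact
  have S: "S = space M" using T(1) Sd(3) by simp
  obtain \<B> where B: "countable \<B>" "\<And>V. V \<in> \<B> \<Longrightarrow> openin T V"
      "\<And>U x. openin T U \<Longrightarrow> x \<in> U \<Longrightarrow> \<exists>V\<in>\<B>. x \<in> V \<and> V \<subseteq> U"
    using T(3) unfolding second_countable_def by metis
  define Q where "Q = (\<lambda>V. SOME x. x \<in> V) ` (\<B> - {{}})"
  have Q_dense: "\<exists>q\<in>Q. d x q < r" if "x \<in> S" "0 < r" for x r
  proof -
    have "openin T (mball x r)" "x \<in> mball x r" using that Sd(3) by auto
    then obtain V where V: "V \<in> \<B>" "x \<in> V" "V \<subseteq> mball x r" using B(3) by meson
    then have "(SOME x. x \<in> V) \<in> V" by (metis someI)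
    with V(3) have "(SOME x. x \<in> V) \<in> mball x r" by (rule subsetD)
    then have "d x (SOME x. x \<in> V) < r" by simp
    moreover have "(SOME x. x \<in> V) \<in> Q" using V by (auto simp: Q_def)
    ultimately show ?thesis by (rule bexI)
  qed
  have QS: "Q \<subseteq> S"
  proof
    fix q assume "q \<in> Q"
    then obtain V where V: "V \<in> \<B>" "V \<noteq> {}" "q = (SOME x. x \<in> V)" by (auto simp: Q_def)
    then have "q \<in> V" by (metis ex_in_conv someI)
    then show "q \<in> S" using B(2)[OF V(1)] openin_subset T(1) S by blast
  qed
  obtain x0 where x0: "x0 \<in> S" using ne S by blast
  then have "Q \<noteq> {}" using Q_dense[of x0 1] by auto
  moreover have "countable Q" using B(1) by (simp add: Q_def)
  ultimately obtain q :: "nat \<Rightarrow> 'a" where q: "Q = range q" by (metis range_from_nat_into)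
  have qS: "q i \<in> S" for i using QS q by auto
  have near: "\<exists>i. d x (q i) < r" if "x \<in> S" "0 < r" for x r
    using Q_dense[OF that] q by auto
  have open_sets: "U \<in> sets M" if "openin T U" for U
    unfolding T(4) using that by (intro sigma_sets.Basic) simp
  have ball: "mball x r \<in> sets M" for x r
    by (rule open_sets) (simp add: Sd(3))
  define e where "e x k = (LEAST i. d x (q i) < (1/2) ^ k)" for x and k :: nat
  have e: "d x (q (e x k)) < (1/2) ^ k" if "x \<in> S" for x k
    unfolding e_def using near[OF that, of "(1/2) ^ k"] by (metis LeastI_ex zero_less_power half_gt_zero_iff zero_less_one)
  have e_meas: "e \<in> M \<rightarrow>\<^sub>M baire_sets"
  proof (rule measurable_PiM_single'[where f = "\<lambda>k x. e x k"])
    fix k :: nat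
    show "(\<lambda>x. e x k) \<in> M \<rightarrow>\<^sub>M count_space UNIV"
    proof (subst measurable_count_space_eq2_countable, intro conjI ballI)
      fix i
      have "(\<lambda>x. e x k) -` {i} \<inter> space M = mball (q i) ((1/2) ^ k) - (\<Union>j\<in>{..<i}. mball (q j) ((1/2) ^ k))"
      proof (rule Set.set_eqI)
        fix x
        have cm: "d (q j) x = d x (q j)" for j by (rule commute)
        have "e x k = i \<longleftrightarrow> d x (q i) < (1/2) ^ k \<and> (\<forall>j<i. \<not> d x (q j) < (1/2) ^ k)" if x: "x \<in> S"
        proof
          assume i: "e x k = i"
          have "\<not> d x (q j) < (1/2) ^ k" if "j < i" for j
            by (rule not_less_Least) (use that i in \<open>simp add: e_def\<close>)
          then show "d x (q i) < (1/2) ^ k \<and> (\<forall>j<i. \<not> d x (q j) < (1/2) ^ k)"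
            using e[OF x, of k] i by simp
        next
          assume "d x (q i) < (1/2) ^ k \<and> (\<forall>j<i. \<not> d x (q j) < (1/2) ^ k)"
          then show "e x k = i"
            unfolding e_def by (intro Least_equality) (simp, meson leI)
        qed
        then show "x \<in> (\<lambda>x. e x k) -` {i} \<inter> space M \<longleftrightarrow>
            x \<in> mball (q i) ((1/2) ^ k) - (\<Union>j\<in>{..<i}. mball (q j) ((1/2) ^ k))"
          using qS by (auto simp: S[symmetric] cm)
      qed
      then show "(\<lambda>x. e x k) -` {i} \<inter> space M \<in> sets M"
        using ball by (auto intro!: sets.Diff sets.finite_UN)
    qed auto
  qed auto
  \<comment> \<open>The triangle inequality gives this bound for every code \<open>e x\<close>. It
    also forces the listed points to converge, with the limit within \<open>(1/2) ^ k\<close> of the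
    \<open>k\<close>-th one.\<close>
  define C where "C = {w. \<forall>k l. d (q (w k)) (q (w l)) \<le> (1/2) ^ k + (1/2) ^ (l :: nat)}"
  have coord: "(\<lambda>w. w k) \<in> baire_sets \<rightarrow>\<^sub>M count_space UNIV" for k :: nat
    by (rule measurable_component_singleton) simp
  have coordP: "{w. P (w k)} \<in> sets baire_sets" for P and k :: nat
    using measurable_sets[OF coord[of k], of "{i. P i}"] by (simp add: vimage_def space_PiM)
  have coordP2: "{w. P (w k) (w l)} \<in> sets baire_sets" for P and k l :: nat
  proof -
    have "{w. P (w k) (w l)} = (\<Union>i. {w. w k = i} \<inter> {w. P i (w l)})" by auto
    then show ?thesis using coordP by (auto intro!: sets.countable_UN sets.Int)
  qed
  have C: "C \<in> sets baire_sets"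
  proof -
    have "C = (\<Inter>k. \<Inter>l. {w. d (q (w k)) (q (w l)) \<le> (1/2) ^ k + (1/2) ^ l})" by (auto simp: C_def)
    then show ?thesis using coordP2 by (auto intro!: sets.countable_INT)
  qed
  have lim: "\<exists>y\<in>S. \<forall>k. d y (q (w k)) \<le> (1/2) ^ k" if w: "w \<in> C" for w
  proof -
    have p0: "(\<lambda>n. (1/2::real) ^ n) \<longlonglongrightarrow> 0" by (rule LIMSEQ_power_zero) simp
    have "MCauchy (\<lambda>k. q (w k))"
      unfolding MCauchy_def
    proof (intro conjI allI impI)
      fix r :: real assume "0 < r"
      then have "eventually (\<lambda>n. (1/2::real) ^ n < r / 2) sequentially"
        by (intro order_tendstoD(2)[OF p0]) simp
      then obtain N where N: "\<And>n. n \<ge> N \<Longrightarrow> (1/2::real) ^ n < r / 2"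
        by (auto simp: eventually_sequentially)
      show "\<exists>N. \<forall>n n'. N \<le> n \<longrightarrow> N \<le> n' \<longrightarrow> d (q (w n)) (q (w n')) < r"
      proof (intro exI[of _ N] allI impI)
        fix n n' assume "N \<le> n" "N \<le> n'"
        then show "d (q (w n)) (q (w n')) < r"
          using w N[of n] N[of n'] unfolding C_def by (smt (verit) field_sum_of_halves mem_Collect_eq)
      qed
    qed (use qS in auto)
    then obtain y where y: "limitin mtopology (\<lambda>k. q (w k)) y sequentially"
      using Sd(2) unfolding mcomplete_def by metis
    have yS: "y \<in> S" using y by (rule limitin_mspace)
    have "(\<lambda>l. d (q (w l)) y) \<longlonglongrightarrow> 0"
      using y unfolding limitin_metric_dist_null by auto
    have "d y (q (w k)) \<le> (1/2) ^ k" for k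
    proof -
      have "(\<lambda>l. (1/2) ^ k + (1/2) ^ l + d (q (w l)) y) \<longlonglongrightarrow> (1/2) ^ k + 0 + 0"
        by (intro tendsto_intros p0) fact
      moreover have "d y (q (w k)) \<le> (1/2) ^ k + (1/2) ^ l + d (q (w l)) y" for l
      proof -
        have "d y (q (w k)) \<le> d y (q (w l)) + d (q (w l)) (q (w k))"
          by (rule triangle[OF yS qS qS])
        also have "d (q (w l)) (q (w k)) = d (q (w k)) (q (w l))" by (rule commute)
        also have "\<dots> \<le> (1/2) ^ k + (1/2) ^ l" using w by (simp add: C_def)
        finally show ?thesis by (simp add: commute)
      qed
      ultimately show ?thesis by (intro LIMSEQ_le_const[of _ "(1/2) ^ k"]) auto
    qed
    then show ?thesis using yS by blast
  qed
  define \<psi> where "\<psi> w = (if w \<in> C then SOME y. y \<in> S \<and> (\<forall>k. d y (q (w k)) \<le> (1/2) ^ k) else x0)" for w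
  have psi: "\<psi> w \<in> S" "d (\<psi> w) (q (w k)) \<le> (1/2) ^ k" if "w \<in> C" for w k
    using someI_ex[of "\<lambda>y. y \<in> S \<and> (\<forall>k. d y (q (w k)) \<le> (1/2) ^ k)"] lim[OF that] that
    by (auto simp: \<psi>_def)
  have psiS: "\<psi> w \<in> S" for w
    using psi(1) x0 by (cases "w \<in> C") (auto simp: \<psi>_def)
  have half_small: "\<exists>k. (1/2::real) ^ k < r" if "0 < r" for r
    using real_arch_pow_inv[OF that, of "1/2"] by simp
  have psi_e: "\<psi> (e x) = x" if x: "x \<in> S" for x
  proof -
    have "e x \<in> C"
      unfolding C_def mem_Collect_eq
    proof (intro allI)
      fix k l
      have "d (q (e x k)) (q (e x l)) \<le> d (q (e x k)) x + d x (q (e x l))"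
        by (rule triangle[OF qS x qS])
      then show "d (q (e x k)) (q (e x l)) \<le> (1/2) ^ k + (1/2) ^ l"
        using e[OF x, of k] e[OF x, of l] by (simp add: commute)
    qed
    have "d (\<psi> (e x)) x = 0"
    proof (rule ccontr)
      assume "d (\<psi> (e x)) x \<noteq> 0"
      then have "0 < d (\<psi> (e x)) x" using nonneg[of "\<psi> (e x)" x] by (metis order_le_less)
      then have "0 < d (\<psi> (e x)) x / 2" by simp
      then obtain k where k: "(1/2) ^ k < d (\<psi> (e x)) x / 2" using half_small by blast
      have "d (\<psi> (e x)) x \<le> d (\<psi> (e x)) (q (e x k)) + d (q (e x k)) x"
        by (rule triangle[OF psiS qS x])
      then show False using psi(2)[OF \<open>e x \<in> C\<close>, of k] e[OF x, of k] k by (simp add: commute)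
    qed
    then show ?thesis using zero[OF psiS x] by simp
  qed
  have arith: "c < r - p" if "c \<le> a + b" "a \<le> p" "p < (r - b) / 2" for a b c p r :: real
    using that by (simp add: field_simps)
  have pre_ball: "\<psi> -` mball (q i) r \<in> sets baire_sets" for i r
  proof -
    \<comment> \<open>The limit lies within \<open>(1/2) ^ k\<close> of \<open>q (w k)\<close>, so
      membership in an open ball shows at a finite stage and turns into conditions on single
      coordinates.\<close>
    have eq: "\<psi> -` mball (q i) r \<inter> C = (\<Union>k. {w. d (q (w k)) (q i) < r - (1/2) ^ k}) \<inter> C"
    proof (rule Set.set_eqI)
      fix w
      have "d (q i) (\<psi> w) < r \<longleftrightarrow> (\<exists>k. d (q (w k)) (q i) < r - (1/2) ^ k)" if w: "w \<in> C"
      proof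
        assume "d (q i) (\<psi> w) < r"
        then obtain k where k: "(1/2) ^ k < (r - d (q i) (\<psi> w)) / 2"
          using half_small[of "(r - d (q i) (\<psi> w)) / 2"] by auto
        have "d (q (w k)) (q i) \<le> d (q (w k)) (\<psi> w) + d (\<psi> w) (q i)"
          by (rule triangle[OF qS psiS qS])
        then have "d (q (w k)) (q i) < r - (1/2) ^ k"
          using psi(2)[OF w, of k] k unfolding commute[of "q (w k)" "\<psi> w"] commute[of "\<psi> w" "q i"]
          by (rule arith)
        then show "\<exists>k. d (q (w k)) (q i) < r - (1/2) ^ k" ..
      next
        assume "\<exists>k. d (q (w k)) (q i) < r - (1/2) ^ k"
        then obtain k where k: "d (q (w k)) (q i) < r - (1/2) ^ k" ..
        have "d (q i) (\<psi> w) \<le> d (q i) (q (w k)) + d (q (w k)) (\<psi> w)"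
          by (rule triangle[OF qS qS psiS])
        then show "d (q i) (\<psi> w) < r" using psi(2)[OF w, of k] k by (simp add: commute)
      qed
      then show "w \<in> \<psi> -` mball (q i) r \<inter> C \<longleftrightarrow> w \<in> (\<Union>k. {w. d (q (w k)) (q i) < r - (1/2) ^ k}) \<inter> C"
        using qS psiS by auto
    qed
    have 1: "\<psi> -` mball (q i) r \<inter> C \<in> sets baire_sets"
      unfolding eq using coordP C by (intro sets.Int sets.countable_UN) auto
    have 2: "UNIV - C \<in> sets baire_sets" using sets.compl_sets[OF C] by (simp add: space_PiM)
    have x0': "\<psi> w = x0" if "w \<notin> C" for w using that by (simp add: \<psi>_def)
    show ?thesis
    proof (cases "x0 \<in> mball (q i) r")
      case True
      then have "\<psi> -` mball (q i) r = (\<psi> -` mball (q i) r \<inter> C) \<union> (UNIV - C)"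
        using x0' by (auto simp del: in_mball)
      then show ?thesis using sets.Un[OF 1 2] by simp
    next
      case False
      then have "\<psi> -` mball (q i) r = \<psi> -` mball (q i) r \<inter> C"
        using x0' by (metis (no_types, lifting) Int_absorb2 subsetI vimage_eq)
      then show ?thesis using 1 by simp
    qed
  qed
  have psi_meas: "\<psi> \<in> baire_sets \<rightarrow>\<^sub>M M"
  proof (rule measurable_sigma_sets[OF T(4)])
    show "{U. openin T U} \<subseteq> Pow (space M)" using openin_subset T(1) by blast
    show "\<psi> \<in> space baire_sets \<rightarrow> space M" using psiS S by auto
    fix U assume "U \<in> {U. openin T U}"
    then have U: "openin T U" by simp
    define I where "I = {(i, n). mball (q i) (1 / Suc n) \<subseteq> U}"
    have "U = (\<Union>p\<in>I. mball (q (fst p)) (1 / Suc (snd p)))"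
    proof (intro equalityI subsetI)
      fix x assume x: "x \<in> U"
      then have xS: "x \<in> S" using U openin_subset T(1) S by blast
      obtain r where r: "0 < r" "mball x r \<subseteq> U"
        using U x unfolding Sd(3) openin_mtopology by blast
      then obtain n where n: "1 / real (Suc n) < r / 2" using nat_approx_posE[of "r / 2"] by auto
      obtain i where i: "d x (q i) < 1 / Suc n" using near[OF xS, of "1 / Suc n"] by auto
      have "mball (q i) (1 / Suc n) \<subseteq> mball x r"
      proof
        fix y assume "y \<in> mball (q i) (1 / Suc n)"
        then have y: "y \<in> S" "d (q i) y < 1 / Suc n" by auto
        have "d x y \<le> d x (q i) + d (q i) y" by (rule triangle[OF xS qS y(1)])
        then show "y \<in> mball x r" using xS y i n by auto
      qed
      then have "(i, n) \<in> I" using r by (auto simp: I_def)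
      moreover have "x \<in> mball (q i) (1 / Suc n)" using i xS qS by (simp add: commute)
      ultimately show "x \<in> (\<Union>p\<in>I. mball (q (fst p)) (1 / Suc (snd p)))" by (intro UN_I[of "(i, n)"]) auto
    qed (auto simp: I_def)
    then have "\<psi> -` U = (\<Union>p\<in>I. \<psi> -` mball (q (fst p)) (1 / Suc (snd p)))" by (simp only: vimage_UN)
    also have "\<dots> \<in> sets baire_sets" using pre_ball by (intro sets.countable_UN') auto
    finally show "\<psi> -` U \<inter> space baire_sets \<in> sets baire_sets" by (simp add: space_PiM)
  qed
  show thesis by (rule that[OF e_meas psi_meas]) (use psi_e S in simp)
qed

text \<open>Finite sets are closed, so a countable base does it. The sets \<open>V n\<close> serve
  to cut domains into pieces that a given map moves off themselves.\<close>

lemma standard_borel_separating: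
  assumes "standard_borel M"
  shows "\<exists>V :: nat \<Rightarrow> 'a set. (\<forall>n. V n \<in> sets M) \<and>
    (\<forall>u\<in>space M. \<forall>F. finite F \<longrightarrow> F \<subseteq> space M \<longrightarrow> u \<notin> F \<longrightarrow> (\<exists>n. u \<in> V n \<and> V n \<inter> F = {}))"
proof -
  obtain T where T: "topspace T = space M" "completely_metrizable_space T" "second_countable T"
      "sets M = sigma_sets (space M) {U. openin T U}"
    using assms unfolding standard_borel_def by (metis (no_types))
  obtain \<B> where B: "countable \<B>" "\<And>V. V \<in> \<B> \<Longrightarrow> openin T V"
      "\<And>U x. openin T U \<Longrightarrow> x \<in> U \<Longrightarrow> \<exists>V\<in>\<B>. x \<in> V \<and> V \<subseteq> U"
    using T(3) unfolding second_countable_def by metis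
  have "t1_space T"
    using T(2) by (intro Hausdorff_imp_t1_space metrizable_imp_Hausdorff_space completely_metrizable_imp_metrizable_space)
  then have closed: "closedin T F" if "finite F" "F \<subseteq> space M" for F
    using that T(1) t1_space_closedin_finite by metis
  define V where "V = from_nat_into (insert {} \<B>)"
  have c: "countable (insert {} \<B>)" using B(1) by simp
  show ?thesis
  proof (intro exI[of _ V] conjI allI ballI impI)
    fix n
    have "V n \<in> insert {} \<B>" unfolding V_def by (rule from_nat_into) simp
    then have "openin T (V n)" using B(2) by auto
    then show "V n \<in> sets M" unfolding T(4) by (intro sigma_sets.Basic) simp
  next
    fix u F assume u: "u \<in> space M" "finite F" "F \<subseteq> space M" "u \<notin> F"
    have "openin T (topspace T - F)" using closed[OF u(2,3)] by blast
    then obtain W where W: "W \<in> \<B>" "u \<in> W" "W \<subseteq> topspace T - F"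
      using B(3)[of "topspace T - F" u] u T(1) by auto
    obtain n where "V n = W" using from_nat_into_surj[OF c, of W] W(1) by (auto simp: V_def)
    then show "\<exists>n. u \<in> V n \<and> V n \<inter> F = {}" using W by blast
  qed
qed

text \<open>Since \<open>\<psi>\<close> undoes \<open>e\<close>, equality of points is equality of
  all coordinates of their codes, a countable conjunction of measurable conditions.\<close>

lemma standard_borel_equality_sets:
  assumes M: "standard_borel M" and f: "f \<in> N \<rightarrow>\<^sub>M M" and g: "g \<in> N \<rightarrow>\<^sub>M M"
  shows "{x \<in> space N. f x = g x} \<in> sets N"
proof (cases "space M = {}")
  case True
  then have "space N = {}" using measurable_space[OF f] by auto
  then show ?thesis by simp
next
  case False
  then obtain e \<psi> where e: "e \<in> M \<rightarrow>\<^sub>M baire_sets" "\<psi> \<in> baire_sets \<rightarrow>\<^sub>M M" "\<forall>x\<in>space M. \<psi> (e x) = x"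
    by (rule standard_borel_coding[OF M])
  have m: "(\<lambda>x. e (h x) k) \<in> N \<rightarrow>\<^sub>M count_space UNIV" if "h \<in> N \<rightarrow>\<^sub>M M" for h k
  proof -
    have "(\<lambda>w. w k) \<in> baire_sets \<rightarrow>\<^sub>M count_space UNIV" by (rule measurable_component_singleton) simp
    from measurable_compose[OF measurable_compose[OF that e(1)] this] show ?thesis .
  qed
  have inj: "f x = g x \<longleftrightarrow> (\<forall>k. e (f x) k = e (g x) k)" if "x \<in> space N" for x
    using bspec[OF e(3) measurable_space[OF f that]] bspec[OF e(3) measurable_space[OF g that]] by (metis ext)
  have "{x \<in> space N. e (f x) k = e (g x) k} \<in> sets N" for k
  proof -
    have "(\<lambda>x. real (e (h x) k)) \<in> borel_measurable N" if "h \<in> N \<rightarrow>\<^sub>M M" for h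
      by (rule measurable_compose[OF m[OF that]]) simp
    from borel_measurable_eq[OF this[OF f] this[OF g]] show ?thesis by simp
  qed
  then have "{x \<in> space N. \<forall>k. e (f x) k = e (g x) k} \<in> sets N"
    by (rule sets.sets_Collect_countable_All)
  also have "{x \<in> space N. \<forall>k. e (f x) k = e (g x) k} = {x \<in> space N. f x = g x}"
    using inj by auto
  finally show ?thesis .
qed

text \<open>\<open>N\<close> shares only the sigma-algebra with \<open>M\<close>, so that image
  measures of \<open>M\<close> can be inserted for it.\<close>

lemma ae_uniformization_standard_borel:
  assumes M: "standard_borel M" "space M \<noteq> {}" and R: "countable_borel_equiv M R"
    and N: "finite_measure N" "sets N = sets M"
  shows "\<exists>(D :: nat \<Rightarrow> 'a set) f. (\<forall>k. D k \<in> sets M \<and> f k \<in> M \<rightarrow>\<^sub>M M \<and> (\<forall>x\<in>D k. (x, f k x) \<in> R)) \<and>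
    (AE x in N. \<forall>y. (x, y) \<in> R \<longrightarrow> (\<exists>k. x \<in> D k \<and> y = f k x))"
proof -
  obtain e \<psi> where e: "e \<in> M \<rightarrow>\<^sub>M baire_sets" and psi: "\<psi> \<in> baire_sets \<rightarrow>\<^sub>M M"
      and psi_e: "\<forall>x\<in>space M. \<psi> (e x) = x"
    by (rule standard_borel_coding[OF M])
  have spN: "space N = space M" by (rule sets_eq_imp_space_eq[OF N(2)])
  have Rsets: "R \<in> sets (M \<Otimes>\<^sub>M M)" and Rsub: "R \<subseteq> space M \<times> space M"
    and Rc: "\<And>x. x \<in> space M \<Longrightarrow> countable (R `` {x})"
    using R unfolding countable_borel_equiv_def equiv_def refl_on_def by auto
  let ?P = "N \<Otimes>\<^sub>M baire_sets"
  \<comment> \<open>The second condition admits a single code for each point \<open>y\<close>,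
    namely \<open>e y\<close>; the sections of \<open>B\<close> are therefore as countable as the
    classes.\<close>
  define B where "B = {p \<in> space ?P. (fst p, \<psi> (snd p)) \<in> R \<and> e (\<psi> (snd p)) = snd p}"
  have "(\<lambda>p. (fst p, \<psi> (snd p))) \<in> ?P \<rightarrow>\<^sub>M M \<Otimes>\<^sub>M M"
  proof (rule measurable_Pair)
    show "(\<lambda>p. fst p) \<in> ?P \<rightarrow>\<^sub>M M" using measurable_fst[of N] measurable_cong_sets[OF refl N(2)] by auto
    show "(\<lambda>p. \<psi> (snd p)) \<in> ?P \<rightarrow>\<^sub>M M" by (rule measurable_compose[OF measurable_snd psi])
  qed
  from measurable_sets[OF this Rsets] have B1: "{p \<in> space ?P. (fst p, \<psi> (snd p)) \<in> R} \<in> sets ?P"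
    by (simp add: vimage_def Int_def conj_commute)
  have comp: "(\<lambda>w. w k) \<in> baire_sets \<rightarrow>\<^sub>M count_space UNIV" for k :: nat
    by (rule measurable_component_singleton) simp
  have "{p \<in> space ?P. e (\<psi> (snd p)) k = snd p k} \<in> sets ?P" for k
  proof -
    have a: "(\<lambda>p. real (e (\<psi> (snd p)) k)) \<in> borel_measurable ?P"
      by (rule measurable_compose[OF measurable_compose[OF measurable_compose[OF measurable_compose[OF measurable_snd psi] e] comp]]) simp
    have b: "(\<lambda>p. real (snd p k)) \<in> borel_measurable ?P"
      by (rule measurable_compose[OF measurable_compose[OF measurable_snd comp]]) simp
    from borel_measurable_eq[OF a b] show ?thesis by simp
  qed
  then have "{p \<in> space ?P. \<forall>k. e (\<psi> (snd p)) k = snd p k} \<in> sets ?P"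
    by (rule sets.sets_Collect_countable_All)
  then have B2: "{p \<in> space ?P. e (\<psi> (snd p)) = snd p} \<in> sets ?P" by (simp add: fun_eq_iff)
  have "B = {p \<in> space ?P. (fst p, \<psi> (snd p)) \<in> R} \<inter> {p \<in> space ?P. e (\<psi> (snd p)) = snd p}"
    by (auto simp: B_def)
  then have B: "B \<in> sets ?P" using B1 B2 by auto
  have Biff: "(x, w) \<in> B \<longleftrightarrow> (x, \<psi> w) \<in> R \<and> e (\<psi> w) = w" if "x \<in> space M" for x w
    using that spN by (auto simp: B_def space_pair_measure space_PiM)
  have cB: "countable {w. (x, w) \<in> B}" if "x \<in> space N" for x
  proof -
    have x: "x \<in> space M" using that spN by simp
    have "{w. (x, w) \<in> B} \<subseteq> e ` (R `` {x})"
    proof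
      fix w assume "w \<in> {w. (x, w) \<in> B}"
      then have "(x, \<psi> w) \<in> R" "w = e (\<psi> w)" using Biff[OF x] by auto
      then show "w \<in> e ` (R `` {x})" by (intro image_eqI[of _ _ "\<psi> w"]) auto
    qed
    then show ?thesis using Rc[OF x] countable_image countable_subset by metis
  qed
  have "\<exists>(D :: nat \<Rightarrow> 'a set) f. (\<forall>k. D k \<in> sets N \<and> f k \<in> N \<rightarrow>\<^sub>M baire_sets \<and> (\<forall>x\<in>D k. (x, f k x) \<in> B)) \<and>
    (AE x in N. \<forall>y. (x, y) \<in> B \<longrightarrow> (\<exists>k. x \<in> D k \<and> y = f k x))"
    by (rule ae_countable_section_uniformization[OF N(1) B cB])
  then obtain D :: "nat \<Rightarrow> 'a set" and f where Df: "\<forall>k. D k \<in> sets N \<and> f k \<in> N \<rightarrow>\<^sub>M baire_sets \<and> (\<forall>x\<in>D k. (x, f k x) \<in> B)"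
    and ae: "AE x in N. \<forall>y. (x, y) \<in> B \<longrightarrow> (\<exists>k. x \<in> D k \<and> y = f k x)"
    by (elim exE conjE) (rule that)
  show ?thesis
  proof (intro exI[of _ D] exI[of _ "\<lambda>k x. \<psi> (f k x)"] conjI allI ballI)
    fix k
    show "D k \<in> sets M" using Df N(2) by simp
    have "f k \<in> M \<rightarrow>\<^sub>M baire_sets" using spec[OF Df, of k] measurable_cong_sets[OF N(2) refl] by auto
    then show "(\<lambda>x. \<psi> (f k x)) \<in> M \<rightarrow>\<^sub>M M" by (rule measurable_compose[OF _ psi])
    fix x assume x: "x \<in> D k"
    have "x \<in> space M" using x Df N(2) sets.sets_into_space by blast
    then show "(x, \<psi> (f k x)) \<in> R" using spec[OF Df, of k] x Biff by auto
  next
    show "AE x in N. \<forall>y. (x, y) \<in> R \<longrightarrow> (\<exists>k. x \<in> D k \<and> y = \<psi> (f k x))"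
      using ae
    proof eventually_elim
      case (elim x)
      show ?case
      proof (intro allI impI)
        fix y assume xy: "(x, y) \<in> R"
        then have sp: "x \<in> space M" "y \<in> space M" using Rsub by auto
        then have y: "\<psi> (e y) = y" using psi_e by simp
        then have "(x, e y) \<in> B" using Biff[OF sp(1)] xy by simp
        then obtain k where "x \<in> D k" "e y = f k x" using elim by auto
        then show "\<exists>k. x \<in> D k \<and> y = \<psi> (f k x)" using y by (intro exI[of _ k]) simp
      qed
    qed
  qed
qed

section \<open>Involutions exchanging two sets\<close>

definition swap_map :: "'a set \<Rightarrow> 'a set \<Rightarrow> ('a \<Rightarrow> 'a) \<Rightarrow> ('a \<Rightarrow> 'a) \<Rightarrow> 'a \<Rightarrow> 'a" where
  "swap_map D D' f g x = (if x \<in> D then f x else if x \<in> D' then g x else x)"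

lemma swap_map_involution:
  assumes "D \<inter> D' = {}" "\<And>x. x \<in> D \<Longrightarrow> f x \<in> D' \<and> g (f x) = x"
    and "\<And>y. y \<in> D' \<Longrightarrow> g y \<in> D \<and> f (g y) = y"
  shows "swap_map D D' f g (swap_map D D' f g x) = x"
proof -
  have d: "z \<notin> D" if "z \<in> D'" for z using that assms(1) by blast
  show ?thesis using assms(2)[of x] assms(3)[of x] d by (auto simp: swap_map_def)
qed

lemma swap_map_borel_automorphism:
  assumes D: "D \<in> sets M" "D' \<in> sets M" "D \<inter> D' = {}"
    and f: "f \<in> M \<rightarrow>\<^sub>M M" "\<And>x. x \<in> D \<Longrightarrow> f x \<in> D' \<and> g (f x) = x"
    and g: "g \<in> M \<rightarrow>\<^sub>M M" "\<And>y. y \<in> D' \<Longrightarrow> g y \<in> D \<and> f (g y) = y"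
  shows "swap_map D D' f g \<in> borel_automorphisms M"
proof -
  let ?s = "swap_map D D' f g"
  have m: "?s \<in> M \<rightarrow>\<^sub>M M"
    unfolding swap_map_def using D f(1) g(1)
    by (intro measurable_If_set measurable_ident_sets refl) auto
  have inv: "?s (?s x) = x" for x by (rule swap_map_involution[OF D(3) f(2) g(2)])
  have sp: "?s x \<in> space M" if "x \<in> space M" for x by (rule measurable_space[OF m that])
  have bij: "bij_betw ?s (space M) (space M)"
    by (rule bij_betwI[where g = ?s]) (use inv sp in auto)
  have "the_inv_into (space M) ?s x = ?s x" if "x \<in> space M" for x
    using bij inv sp that by (metis bij_betw_imp_inj_on the_inv_into_f_eq)
  then have "the_inv_into (space M) ?s \<in> M \<rightarrow>\<^sub>M M"
    using m measurable_cong[of M "the_inv_into (space M) ?s" ?s M] by simp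
  then show ?thesis using m bij by (simp add: borel_automorphisms_def)
qed

lemma borel_full_group_id:
  assumes "countable_borel_equiv M R"
  shows "id \<in> borel_full_group M R"
proof -
  have "the_inv_into (space M) id x = id x" if "x \<in> space M" for x
    by (rule the_inv_into_f_eq) (simp_all add: that)
  then have "the_inv_into (space M) id \<in> M \<rightarrow>\<^sub>M M"
    by (rule iffD2[OF measurable_cong measurable_ident])
  then show ?thesis
    using assms unfolding borel_full_group_def borel_automorphisms_def countable_borel_equiv_def equiv_def refl_on_def
    by auto
qed

text \<open>An almost everywhere version of the theorem of Feldman and Moore.  The right inverses
  \<open>g n m\<close> are taken with respect to the image measures of the \<open>f n\<close>, so that the exceptional null sets
  pull back to null sets.\<close>

theorem ae_feldman_moore:
  assumes M: "standard_borel M" "prob_space M" and R: "countable_borel_equiv M R"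
  shows "\<exists>T :: nat \<Rightarrow> 'a \<Rightarrow> 'a. (\<forall>k. T k \<in> borel_full_group M R) \<and>
    (AE x in M. \<forall>y. (x, y) \<in> R \<longrightarrow> (\<exists>k. y = T k x))"
proof -
  interpret prob_space M by fact
  have eq: "equiv (space M) R" using R by (simp add: countable_borel_equiv_def)
  have Rsub: "R \<subseteq> space M \<times> space M" and Rrefl: "\<And>x. x \<in> space M \<Longrightarrow> (x, x) \<in> R"
    and Rsym: "\<And>x y. (x, y) \<in> R \<Longrightarrow> (y, x) \<in> R"
    using eq by (auto simp: equiv_def refl_on_def sym_def)
  obtain D :: "nat \<Rightarrow> 'a set" and f where Df: "\<forall>k. D k \<in> sets M \<and> f k \<in> M \<rightarrow>\<^sub>M M \<and> (\<forall>x\<in>D k. (x, f k x) \<in> R)"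
    and ae: "AE x in M. \<forall>y. (x, y) \<in> R \<longrightarrow> (\<exists>k. x \<in> D k \<and> y = f k x)"
    using ae_uniformization_standard_borel[OF M(1) not_empty R finite_measure_axioms refl] by (elim exE conjE) (rule that)
  \<comment> \<open>The identity off \<open>D n\<close> makes this a total map, which has an image
    measure on the whole space.\<close>
  define F where "F n x = (if x \<in> D n then f n x else x)" for n x
  have F: "F n \<in> M \<rightarrow>\<^sub>M M" for n
    unfolding F_def using Df by (intro measurable_If_set measurable_ident_sets refl) auto
  define P where "P n q \<longleftrightarrow> (\<forall>m::nat. fst q m \<in> sets M \<and> snd q m \<in> M \<rightarrow>\<^sub>M M \<and> (\<forall>x\<in>fst q m. (x, snd q m x) \<in> R)) \<and>
      (AE x in distr M M (F n). \<forall>y. (x, y) \<in> R \<longrightarrow> (\<exists>m. x \<in> fst q m \<and> y = snd q m x))" for n q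
  have "\<forall>n. \<exists>q. P n q"
  proof
    fix n
    have "finite_measure (distr M M (F n))" by (rule finite_measure_distr[OF F])
    from ae_uniformization_standard_borel[OF M(1) not_empty R this sets_distr] obtain E :: "nat \<Rightarrow> 'a set" and g where
        "\<forall>k. E k \<in> sets M \<and> g k \<in> M \<rightarrow>\<^sub>M M \<and> (\<forall>x\<in>E k. (x, g k x) \<in> R)"
        "AE x in distr M M (F n). \<forall>y. (x, y) \<in> R \<longrightarrow> (\<exists>k. x \<in> E k \<and> y = g k x)"
      by (elim exE conjE) (rule that)
    then show "\<exists>q. P n q" unfolding P_def by (intro exI[of _ "(E, g)"]) simp
  qed
  then obtain q where q: "\<forall>n. P n (q n)" by (rule exE[OF choice])
  define E where "E n m = fst (q n) m" for n m
  define g where "g n m = snd (q n) m" for n m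
  have E: "E n m \<in> sets M" and g: "g n m \<in> M \<rightarrow>\<^sub>M M" and gR: "x \<in> E n m \<Longrightarrow> (x, g n m x) \<in> R"
    and aeg: "AE x in distr M M (F n). \<forall>y. (x, y) \<in> R \<longrightarrow> (\<exists>m. x \<in> E n m \<and> y = g n m x)" for n m x
    using spec[OF q, of n] unfolding P_def E_def g_def by auto
  obtain V :: "nat \<Rightarrow> 'a set" where V': "\<forall>n. V n \<in> sets M"
    and Vsep: "\<forall>u\<in>space M. \<forall>F. finite F \<longrightarrow> F \<subseteq> space M \<longrightarrow> u \<notin> F \<longrightarrow> (\<exists>n. u \<in> V n \<and> V n \<inter> F = {})"
    using standard_borel_separating[OF M(1)] by (elim exE conjE) (rule that)
  have V: "V n \<in> sets M" for n using V' ..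
  \<comment> \<open>Here \<open>g n m\<close> undoes \<open>f n\<close>, and \<open>V i\<close>
    contains \<open>x\<close> but not its image. Hence \<open>f n\<close> is injective on this set
    and moves it off itself, as a swap requires.\<close>
  define A where "A n m i = {x \<in> space M. x \<in> D n \<inter> V i \<and> f n x \<in> E n m - V i \<and> g n m (f n x) = x}" for n m i
  define A' where "A' n m i = {y \<in> space M. y \<in> E n m \<and> g n m y \<in> A n m i \<and> f n (g n m y) = y}" for n m i
  have fm: "f n \<in> M \<rightarrow>\<^sub>M M" and Dm: "D n \<in> sets M" and fR: "x \<in> D n \<Longrightarrow> (x, f n x) \<in> R" for n x
    using Df by auto
  have preim: "{x \<in> space M. h x \<in> B} \<in> sets M" if "h \<in> M \<rightarrow>\<^sub>M M" "B \<in> sets M" for h B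
    using measurable_sets[OF that] by (simp add: vimage_def Int_def conj_commute)
  have ids: "(\<lambda>x. x) \<in> M \<rightarrow>\<^sub>M M" by simp
  have eq1: "{x \<in> space M. g n m (f n x) = x} \<in> sets M" for n m
    by (rule standard_borel_equality_sets[OF M(1) measurable_compose[OF fm g] ids])
  have eq2: "{x \<in> space M. f n (g n m x) = x} \<in> sets M" for n m
    by (rule standard_borel_equality_sets[OF M(1) measurable_compose[OF g fm] ids])
  have Am: "A n m i \<in> sets M" for n m i
  proof -
    have "A n m i = (D n \<inter> V i) \<inter> {x \<in> space M. f n x \<in> E n m - V i} \<inter> {x \<in> space M. g n m (f n x) = x}"
      using sets.sets_into_space[OF Dm, of n] by (auto simp: A_def)
    also have "\<dots> \<in> sets M"
      by (intro sets.Int preim[OF fm] sets.Diff eq1 Dm V E)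
    finally show ?thesis .
  qed
  have A'm: "A' n m i \<in> sets M" for n m i
  proof -
    have "A' n m i = E n m \<inter> {y \<in> space M. g n m y \<in> A n m i} \<inter> {y \<in> space M. f n (g n m y) = y}"
      using sets.sets_into_space[OF E, of n m] by (auto simp: A'_def)
    also have "\<dots> \<in> sets M"
      by (intro sets.Int preim[OF g] eq2 E Am)
    finally show ?thesis .
  qed
  define S where "S n m i = swap_map (A n m i) (A' n m i) (f n) (g n m)" for n m i
  have S: "S n m i \<in> borel_full_group M R" for n m i
  proof -
    have AA': "f n x \<in> A' n m i \<and> g n m (f n x) = x" if "x \<in> A n m i" for x
    proof -
      have x: "x \<in> space M" "f n x \<in> E n m" "g n m (f n x) = x" using that by (auto simp: A_def)
      have "f n x \<in> space M" by (rule measurable_space[OF fm x(1)])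
      then show ?thesis using x that by (simp add: A'_def)
    qed
    have A'A: "g n m y \<in> A n m i \<and> f n (g n m y) = y" if "y \<in> A' n m i" for y
      using that by (simp add: A'_def)
    have "y \<notin> V i" if "y \<in> A' n m i" for y
      using A'A[OF that] by (auto simp: A_def)
    then have disj: "A n m i \<inter> A' n m i = {}" by (auto simp: A_def)
    have aut: "S n m i \<in> borel_automorphisms M"
      unfolding S_def by (rule swap_map_borel_automorphism[OF Am A'm disj fm AA' g A'A])
    have "(x, S n m i x) \<in> R" if "x \<in> space M" for x
      using that Rrefl fR gR by (auto simp: S_def swap_map_def A_def A'_def)
    then show ?thesis using aut by (simp add: borel_full_group_def)
  qed
  define T where "T k = (case k of 0 \<Rightarrow> id | Suc j \<Rightarrow>
      (case prod_decode j of (n, l) \<Rightarrow> (case prod_decode l of (m, i) \<Rightarrow> S n m i)))" for k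
  have T0: "T 0 = id" by (simp add: T_def)
  have TS: "\<exists>k. T k = S n m i" for n m i
    by (rule exI[of _ "Suc (prod_encode (n, prod_encode (m, i)))"]) (simp add: T_def)
  have "T k \<in> borel_full_group M R" for k
    using borel_full_group_id[OF R] S by (auto simp: T_def split: nat.split prod.split)
  moreover have "AE x in M. \<forall>y. (x, y) \<in> R \<longrightarrow> (\<exists>k. y = T k x)"
  proof -
    have "AE x in M. \<forall>y. (F n x, y) \<in> R \<longrightarrow> (\<exists>m. F n x \<in> E n m \<and> y = g n m (F n x))" for n
      by (rule AE_distrD[OF F aeg])
    then have "AE x in M. \<forall>n. \<forall>y. (F n x, y) \<in> R \<longrightarrow> (\<exists>m. F n x \<in> E n m \<and> y = g n m (F n x))"
      by (simp add: AE_all_countable)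
    with ae show ?thesis
    proof eventually_elim
      case (elim x)
      show ?case
      proof (intro allI impI)
        fix y assume xy: "(x, y) \<in> R"
        show "\<exists>k. y = T k x"
        proof (cases "y = x")
          case True
          then show ?thesis by (intro exI[of _ 0]) (simp add: T0)
        next
          case False
          have sp: "x \<in> space M" "y \<in> space M" using xy Rsub by auto
          obtain n where n: "x \<in> D n" "y = f n x" using elim(1) xy by auto
          then have Fn: "F n x = y" by (simp add: F_def)
          \<comment> \<open>Symmetry of \<open>R\<close> gives \<open>(y, x) \<in> R\<close>, and
            \<open>y = F n x\<close> is a point at which the sections chosen for the image measure
            exhaust the class.\<close>
          obtain m where m: "y \<in> E n m" "x = g n m y" using elim(2) Rsym[OF xy] unfolding Fn[symmetric] by auto
          obtain i where i: "x \<in> V i" "V i \<inter> {y} = {}" using bspec[OF Vsep sp(1), THEN spec, of "{y}"] sp False by auto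
          have "x \<in> A n m i"
            unfolding A_def using n(1) n(2)[symmetric] m(1) m(2)[symmetric] i sp by auto
          then have "S n m i x = y" by (simp add: S_def swap_map_def n)
          then show ?thesis using TS[of n m i] by metis
        qed
      qed
    qed
  qed
  ultimately show ?thesis by (intro exI[of _ T]) simp
qed

section \<open>Random walks and the Liouville property\<close>

lemma diagonal_pointwise_limit:
  fixes h :: "nat \<Rightarrow> 'y \<Rightarrow> real"
  assumes Y: "countable Y" and b: "\<And>n y. \<bar>h n y\<bar> \<le> C"
  obtains r :: "nat \<Rightarrow> nat" where "strict_mono r" "\<forall>y\<in>Y. convergent (\<lambda>n. h (r n) y)"
proof (cases "Y = {}")
  case True
  then show ?thesis by (intro that[of id]) (auto simp: strict_mono_def)
next
  case False
  define y where "y = from_nat_into Y"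
  have Yr: "Y = range y" using False Y by (simp add: y_def range_from_nat_into)
  have *: "\<exists>r'. strict_mono r' \<and> convergent (\<lambda>n. h ((s \<circ> r') n) (y k))" for s :: "nat \<Rightarrow> nat" and k
  proof -
    have "bounded (range (\<lambda>n. h (s n) (y k)))"
      unfolding bounded_iff using b by (auto intro!: exI[of _ C])
    then obtain l r' where "strict_mono (r' :: nat \<Rightarrow> nat)" "((\<lambda>n. h (s n) (y k)) \<circ> r') \<longlonglongrightarrow> l"
      using bounded_imp_convergent_subsequence by metis
    then show ?thesis by (intro exI[of _ r']) (auto simp: convergent_def o_def)
  qed
  interpret subseqs "\<lambda>k s. convergent (\<lambda>n. h (s n) (y k))"
    by unfold_locales (rule *)
  have "convergent (\<lambda>n. h (diagseq n) (y k))" for k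
  proof -
    have "convergent (\<lambda>n. h ((diagseq \<circ> (+) (Suc k)) n) (y k))"
    proof (rule diagseq_holds)
      fix s r :: "nat \<Rightarrow> nat" and k
      assume "strict_mono r" "convergent (\<lambda>n. h (s n) (y k))"
      then show "convergent (\<lambda>n. h ((s \<circ> r) n) (y k))"
        using convergent_subseq_convergent[of "\<lambda>n. h (s n) (y k)" r] by (simp add: o_def)
    qed
    then have "convergent (\<lambda>n. h (diagseq (n + Suc k)) (y k))" by (simp add: o_def add.commute)
    then show ?thesis by (simp only: convergent_ignore_initial_segment[of "\<lambda>n. h (diagseq n) (y k)"])
  qed
  then show ?thesis using subseq_diagseq Yr by (intro that[of diagseq]) auto
qed

section \<open>Expectations under discrete distributions\<close>

lemma integrable_pmf_bounded:
  fixes f :: "'y \<Rightarrow> real"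
  assumes "\<And>y. \<bar>f y\<bar> \<le> C"
  shows "integrable (measure_pmf p) f"
  using assms by (intro measure_pmf.integrable_const_bound[where B = C]) auto

abbreviation pmf_mean :: "'b pmf \<Rightarrow> ('b \<Rightarrow> real) \<Rightarrow> real" ("\<E>") where
  "\<E> p f \<equiv> measure_pmf.expectation p f"

abbreviation pmf_l1 :: "'b pmf \<Rightarrow> 'b pmf \<Rightarrow> ennreal" where
  "pmf_l1 p q \<equiv> \<integral>\<^sup>+ z. ennreal \<bar>pmf p z - pmf q z\<bar> \<partial>count_space UNIV"

lemma expectation_pmf_bound:
  fixes f :: "'y \<Rightarrow> real"
  assumes "\<And>y. \<bar>f y\<bar> \<le> C"
  shows "\<bar>\<E> p f\<bar> \<le> C"
proof -
  obtain y where "y \<in> set_pmf p" using set_pmf_not_empty[of p] by blast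
  have C: "0 \<le> C" using assms[of y] abs_ge_zero order_trans by blast
  have "\<bar>\<E> p f\<bar> \<le> \<E> p (\<lambda>y. \<bar>f y\<bar>)"
    by (rule integral_abs_bound)
  also have "\<dots> \<le> \<E> p (\<lambda>_. C)"
    using assms C by (intro integral_mono integrable_pmf_bounded[where C = C]) auto
  finally show ?thesis by simp
qed

lemma expectation_bind_pmf:
  fixes f :: "'y \<Rightarrow> real"
  assumes "\<And>y. \<bar>f y\<bar> \<le> C"
  shows "\<E> (p \<bind> q) f = \<E> p (\<lambda>x. \<E> (q x) f)"
  unfolding measure_pmf_bind
proof (rule integral_bind[where B = C and B' = 1 and K = "count_space UNIV"])
  show "(\<lambda>x. measure_pmf (q x)) \<in> measure_pmf p \<rightarrow>\<^sub>M subprob_algebra (count_space UNIV)"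
    by (subst measurable_cong_sets[OF sets_measure_pmf_count_space refl]) (rule measurable_measure_pmf)
  show "finite_measure (measure_pmf p)" by (rule measure_pmf.finite_measure)
qed (use assms in auto)

lemma expectation_pmf_count_space:
  fixes f :: "'y \<Rightarrow> real"
  assumes "\<And>y. \<bar>f y\<bar> \<le> C"
  shows "integrable (count_space UNIV) (\<lambda>z. pmf p z * f z)"
    and "\<E> p f = (LINT z|count_space UNIV. pmf p z * f z)"
proof -
  have "integrable (density (count_space UNIV) (pmf p)) f"
    using integrable_pmf_bounded[OF assms, of p] by (simp add: measure_pmf_eq_density)
  then show "integrable (count_space UNIV) (\<lambda>z. pmf p z * f z)"
    by (subst (asm) integrable_density) auto
  show "\<E> p f = (LINT z|count_space UNIV. pmf p z * f z)"
    unfolding measure_pmf_eq_density by (subst integral_density) auto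
qed

text \<open>Connects expectations with the unordered sums in \<open>harmonic\<close>; terms outside
  the support vanish.\<close>

lemma expectation_pmf_has_sum:
  fixes f :: "'y \<Rightarrow> real"
  assumes f: "\<And>y. \<bar>f y\<bar> \<le> C" and A: "set_pmf p \<subseteq> A"
  shows "((\<lambda>g. f g * pmf p g) has_sum \<E> p f) A"
proof -
  let ?h = "\<lambda>g. pmf p g * f g"
  note E = expectation_pmf_count_space[of f C p, OF f]
  have abs: "Infinite_Set_Sum.abs_summable_on ?h UNIV" using E(1) by (simp add: Infinite_Set_Sum.abs_summable_on_def)
  have "?h summable_on UNIV"
    by (rule abs_summable_summable) (use abs abs_summable_equivalent[of ?h UNIV] in blast)
  moreover have "infsum ?h UNIV = \<E> p f"
    using infsetsum_infsum[OF abs] E(2) by (simp add: infsetsum_def)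
  ultimately have "(?h has_sum \<E> p f) UNIV"
    by (metis has_sum_infsum)
  then show ?thesis
    using A by (subst has_sum_cong_neutral[where T = UNIV and g = ?h]) (auto simp: set_pmf_iff)
qed

text \<open>The test function is the sign of \<open>pmf p z - pmf q z\<close>. Trading the norm for
  a bounded function makes pointwise limits along subsequences available.\<close>

lemma pmf_l1_distance:
  "\<exists>f :: 'y \<Rightarrow> real. (\<forall>z. \<bar>f z\<bar> \<le> 1) \<and>
    pmf_l1 p q =
       ennreal (\<E> p f - \<E> q f)"
proof -
  define f where "f z = (if pmf p z \<ge> pmf q z then 1 else - 1 :: real)" for z
  have f: "\<bar>f z\<bar> \<le> 1" for z by (simp add: f_def)
  note P = expectation_pmf_count_space[of f 1 p, OF f] and Q = expectation_pmf_count_space[of f 1 q, OF f]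
  have eq: "pmf p z * f z - pmf q z * f z = \<bar>pmf p z - pmf q z\<bar>" for z by (simp add: f_def)
  have int: "integrable (count_space UNIV) (\<lambda>z. \<bar>pmf p z - pmf q z\<bar>)"
    using Bochner_Integration.integrable_diff[OF P(1) Q(1)] by (simp add: eq)
  have "\<E> p f - \<E> q f = (LINT z|count_space UNIV. \<bar>pmf p z - pmf q z\<bar>)"
    using Bochner_Integration.integral_diff[OF P(1) Q(1)] P(2) Q(2) by (simp add: eq)
  moreover have "pmf_l1 p q =
      ennreal (LINT z|count_space UNIV. \<bar>pmf p z - pmf q z\<bar>)"
    by (rule nn_integral_eq_integral[OF int]) simp
  ultimately show ?thesis using f by (intro exI[of _ f]) simp
qed

section \<open>Walks and their Cesaro averages\<close>

primrec walk :: "('y \<Rightarrow> 'y pmf) \<Rightarrow> nat \<Rightarrow> 'y \<Rightarrow> 'y pmf" where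
  "walk K 0 y = return_pmf y"
| "walk K (Suc n) y = K y \<bind> walk K n"

text \<open>The walk at a uniformly random time among \<open>0, ..., n\<close>. Averaging makes its
  expectations almost invariant under one step even when the walk is periodic.\<close>

definition cesaro_walk :: "('y \<Rightarrow> 'y pmf) \<Rightarrow> nat \<Rightarrow> 'y \<Rightarrow> 'y pmf" where
  "cesaro_walk K n y = pmf_of_set {..n} \<bind> (\<lambda>k. walk K k y)"

lemma expectation_cesaro_walk:
  fixes f :: "'y \<Rightarrow> real"
  assumes "\<And>y. \<bar>f y\<bar> \<le> C"
  shows "\<E> (cesaro_walk K n y) f =
    (\<Sum>k\<le>n. \<E> (walk K k y) f) / real (Suc n)"
  unfolding cesaro_walk_def using assms
  by (subst expectation_bind_pmf[where C = C]) (simp_all add: integral_pmf_of_set)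

text \<open>The sums over the times \<open>1, ..., n + 1\<close> and \<open>0, ..., n\<close> differ
  by two end terms of absolute value at most 1, whence the 2.\<close>

lemma cesaro_walk_almost_invariant:
  fixes f :: "'y \<Rightarrow> real"
  assumes f: "\<And>y. \<bar>f y\<bar> \<le> 1"
  shows "\<bar>\<E> (K y) (\<lambda>z. \<E> (cesaro_walk K n z) f) -
    \<E> (cesaro_walk K n y) f\<bar> \<le> 2 / real (Suc n)"
proof -
  let ?E = "\<lambda>k z. \<E> (walk K k z) f"
  have b: "\<bar>?E k z\<bar> \<le> 1" for k z by (rule expectation_pmf_bound[OF f])
  have int: "integrable (measure_pmf (K y)) (?E k)" for k
    by (rule integrable_pmf_bounded[where C = 1]) (rule b)
  have S: "\<E> (K y) (?E k) = ?E (Suc k) y" for k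
    using expectation_bind_pmf[of f 1 "K y" "walk K k", OF f] by simp
  have "\<E> (K y) (\<lambda>z. \<E> (cesaro_walk K n z) f) =
      \<E> (K y) (\<lambda>z. (\<Sum>k\<le>n. ?E k z) / real (Suc n))"
    using expectation_cesaro_walk[of f 1 K, OF f] by simp
  also have "\<dots> = (\<Sum>k\<le>n. \<E> (K y) (?E k)) / real (Suc n)"
    using int by (simp add: Bochner_Integration.integral_sum)
  also have "\<dots> = (\<Sum>k\<le>n. ?E (Suc k) y) / real (Suc n)" by (simp add: S del: walk.simps)
  finally have "\<E> (K y) (\<lambda>z. \<E> (cesaro_walk K n z) f) -
      \<E> (cesaro_walk K n y) f =
      ((\<Sum>k\<le>n. ?E (Suc k) y) - (\<Sum>k\<le>n. ?E k y)) / real (Suc n)"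
    using expectation_cesaro_walk[of f 1 K n y, OF f] by (simp only: diff_divide_distrib)
  also have "(\<Sum>k\<le>n. ?E (Suc k) y) - (\<Sum>k\<le>n. ?E k y) = ?E (Suc n) y - ?E 0 y"
    by (induction n) simp_all
  finally have eq: "\<E> (K y) (\<lambda>z. \<E> (cesaro_walk K n z) f) -
      \<E> (cesaro_walk K n y) f = (?E (Suc n) y - ?E 0 y) / real (Suc n)" .
  have "\<bar>?E (Suc n) y - ?E 0 y\<bar> \<le> 2" using b[of "Suc n" y] b[of 0 y] by linarith
  then show ?thesis unfolding eq abs_divide abs_of_nat by (rule divide_right_mono) simp
qed

text \<open>If the distance did not tend to zero, test functions witnessing this would have a pointwise
  limit along a subsequence, which is harmonic but not constant.\<close>

theorem liouville_cesaro_walk: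
  fixes K :: "'y \<Rightarrow> 'y pmf"
  assumes Y: "countable Y" and K: "\<And>y. y \<in> Y \<Longrightarrow> set_pmf (K y) \<subseteq> Y"
    and L: "\<And>(f :: 'y \<Rightarrow> real) C. (\<And>y. \<bar>f y\<bar> \<le> C) \<Longrightarrow> (\<And>y. y \<in> Y \<Longrightarrow> f y = \<E> (K y) f) \<Longrightarrow> f constant_on Y"
    and xy: "x \<in> Y" "y \<in> Y"
  shows "(\<lambda>n. pmf_l1 (cesaro_walk K n x) (cesaro_walk K n y)) \<longlonglongrightarrow> 0"
proof -
  have "\<exists>f. (\<forall>z. \<bar>f z\<bar> \<le> (1::real)) \<and>
    pmf_l1 (cesaro_walk K n x) (cesaro_walk K n y) =
      ennreal (\<E> (cesaro_walk K n x) f - \<E> (cesaro_walk K n y) f)" for n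
    by (rule pmf_l1_distance)
  then have "\<forall>n. \<exists>f. (\<forall>z. \<bar>f z\<bar> \<le> (1::real)) \<and>
    pmf_l1 (cesaro_walk K n x) (cesaro_walk K n y) =
      ennreal (\<E> (cesaro_walk K n x) f - \<E> (cesaro_walk K n y) f)" ..
  then obtain f where f: "\<forall>n. (\<forall>z. \<bar>f n z\<bar> \<le> (1::real)) \<and>
    pmf_l1 (cesaro_walk K n x) (cesaro_walk K n y) =
      ennreal (\<E> (cesaro_walk K n x) (f n) - \<E> (cesaro_walk K n y) (f n))"
    by (rule exE[OF choice])
  define h where "h n z = \<E> (cesaro_walk K n z) (f n)" for n z
  have f1: "\<bar>f n z\<bar> \<le> 1" for n z using f by simp
  have h1: "\<bar>h n z\<bar> \<le> 1" for n z unfolding h_def by (rule expectation_pmf_bound[OF f1])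
  have almost: "\<bar>\<E> (K z) (h n) - h n z\<bar> \<le> 2 / real (Suc n)" for n z
    unfolding h_def by (rule cesaro_walk_almost_invariant[OF f1])
  \<comment> \<open>\<open>ennreal\<close> truncates at zero, so \<open>max 0\<close> gives the real
    sequence behind the distance.\<close>
  have "(\<lambda>n. max 0 (h n x - h n y)) \<longlonglongrightarrow> 0"
  proof (rule ccontr)
    assume "\<not> ?thesis"
    then obtain e where e: "0 < e" "\<not> eventually (\<lambda>n. dist (max 0 (h n x - h n y)) 0 < e) sequentially"
      unfolding tendsto_iff by auto
    from e(2) have "\<exists>\<^sub>F n in sequentially. \<not> dist (max 0 (h n x - h n y)) 0 < e"
      by (simp add: not_eventually)
    then have "\<exists>\<^sub>F n in sequentially. h n x - h n y \<ge> e"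
      by (rule frequently_elim1) (use e(1) in \<open>auto simp: dist_real_def max_def split: if_splits\<close>)
    then have "infinite {n. h n x - h n y \<ge> e}"
      by (simp add: frequently_sequentially infinite_nat_iff_unbounded_le)
    from infinite_enumerate[OF this] obtain s :: "nat \<Rightarrow> nat"
      where s: "strict_mono s" "\<And>n. h (s n) x - h (s n) y \<ge> e"
      by auto
    obtain r :: "nat \<Rightarrow> nat" where r: "strict_mono r" "\<forall>z\<in>Y. convergent (\<lambda>n. h (s (r n)) z)"
      by (rule diagonal_pointwise_limit[of Y "\<lambda>n. h (s n)" 1]) (use Y h1 in auto)
    have sr: "strict_mono (\<lambda>n. s (r n))" using s(1) r(1) by (simp add: strict_mono_def)
    \<comment> \<open>The value 0 off \<open>Y\<close> bounds \<open>l\<close> on the whole type;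
      the kernel at a point of \<open>Y\<close> is supported in \<open>Y\<close> and never sees
      it.\<close>
    define l where "l z = (if z \<in> Y then lim (\<lambda>n. h (s (r n)) z) else 0)" for z
    have lim: "(\<lambda>n. h (s (r n)) z) \<longlonglongrightarrow> l z" if "z \<in> Y" for z
      using r(2) that by (simp add: l_def convergent_LIMSEQ_iff)
    have l1: "\<bar>l z\<bar> \<le> 1" for z
    proof (cases "z \<in> Y")
      case True
      then show ?thesis using h1 by (intro LIMSEQ_le_const2[OF tendsto_rabs[OF lim]]) auto
    qed (simp add: l_def)
    have harm: "l z = \<E> (K z) l" if z: "z \<in> Y" for z
    proof -
      \<comment> \<open>Dominated convergence moves the limit inside the expectation; almost
        invariance then identifies the result with the limit of \<open>h\<close> at
        \<open>z\<close>.\<close>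
      have a: "(\<lambda>n. \<E> (K z) (h (s (r n)))) \<longlonglongrightarrow> \<E> (K z) l"
      proof (rule integral_dominated_convergence[where w = "\<lambda>_. 1"])
        show "AE u in measure_pmf (K z). (\<lambda>n. h (s (r n)) u) \<longlonglongrightarrow> l u"
          using K[OF z] lim by (auto intro!: AE_pmfI)
        show "AE u in measure_pmf (K z). norm (h (s (r n)) u) \<le> 1" for n
          by (rule AE_I2) (simp add: h1)
      qed simp_all
      have b: "(\<lambda>n. \<E> (K z) (h (s (r n))) - h (s (r n)) z) \<longlonglongrightarrow> 0"
      proof (rule Lim_null_comparison)
        show "eventually (\<lambda>n. norm (\<E> (K z) (h (s (r n))) - h (s (r n)) z) \<le> 2 * inverse (real (Suc (s (r n))))) sequentially"
          using almost by (simp add: divide_inverse)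
        have "(\<lambda>n. inverse (real (Suc (s (r n))))) \<longlonglongrightarrow> 0"
          using LIMSEQ_subseq_LIMSEQ[OF LIMSEQ_inverse_real_of_nat sr] by (simp add: o_def)
        then show "(\<lambda>n. 2 * inverse (real (Suc (s (r n))))) \<longlonglongrightarrow> 0"
          by (rule tendsto_mult_right_zero)
      qed
      have "(\<lambda>n. h (s (r n)) z) \<longlonglongrightarrow> \<E> (K z) l"
        using tendsto_diff[OF a b] by simp
      then show ?thesis by (rule LIMSEQ_unique[OF lim[OF z]])
    qed
    have "l constant_on Y" by (rule L[of l 1]) (rule l1, rule harm)
    then have "l x = l y" using xy by (auto simp: constant_on_def)
    moreover have "(\<lambda>n. h (s (r n)) x - h (s (r n)) y) \<longlonglongrightarrow> l x - l y"
      by (intro tendsto_diff lim xy)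
    then have "e \<le> l x - l y" by (rule LIMSEQ_le_const) (use s(2) in auto)
    ultimately show False using e(1) by simp
  qed
  then have "(\<lambda>n. ennreal (max 0 (h n x - h n y))) \<longlonglongrightarrow> ennreal 0" by (rule tendsto_ennrealI)
  moreover have "pmf_l1 (cesaro_walk K n x) (cesaro_walk K n y)
      = ennreal (max 0 (h n x - h n y))" for n
    using spec[OF f, of n] by (simp add: h_def ennreal_max_0 max_def ennreal_neg)
  ultimately show ?thesis by simp
qed

section \<open>Liouville measures for highly transitive actions\<close>

text \<open>The complements of the two lists in \<open>D\<close> have equal size; any bijection
  between them completes the partial map.\<close>

lemma permutes_extending_distinct_lists:
  assumes D: "finite D" and ys: "distinct ys" "set ys \<subseteq> D" and zs: "distinct zs" "set zs \<subseteq> D"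
    and len: "length ys = length zs"
  shows "\<exists>\<tau>. \<tau> permutes D \<and> map \<tau> ys = zs"
proof -
  have "card (D - set ys) = card (D - set zs)"
    using D ys zs len by (simp add: card_Diff_subset distinct_card)
  then obtain b where b: "bij_betw b (D - set ys) (D - set zs)"
    using D finite_same_card_bij[of "D - set ys" "D - set zs"] by auto
  define \<tau> where "\<tau> v = (if v \<in> set ys then the (map_of (zip ys zs) v) else if v \<in> D then b v else v)" for v
  have m: "map \<tau> ys = zs"
    by (rule nth_equalityI) (use len ys in \<open>simp_all add: \<tau>_def map_of_zip_nth\<close>)
  have "inj_on \<tau> (set ys)" using zs(1) m distinct_map[of \<tau> ys] by simp
  moreover have "\<tau> ` set ys = set zs" using arg_cong[OF m, of set] by simp
  ultimately have 1: "bij_betw \<tau> (set ys) (set zs)" by (simp add: bij_betw_def)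
  have 2: "bij_betw \<tau> (D - set ys) (D - set zs)"
    by (rule bij_betw_cong[THEN iffD1, OF _ b]) (simp add: \<tau>_def)
  have "bij_betw \<tau> (set ys \<union> (D - set ys)) (set zs \<union> (D - set zs))"
    by (rule bij_betw_combine[OF 1 2]) auto
  moreover have "set ys \<union> (D - set ys) = D" "set zs \<union> (D - set zs) = D" using ys zs by auto
  ultimately have "bij_betw \<tau> D D" by simp
  then have "\<tau> permutes D" by (rule bij_imp_permutes) (use ys in \<open>auto simp: \<tau>_def\<close>)
  with m show ?thesis by auto
qed

section \<open>Symmetric measures that equalise tuples\<close>

definition symmetrization :: "('g \<Rightarrow> 'g) \<Rightarrow> 'g pmf \<Rightarrow> 'g pmf" where
  "symmetrization i p = pmf_of_set UNIV \<bind> (\<lambda>b. if b then p else map_pmf i p)"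

text \<open>Applying \<open>i\<close> exchanges the two halves of the mixture, and a fair coin is
  invariant under \<open>Not\<close>.\<close>

lemma map_pmf_symmetrization:
  assumes "\<And>g. g \<in> set_pmf p \<Longrightarrow> i (i g) = g"
  shows "map_pmf i (symmetrization i p) = symmetrization i p"
proof -
  let ?f = "\<lambda>b. if b then p else map_pmf i p" and ?U = "pmf_of_set (UNIV :: bool set)"
  have ii: "map_pmf i (map_pmf i p) = p"
    using assms by (simp add: pmf.map_comp map_pmf_idI)
  have "bij Not" by (rule involuntory_imp_bij) simp
  then have N: "map_pmf Not ?U = ?U" by (intro map_pmf_of_set_bij_betw) auto
  have "map_pmf i (symmetrization i p) = ?U \<bind> (\<lambda>b. map_pmf i (?f b))"
    by (simp add: symmetrization_def map_bind_pmf)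
  also have "(\<lambda>b. map_pmf i (?f b)) = (\<lambda>b. ?f (Not b))" by (auto simp: ii)
  also have "?U \<bind> (\<lambda>b. ?f (Not b)) = map_pmf Not ?U \<bind> ?f" by (simp only: bind_map_pmf)
  finally show ?thesis by (simp only: N symmetrization_def)
qed

lemma set_pmf_symmetrization: "set_pmf (symmetrization i p) = set_pmf p \<union> i ` set_pmf p"
  by (auto simp: symmetrization_def set_bind_pmf UNIV_bool)

lemma map_pmf_symmetrization_const:
  assumes "map_pmf F p = q" "map_pmf (\<lambda>g. F (i g)) p = q"
  shows "map_pmf F (symmetrization i p) = q"
proof -
  have "map_pmf F (symmetrization i p) =
      pmf_of_set UNIV \<bind> (\<lambda>b. map_pmf F (if b then p else map_pmf i p))"
    by (simp add: symmetrization_def map_bind_pmf)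
  also have "(\<lambda>b. map_pmf F (if b then p else map_pmf i p)) = (\<lambda>_. q)"
    using assms by (auto simp: pmf.map_comp o_def)
  finally show ?thesis by simp
qed

lemma symmetric_measureI:
  assumes H: "group H" and sub: "set_pmf \<nu> \<subseteq> carrier H" and s: "map_pmf (m_inv H) \<nu> = \<nu>"
  shows "symmetric_measure H \<nu>"
  unfolding symmetric_measure_def
proof
  interpret group H by fact
  fix g assume g: "g \<in> carrier H"
  have inj: "inj_on (m_inv H) (set_pmf \<nu>)"
    by (rule inj_on_subset[OF inv_inj sub])
  have pos: "pmf \<nu> (m_inv H k) = pmf \<nu> k" if "k \<in> set_pmf \<nu>" for k
    using pmf_map_inj[OF inj that] s by simp
  show "pmf \<nu> g = pmf \<nu> (m_inv H g)"
  proof (cases "g \<in> set_pmf \<nu>")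
    case True
    then show ?thesis using pos by simp
  next
    case False
    have "m_inv H g \<notin> set_pmf \<nu>"
    proof
      assume i: "m_inv H g \<in> set_pmf \<nu>"
      then have "pmf \<nu> g = pmf \<nu> (m_inv H g)" using pos[OF i] g by simp
      then show False using False i by (simp add: set_pmf_iff)
    qed
    then show ?thesis using False by (simp add: set_pmf_iff)
  qed
qed

text \<open>A group element \<open>h \<sigma>\<close> is chosen for each permutation,
  \<open>\<sigma>\<close> is drawn uniformly, and the result is symmetrised. The uniform law is
  invariant under inversion, so both halves act on \<open>F\<close> as a uniform permutation; it is
  invariant under right translation by a permutation taking \<open>y\<close> to \<open>y'\<close>,
  so the image law of a tuple depends on its length alone.\<close>

lemma exists_mixing_pmf:
  assumes ga: "group_action H E \<phi>" and F: "finite F" "F \<subseteq> E"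
    and tr: "\<And>\<sigma>. \<sigma> permutes F \<Longrightarrow> \<exists>g\<in>carrier H. \<forall>d\<in>F. \<phi> g d = \<sigma> d"
  shows "\<exists>\<kappa>. finite (set_pmf \<kappa>) \<and> set_pmf \<kappa> \<subseteq> carrier H \<and> map_pmf (m_inv H) \<kappa> = \<kappa> \<and>
    (\<forall>n. \<forall>y\<in>tuples n F. \<forall>y'\<in>tuples n F. map_pmf (\<lambda>g. map (\<phi> g) y) \<kappa> = map_pmf (\<lambda>g. map (\<phi> g) y') \<kappa>)"
proof -
  interpret group_action H E \<phi> by fact
  interpret group H using group_hom by (rule group_hom.axioms(1))
  let ?P = "{\<sigma>. \<sigma> permutes F}"
  have P: "finite ?P" "?P \<noteq> {}" using finite_permutations[OF F(1)] by (auto intro: exI[of _ id] permutes_id)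
  define U where "U = pmf_of_set ?P"
  have setU: "set_pmf U = ?P" unfolding U_def using P by (intro set_pmf_of_set) auto
  have "\<forall>\<sigma>. \<exists>g. \<sigma> permutes F \<longrightarrow> g \<in> carrier H \<and> (\<forall>d\<in>F. \<phi> g d = \<sigma> d)" using tr by auto
  then obtain h where h: "\<forall>\<sigma>. \<sigma> permutes F \<longrightarrow> h \<sigma> \<in> carrier H \<and> (\<forall>d\<in>F. \<phi> (h \<sigma>) d = \<sigma> d)"
    by (rule exE[OF choice])
  have hc: "h \<sigma> \<in> carrier H" if "\<sigma> permutes F" for \<sigma> using h that by auto
  have h1: "\<phi> (h \<sigma>) d = \<sigma> d" if "\<sigma> permutes F" "d \<in> F" for \<sigma> d using h that by auto
  \<comment> \<open>The inverse of \<open>h \<sigma>\<close> acts on \<open>F\<close> as the inverse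
    permutation because \<open>\<sigma>\<close> maps \<open>F\<close> onto itself.\<close>
  have h2: "\<phi> (m_inv H (h \<sigma>)) d = Hilbert_Choice.inv \<sigma> d" if "\<sigma> permutes F" "d \<in> F" for \<sigma> d
  proof (rule orbit_sym_aux[OF hc[OF that(1)]])
    have i: "Hilbert_Choice.inv \<sigma> d \<in> F"
      using permutes_in_image[OF permutes_inv[OF that(1)]] that(2) by auto
    then show "Hilbert_Choice.inv \<sigma> d \<in> E" using F(2) by auto
    show "\<phi> (h \<sigma>) (Hilbert_Choice.inv \<sigma> d) = d"
      using h1[OF that(1) i] permutes_inverses(1)[OF that(1)] by simp
  qed
  define \<Lambda> where "\<Lambda> y = map_pmf (\<lambda>\<sigma>. map \<sigma> y) U" for y
  have U_inv: "map_pmf Hilbert_Choice.inv U = U"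
    unfolding U_def
  proof (rule map_pmf_of_set_bij_betw[OF _ P(2,1)])
    show "bij_betw Hilbert_Choice.inv ?P ?P"
      by (rule bij_betw_byWitness[where f' = Hilbert_Choice.inv])
        (auto simp: permutes_inv_inv permutes_inv)
  qed
  define \<alpha> where "\<alpha> = map_pmf h U"
  define \<kappa> where "\<kappa> = symmetrization (m_inv H) \<alpha>"
  have set\<alpha>: "set_pmf \<alpha> \<subseteq> carrier H" using hc by (auto simp: \<alpha>_def setU)
  have law: "map_pmf (\<lambda>g. map (\<phi> g) y) \<kappa> = \<Lambda> y" if y: "set y \<subseteq> F" for y
    unfolding \<kappa>_def
  proof (rule map_pmf_symmetrization_const)
    show "map_pmf (\<lambda>g. map (\<phi> g) y) \<alpha> = \<Lambda> y"
      unfolding \<alpha>_def \<Lambda>_def pmf.map_comp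
      by (rule map_pmf_cong[OF refl]) (use y h1 in \<open>auto simp: setU\<close>)
    have "map_pmf (\<lambda>g. map (\<phi> (m_inv H g)) y) \<alpha> = map_pmf (\<lambda>\<sigma>. map (Hilbert_Choice.inv \<sigma>) y) U"
      unfolding \<alpha>_def pmf.map_comp
      by (rule map_pmf_cong[OF refl]) (use y h2 in \<open>auto simp: setU\<close>)
    also have "\<dots> = map_pmf (\<lambda>\<sigma>. map \<sigma> y) (map_pmf Hilbert_Choice.inv U)"
      by (simp add: pmf.map_comp o_def)
    finally show "map_pmf (\<lambda>g. map (\<phi> (m_inv H g)) y) \<alpha> = \<Lambda> y" by (simp only: U_inv \<Lambda>_def)
  qed
  have "\<Lambda> y' = \<Lambda> y" if yy': "y \<in> tuples n F" "y' \<in> tuples n F" for n y y'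
  proof -
    obtain \<tau> where \<tau>: "\<tau> permutes F" "map \<tau> y = y'"
      using permutes_extending_distinct_lists[OF F(1), of y y'] yy' by (auto simp: tuples_def)
    have "map_pmf (\<lambda>\<sigma>. \<sigma> \<circ> \<tau>) U = U"
      unfolding U_def
    proof (rule map_pmf_of_set_bij_betw[OF _ P(2,1)])
      have o: "\<sigma> \<circ> \<tau> \<circ> Hilbert_Choice.inv \<tau> = \<sigma>" "\<sigma> \<circ> Hilbert_Choice.inv \<tau> \<circ> \<tau> = \<sigma>" for \<sigma>
        by (simp_all add: o_assoc[symmetric] permutes_inv_o[OF \<tau>(1)])
      show "bij_betw (\<lambda>\<sigma>. \<sigma> \<circ> \<tau>) ?P ?P"
        by (rule bij_betw_byWitness[where f' = "\<lambda>\<sigma>. \<sigma> \<circ> Hilbert_Choice.inv \<tau>"])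
          (auto simp: o intro: permutes_compose \<tau>(1) permutes_inv)
    qed
    then have "\<Lambda> y = map_pmf (\<lambda>\<sigma>. map \<sigma> y) (map_pmf (\<lambda>\<sigma>. \<sigma> \<circ> \<tau>) U)" by (simp only: \<Lambda>_def)
    also have "\<dots> = \<Lambda> (map \<tau> y)" by (simp add: pmf.map_comp o_def \<Lambda>_def)
    finally show ?thesis by (simp only: \<tau>(2))
  qed
  then have "\<forall>n. \<forall>y\<in>tuples n F. \<forall>y'\<in>tuples n F. map_pmf (\<lambda>g. map (\<phi> g) y) \<kappa> = map_pmf (\<lambda>g. map (\<phi> g) y') \<kappa>"
    using law by (auto simp: tuples_def)
  moreover have "map_pmf (m_inv H) \<kappa> = \<kappa>"
    unfolding \<kappa>_def using set\<alpha> by (intro map_pmf_symmetrization) auto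
  moreover have "set_pmf \<kappa> \<subseteq> carrier H" using set\<alpha> by (auto simp: \<kappa>_def set_pmf_symmetrization)
  moreover have "finite (set_pmf \<kappa>)" using P by (simp add: \<kappa>_def set_pmf_symmetrization \<alpha>_def setU)
  ultimately show ?thesis by (intro exI[of _ \<kappa>] conjI)
qed

section \<open>Walks that forget their starting point\<close>

primrec reach :: "('g \<Rightarrow> 'y \<Rightarrow> 'y) \<Rightarrow> 'g set \<Rightarrow> 'y set \<Rightarrow> nat \<Rightarrow> 'y set" where
  "reach act S B 0 = B"
| "reach act S B (Suc k) = reach act S B k \<union> (\<Union>g\<in>S. act g ` reach act S B k)"

lemma finite_reach: "finite S \<Longrightarrow> finite B \<Longrightarrow> finite (reach act S B k)"
  by (induction k) auto

lemma reach_mono: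
  assumes "S \<subseteq> S'" "B \<subseteq> B'"
  shows "reach act S B k \<subseteq> reach act S' B' k"
proof (induction k)
  case (Suc k)
  show ?case unfolding reach.simps by (intro Un_mono UN_mono image_mono Suc assms(1))
qed (use assms in simp)

lemma reach_mono_steps: "k \<le> l \<Longrightarrow> reach act S B k \<subseteq> reach act S B l"
  by (induction l) (auto simp: le_Suc_eq)

lemma reach_subset:
  assumes "B \<subseteq> Y" "\<And>g. g \<in> S \<Longrightarrow> act g ` Y \<subseteq> Y"
  shows "reach act S B k \<subseteq> Y"
proof (induction k)
  case (Suc k)
  then show ?case using assms(2) by auto
qed (use assms(1) in simp)

lemma abs_expectation_le:
  fixes f g :: "'b \<Rightarrow> real"
  assumes f: "\<And>y. \<bar>f y\<bar> \<le> C" and g: "\<And>y. \<bar>g y\<bar> \<le> D" and le: "\<And>y. y \<in> set_pmf p \<Longrightarrow> \<bar>f y\<bar> \<le> g y"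
  shows "\<bar>\<E> p f\<bar> \<le> \<E> p g"
proof -
  have "\<bar>\<E> p f\<bar> \<le> \<E> p (\<lambda>y. \<bar>f y\<bar>)"
    by (rule integral_abs_bound)
  also have "\<dots> \<le> \<E> p g"
  proof (rule integral_mono_AE)
    show "integrable (measure_pmf p) (\<lambda>y. \<bar>f y\<bar>)"
      by (rule integrable_pmf_bounded[where C = C]) (simp add: f)
    show "integrable (measure_pmf p) g" by (rule integrable_pmf_bounded[OF g])
    show "AE y in measure_pmf p. \<bar>f y\<bar> \<le> g y" by (rule AE_pmfI) (rule le)
  qed
  finally show ?thesis .
qed

lemma expectation_diff_bounded:
  fixes f g :: "'b \<Rightarrow> real"
  assumes f: "\<And>y. \<bar>f y\<bar> \<le> C" and g: "\<And>y. \<bar>g y\<bar> \<le> C"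
  shows "\<E> p f - \<E> p g = \<E> p (\<lambda>y. f y - g y)"
  by (rule Bochner_Integration.integral_diff[symmetric])
    (rule integrable_pmf_bounded[OF f], rule integrable_pmf_bounded[OF g])

text \<open>The step distribution is a mixture of \<open>\<kappa> j\<close> with weights \<open>\<tau> j\<close>, where
  \<open>\<kappa> j\<close> uses the mixing part \<open>\<gamma> j\<close> except with probability \<open>\<epsilon> j\<close>.  With overwhelming probability the walk
  makes a step of level at least \<open>i\<close> before leaving the finite set \<open>Z N\<close>, and the first such step
  erases the starting point.\<close>

lemma mixing_walk_estimate:
  fixes f :: "'z \<Rightarrow> real" and act :: "'g \<Rightarrow> 'z \<Rightarrow> 'z" and i :: nat
  assumes f: "\<And>z. \<bar>f z\<bar> \<le> C"
    and \<kappa>: "\<And>j. \<kappa> j = bernoulli_pmf (\<epsilon> j) \<bind> (\<lambda>b. if b then \<eta> j else \<gamma> j)"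
    and \<epsilon>: "\<And>j. 0 \<le> \<epsilon> j" "\<And>j. \<epsilon> j \<le> 1" "\<And>j. i \<le> j \<Longrightarrow> \<epsilon> j \<le> \<delta>"
    and harm: "\<And>z. z \<in> Z N \<Longrightarrow> f z = \<E> (\<tau> \<bind> \<kappa>) (\<lambda>g. f (act g z))"
    and Zmono: "\<And>m. m \<le> N \<Longrightarrow> Z m \<subseteq> Z N"
    and Zstep: "\<And>m z j g. Suc m \<le> N \<Longrightarrow> z \<in> Z m \<Longrightarrow> j < i \<Longrightarrow> g \<in> set_pmf (\<kappa> j) \<Longrightarrow> act g z \<in> Z (Suc m)"
    and mix: "\<And>j z z'. i \<le> j \<Longrightarrow> z \<in> Z N \<Longrightarrow> z' \<in> Z N \<Longrightarrow>
                map_pmf (\<lambda>g. act g z) (\<gamma> j) = map_pmf (\<lambda>g. act g z') (\<gamma> j)"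
  shows "m + k \<le> N \<Longrightarrow> z \<in> Z m \<Longrightarrow> z' \<in> Z m \<Longrightarrow>
    \<bar>f z - f z'\<bar> \<le> 2 * C * measure_pmf.prob \<tau> {..<i} ^ k + 2 * C * \<delta>"
proof (induction k arbitrary: m z z')
  case 0
  have C: "0 \<le> C" using f[of z] by linarith
  have "0 \<le> \<delta>" using \<epsilon>(1)[of i] \<epsilon>(3)[OF order_refl] by linarith
  then have "0 \<le> 2 * C * \<delta>" using C by simp
  then show ?case using f[of z] f[of z'] by simp
next
  case (Suc k)
  let ?a = "measure_pmf.prob \<tau> {..<i}"
  let ?B = "2 * C * ?a ^ k"
  have C: "0 \<le> C" using f[of z] by linarith
  have \<delta>: "0 \<le> \<delta>" using \<epsilon>(1)[of i] \<epsilon>(3)[OF order_refl] by linarith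
  have B: "0 \<le> ?B" using C by simp
  have fa: "\<bar>f (act g u)\<bar> \<le> C" for g u by (rule f)
  define q where "q u j = \<E> (\<kappa> j) (\<lambda>g. f (act g u))" for u j
  have qC: "\<bar>q u j\<bar> \<le> C" for u j unfolding q_def by (rule expectation_pmf_bound[OF fa])
  have fq: "f u = \<E> \<tau> (q u)" if "u \<in> Z m" for u
  proof -
    have "u \<in> Z N" using Zmono[of m] Suc.prems(1) that by auto
    then show ?thesis
      unfolding q_def using harm[of u] expectation_bind_pmf[of "\<lambda>g. f (act g u)" C \<tau> \<kappa>, OF fa] by simp
  qed
  \<comment> \<open>Below level \<open>i\<close> the same \<open>g\<close> moves both points into
    \<open>Z (Suc m)\<close>, and the induction hypothesis applies with one step fewer to
    go.\<close>
  have low: "\<bar>q z j - q z' j\<bar> \<le> ?B + 2 * C * \<delta>" if j: "j < i" for j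
  proof -
    have "q z j - q z' j = \<E> (\<kappa> j) (\<lambda>g. f (act g z) - f (act g z'))"
      unfolding q_def by (rule expectation_diff_bounded[OF fa fa])
    also have "\<bar>\<dots>\<bar> \<le> \<E> (\<kappa> j) (\<lambda>_. ?B + 2 * C * \<delta>)"
    proof (rule abs_expectation_le[where C = "2 * C" and D = "\<bar>?B + 2 * C * \<delta>\<bar>"])
      fix g
      show "\<bar>f (act g z) - f (act g z')\<bar> \<le> 2 * C"
        using f[of "act g z"] f[of "act g z'"] by linarith
      assume g: "g \<in> set_pmf (\<kappa> j)"
      show "\<bar>f (act g z) - f (act g z')\<bar> \<le> ?B + 2 * C * \<delta>"
      proof (rule Suc.IH)
        show "Suc m + k \<le> N" using Suc.prems(1) by simp
        show "act g z \<in> Z (Suc m)" by (rule Zstep[OF _ Suc.prems(2) j g]) (use Suc.prems(1) in simp)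
        show "act g z' \<in> Z (Suc m)" by (rule Zstep[OF _ Suc.prems(3) j g]) (use Suc.prems(1) in simp)
      qed
    qed simp
    finally show ?thesis by simp
  qed
  \<comment> \<open>From level \<open>i\<close> on the mixing part acts alike on both points and
    cancels; only the share \<open>\<epsilon> j\<close> of \<open>\<eta> j\<close>
    contributes.\<close>
  have high: "\<bar>q z j - q z' j\<bar> \<le> 2 * C * \<delta>" if j: "i \<le> j" for j
  proof -
    let ?E = "\<lambda>p u. \<E> p (\<lambda>g. f (act g u))"
    have q: "q u j = ?E (\<eta> j) u * \<epsilon> j + ?E (\<gamma> j) u * (1 - \<epsilon> j)" for u
      unfolding q_def \<kappa> using \<epsilon>(1,2)
      by (subst expectation_bind_pmf[where C = C]) (simp_all add: f)
    have E: "?E (\<gamma> j) u = \<E> (map_pmf (\<lambda>g. act g u) (\<gamma> j)) f" for u by simp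
    have zN: "z \<in> Z N" "z' \<in> Z N" using Zmono[of m] Suc.prems by auto
    have "?E (\<gamma> j) z = ?E (\<gamma> j) z'" unfolding E mix[OF j zN] ..
    then have "q z j - q z' j = (?E (\<eta> j) z - ?E (\<eta> j) z') * \<epsilon> j" by (simp add: q algebra_simps)
    also have "\<bar>\<dots>\<bar> = \<bar>?E (\<eta> j) z - ?E (\<eta> j) z'\<bar> * \<epsilon> j" using \<epsilon>(1)[of j] by (simp add: abs_mult)
    also have "\<dots> \<le> 2 * C * \<delta>"
    proof (rule mult_mono)
      show "\<bar>?E (\<eta> j) z - ?E (\<eta> j) z'\<bar> \<le> 2 * C"
        using expectation_pmf_bound[of "\<lambda>g. f (act g z)" C "\<eta> j", OF fa]
          expectation_pmf_bound[of "\<lambda>g. f (act g z')" C "\<eta> j", OF fa] by linarith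
    qed (use \<epsilon>(1)[of j] \<epsilon>(3)[OF j] C in auto)
    finally show ?thesis .
  qed
  \<comment> \<open>Both cases contain the error \<open>2 * C * \<delta>\<close> once, so it does
    not accumulate over the steps. Only the other term gains a factor, the probability of a level
    below \<open>i\<close>.\<close>
  have "f z - f z' = \<E> \<tau> (\<lambda>j. q z j - q z' j)"
    unfolding fq[OF Suc.prems(2)] fq[OF Suc.prems(3)] by (rule expectation_diff_bounded[OF qC qC])
  also have "\<bar>\<dots>\<bar> \<le> \<E> \<tau> (\<lambda>j. ?B * indicator {..<i} j + 2 * C * \<delta>)"
  proof (rule abs_expectation_le[where C = "2 * C" and D = "?B + 2 * C * \<delta>"])
    fix j
    show "\<bar>q z j - q z' j\<bar> \<le> 2 * C" using qC[of z j] qC[of z' j] by linarith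
    show "\<bar>?B * indicator {..<i} j + 2 * C * \<delta>\<bar> \<le> ?B + 2 * C * \<delta>"
      using B C \<delta> by (auto simp: indicator_def)
    show "\<bar>q z j - q z' j\<bar> \<le> ?B * indicator {..<i} j + 2 * C * \<delta>"
      using low[of j] high[of j] by (cases "j < i") (auto simp: not_less)
  qed
  also have "\<dots> = ?B * ?a + 2 * C * \<delta>"
  proof -
    have "integrable (measure_pmf \<tau>) (indicator {..<i} :: nat \<Rightarrow> real)"
      by (rule integrable_pmf_bounded[where C = 1]) (simp add: indicator_def)
    then show ?thesis by simp
  qed
  finally show ?case by (simp add: mult.assoc mult.commute[of ?a])
qed

text \<open>The erasing set of level \<open>j\<close> has to contain whatever the lower levels reach
  in \<open>N j\<close> steps. So \<open>F\<close>, \<open>\<gamma>\<close> and \<open>K\<close>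
  take the set \<open>S\<close> of group elements used so far as a parameter, into which the
  recursion \<open>A\<close> feeds the supports. For points among the first \<open>i\<close> in the
  enumeration of the orbit, the remaining dependence of \<open>f\<close> on the starting tuple is of
  order \<open>C / (i + 1)\<close>.\<close>

theorem exists_liouville_measure:
  fixes \<phi> :: "'g \<Rightarrow> 'y \<Rightarrow> 'y" and H (structure)
  assumes ga: "group_action H E \<phi>" and c: "countable (carrier H)" and x: "x \<in> E"
    and tr: "\<And>F \<sigma>. finite F \<Longrightarrow> F \<subseteq> orbit H \<phi> x \<Longrightarrow> \<sigma> permutes F \<Longrightarrow> \<exists>g\<in>carrier H. \<forall>d\<in>F. \<phi> g d = \<sigma> d"
  shows "\<exists>\<nu>. set_pmf \<nu> \<subseteq> carrier H \<and> symmetric_measure H \<nu> \<and> nondegenerate_measure H \<nu> \<and>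
    (\<forall>n. liouville H (diagonal_action \<phi>) (tuples n (orbit H \<phi> x)) \<nu>)"
proof -
  interpret group_action H E \<phi> by fact
  interpret group H using group_hom by (rule group_hom.axioms(1))
  let ?O = "orbit H \<phi> x"
  define gs where "gs = from_nat_into (carrier H)"
  have ne: "carrier H \<noteq> {}" using one_closed by auto
  have gs: "range gs = carrier H" unfolding gs_def by (rule range_from_nat_into[OF ne c])
  then have gsc: "gs j \<in> carrier H" for j by auto
  define p where "p j = \<phi> (gs j) x" for j
  have p: "range p = ?O" unfolding p_def orbit_def gs[symmetric] by auto
  have OE: "?O \<subseteq> E" unfolding orbit_def using element_image x by auto
  have Oinv: "\<phi> g ` ?O \<subseteq> ?O" if g: "g \<in> carrier H" for g
  proof
    fix u assume "u \<in> \<phi> g ` ?O"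
    then obtain k where k: "k \<in> carrier H" "u = \<phi> g (\<phi> k x)" by (auto simp: orbit_def)
    then have "u = \<phi> (g \<otimes>\<^bsub>H\<^esub> k) x" using composition_rule[OF x g k(1)] by simp
    then show "u \<in> ?O" using g k(1) by (auto simp: orbit_def)
  qed
  \<comment> \<open>Full support keeps each \<open>a i\<close> below 1 and lets every level occur in
    the mixture.\<close>
  define \<tau> where "\<tau> = geometric_pmf (1/2)"
  have set\<tau>: "set_pmf \<tau> = UNIV" unfolding \<tau>_def by (rule set_pmf_geometric) auto
  define a where "a i = measure_pmf.prob \<tau> {..<i}" for i
  have a0: "0 \<le> a i" for i by (simp add: a_def)
  have a1: "a i < 1" for i
  proof -
    have "a i + measure_pmf.prob \<tau> {i} = measure_pmf.prob \<tau> ({..<i} \<union> {i})"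
      unfolding a_def by (rule measure_pmf.finite_measure_Union[symmetric]) auto
    also have "\<dots> \<le> 1" by simp
    finally have "a i + pmf \<tau> i \<le> 1" by (simp add: measure_pmf_single)
    moreover have "0 < pmf \<tau> i" using set\<tau> by (simp add: pmf_positive)
    ultimately show ?thesis by linarith
  qed
  have "\<forall>i. \<exists>n. a i ^ n < 1 / (real i + 1)"
    using a1 by (intro allI real_arch_pow_inv) auto
  then obtain N0 where N0: "\<forall>i. a i ^ N0 i < 1 / (real i + 1)" by (rule exE[OF choice])
  \<comment> \<open>Summation makes the number of steps monotone; this puts the set reached for
    \<open>i\<close> inside the erasing set of every level \<open>j \<ge> i\<close>.\<close>
  define N where "N i = (\<Sum>l\<le>i. N0 l)" for i
  have Nmono: "N i \<le> N j" if "i \<le> j" for i j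
    unfolding N_def by (rule sum_mono2) (use that in auto)
  have aN: "a i ^ N i \<le> 1 / (real i + 1)" for i
  proof -
    have "N0 i \<le> N i" unfolding N_def by (rule member_le_sum) auto
    then have "a i ^ N i \<le> a i ^ N0 i" by (rule power_decreasing) (use a0 a1[of i] in auto)
    then show ?thesis using spec[OF N0, of i] by linarith
  qed
  define F where "F j S = reach \<phi> S (p ` {..<j}) (N j)" for j S
  define P where "P F \<kappa> \<longleftrightarrow> finite (set_pmf \<kappa>) \<and> set_pmf \<kappa> \<subseteq> carrier H \<and> map_pmf (m_inv H) \<kappa> = \<kappa> \<and>
    (\<forall>n. \<forall>y\<in>tuples n F. \<forall>y'\<in>tuples n F. map_pmf (\<lambda>g. map (\<phi> g) y) \<kappa> = map_pmf (\<lambda>g. map (\<phi> g) y') \<kappa>)" for F \<kappa>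
  define \<gamma> where "\<gamma> j S = (SOME \<kappa>. P (F j S) \<kappa>)" for j S
  have F: "finite (F j S)" "F j S \<subseteq> ?O" if "finite S" "S \<subseteq> carrier H" for j S
  proof -
    show "finite (F j S)" unfolding F_def using that by (intro finite_reach) auto
    show "F j S \<subseteq> ?O" unfolding F_def
      by (rule reach_subset) (use p Oinv that in auto)
  qed
  have \<gamma>: "P (F j S) (\<gamma> j S)" if S: "finite S" "S \<subseteq> carrier H" for j S
    unfolding \<gamma>_def
  proof (rule someI_ex)
    show "\<exists>\<kappa>. P (F j S) \<kappa>"
      unfolding P_def
    proof (rule exists_mixing_pmf[OF ga F(1)[OF S]])
      show "F j S \<subseteq> E" using F(2)[OF S] OE by (rule subset_trans)
    qed (rule tr[OF F[OF S]])
  qed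
  \<comment> \<open>Contributes \<open>gs j\<close> and its inverse, so that the support of
    \<open>\<nu>\<close> is the whole group. Its share \<open>\<epsilon> j\<close> tends to zero,
    which makes a failure to erase negligible.\<close>
  define \<eta> where "\<eta> j = symmetrization (m_inv H) (return_pmf (gs j))" for j
  define \<epsilon> where "\<epsilon> j = 1 / (real j + 2)" for j
  have \<epsilon>: "0 < \<epsilon> j" "\<epsilon> j < 1" "i \<le> j \<Longrightarrow> \<epsilon> j \<le> \<epsilon> i" for i j
    by (auto simp: \<epsilon>_def field_simps)
  define K where "K j S = bernoulli_pmf (\<epsilon> j) \<bind> (\<lambda>b. if b then \<eta> j else \<gamma> j S)" for j S
  \<comment> \<open>\<open>A j\<close> is the finite union of the supports of all levels below
    \<open>j\<close>.\<close>
  define A where "A = rec_nat {} (\<lambda>j S. S \<union> set_pmf (K j S))"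
  have A0: "A 0 = {}" and AS: "A (Suc j) = A j \<union> set_pmf (K j (A j))" for j
    by (simp_all add: A_def)
  have setK: "set_pmf (K j S) = set_pmf (\<eta> j) \<union> set_pmf (\<gamma> j S)" for j S
    unfolding K_def set_bind_pmf using \<epsilon>[of j] by (auto simp: set_pmf_bernoulli UNIV_bool split: if_splits)
  have set\<eta>: "set_pmf (\<eta> j) = {gs j, m_inv H (gs j)}" for j
    by (auto simp: \<eta>_def set_pmf_symmetrization)
  have A: "finite (A j) \<and> A j \<subseteq> carrier H" for j
  proof (induction j)
    case (Suc j)
    then have "P (F j (A j)) (\<gamma> j (A j))" using \<gamma> by simp
    then show ?case using Suc gsc[of j] by (auto simp: AS setK set\<eta> P_def)
  qed (simp add: A0)
  have Amono: "A i \<subseteq> A j" if "i \<le> j" for i j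
    by (rule lift_Suc_mono_le[OF _ that]) (simp add: AS)
  define \<kappa> where "\<kappa> j = K j (A j)" for j
  have P\<gamma>: "P (F j (A j)) (\<gamma> j (A j))" for j using \<gamma> A by simp
  have set\<kappa>: "set_pmf (\<kappa> j) \<subseteq> A i" if "j < i" for i j
    using Amono[of "Suc j" i] that by (auto simp: AS \<kappa>_def)
  define \<nu> where "\<nu> = \<tau> \<bind> \<kappa>"
  have sub: "set_pmf \<nu> \<subseteq> carrier H"
    using set\<kappa>[OF lessI] A by (auto simp: \<nu>_def set_bind_pmf)
  have sup: "carrier H \<subseteq> set_pmf \<nu>"
  proof
    fix g assume "g \<in> carrier H"
    then obtain j where "g = gs j" using gs by auto
    then have "g \<in> set_pmf (\<kappa> j)" by (simp add: \<kappa>_def setK set\<eta>)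
    then show "g \<in> set_pmf \<nu>" by (auto simp: \<nu>_def set_bind_pmf set\<tau>)
  qed
  have "map_pmf (m_inv H) (\<kappa> j) = \<kappa> j" for j
  proof -
    have "map_pmf (m_inv H) (\<eta> j) = \<eta> j"
      unfolding \<eta>_def using gsc by (intro map_pmf_symmetrization) simp
    moreover have "map_pmf (m_inv H) (\<gamma> j (A j)) = \<gamma> j (A j)" using P\<gamma> by (simp add: P_def)
    ultimately have "(\<lambda>b. map_pmf (m_inv H) (if b then \<eta> j else \<gamma> j (A j))) = (\<lambda>b. if b then \<eta> j else \<gamma> j (A j))"
      by auto
    then show ?thesis unfolding \<kappa>_def K_def map_bind_pmf by simp
  qed
  then have "map_pmf (m_inv H) \<nu> = \<nu>" unfolding \<nu>_def map_bind_pmf by simp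
  then have sym: "symmetric_measure H \<nu>" by (rule symmetric_measureI[OF is_group sub])
  have nondeg: "nondegenerate_measure H \<nu>"
  proof -
    have "g \<in> carrier H" if "g \<in> semigroup_generated H (set_pmf \<nu>)" for g
      using that by induction (use sub in auto)
    then show ?thesis
      unfolding nondegenerate_measure_def using sup by (auto intro: semigroup_generated.incl)
  qed
  have "liouville H (diagonal_action \<phi>) (tuples n ?O) \<nu>" for n
    unfolding liouville_def
  proof (intro allI impI)
    let ?Y = "tuples n ?O"
    fix f :: "'y list \<Rightarrow> real"
    assume "harmonic H (diagonal_action \<phi>) ?Y \<nu> f \<and> bounded (f ` ?Y)"
    then have harm: "\<And>y. y \<in> ?Y \<Longrightarrow> ((\<lambda>g. f (map (\<phi> g) y) * pmf \<nu> g) has_sum f y) (carrier H)"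
      and "bounded (f ` ?Y)" by (auto simp: harmonic_def diagonal_action_def)
    then obtain C0 where C0: "\<forall>z\<in>?Y. \<bar>f z\<bar> \<le> C0" by (auto simp: bounded_iff)
    define C where "C = max 0 C0"
    \<comment> \<open>Extension by 0 gives a global bound, as the expectation lemmas require; the
      action preserves \<open>?Y\<close>, so harmonicity there is unaffected.\<close>
    define f' where "f' z = (if z \<in> ?Y then f z else 0)" for z
    have C: "0 \<le> C" and f'C: "\<bar>f' z\<bar> \<le> C" for z
      using C0 by (auto simp: C_def f'_def max_def)
    have maps: "map (\<phi> g) z \<in> tuples n Z'" if "g \<in> carrier H" "z \<in> tuples n Z" "Z \<subseteq> ?O" "\<phi> g ` Z \<subseteq> Z'" for g z Z Z'
    proof -
      have "inj_on (\<phi> g) (set z)"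
        by (rule inj_on_subset[OF inj_prop[OF that(1)]]) (use that OE in \<open>auto simp: tuples_def\<close>)
      then show ?thesis using that by (auto simp: tuples_def distinct_map)
    qed
    have harm': "f' z = \<E> (\<tau> \<bind> \<kappa>) (\<lambda>g. f' (map (\<phi> g) z))" if z: "z \<in> ?Y" for z
    proof -
      have "((\<lambda>g. f' (map (\<phi> g) z) * pmf \<nu> g) has_sum f z) (carrier H) \<longleftrightarrow>
          ((\<lambda>g. f (map (\<phi> g) z) * pmf \<nu> g) has_sum f z) (carrier H)"
        by (rule has_sum_cong) (use maps[OF _ z order_refl Oinv] in \<open>simp add: f'_def\<close>)
      then have "((\<lambda>g. f' (map (\<phi> g) z) * pmf \<nu> g) has_sum f z) (carrier H)" using harm[OF z] by simp
      moreover have "((\<lambda>g. f' (map (\<phi> g) z) * pmf \<nu> g) has_sum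
          \<E> \<nu> (\<lambda>g. f' (map (\<phi> g) z))) (carrier H)"
        by (rule expectation_pmf_has_sum[OF f'C sub])
      ultimately have "f z = \<E> \<nu> (\<lambda>g. f' (map (\<phi> g) z))" by (rule has_sum_unique)
      then show ?thesis using z by (simp add: f'_def \<nu>_def)
    qed
    have eq: "f y = f y'" if y: "y \<in> ?Y" "y' \<in> ?Y" for y y'
    proof -
      have "finite (set y \<union> set y')" "set y \<union> set y' \<subseteq> range p" using y p by (auto simp: tuples_def)
      then obtain B where B: "finite B" "set y \<union> set y' = p ` B" by (meson finite_subset_image)
      \<comment> \<open>From \<open>i0\<close> on, the first \<open>i\<close> points of the
        enumeration include all entries of both tuples, which therefore lie in
        \<open>Z 0\<close>.\<close>
      obtain i0 where i0: "B \<subseteq> {..<i0}" using B(1) finite_nat_bounded by blast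
      have est: "\<bar>f' y - f' y'\<bar> \<le> 4 * C * inverse (real (Suc i))" if i: "i0 \<le> i" for i
      proof -
        define Z where "Z m = tuples n (reach \<phi> (A i) (p ` {..<i}) m)" for m
        have RO: "reach \<phi> (A i) (p ` {..<i}) m \<subseteq> ?O" for m
          by (rule reach_subset) (use p Oinv A in auto)
        have ZY: "Z m \<subseteq> ?Y" for m using RO[of m] by (auto simp: Z_def tuples_def)
        have "\<bar>f' y - f' y'\<bar> \<le> 2 * C * measure_pmf.prob \<tau> {..<i} ^ N i + 2 * C * \<epsilon> i"
        proof (rule mixing_walk_estimate[where Z = Z and N = "N i" and m = 0 and \<kappa> = \<kappa> and \<epsilon> = \<epsilon> and
              \<eta> = \<eta> and \<gamma> = "\<lambda>j. \<gamma> j (A j)" and act = "\<lambda>g. map (\<phi> g)"])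
          show "\<bar>f' z\<bar> \<le> C" for z by (rule f'C)
          show "\<kappa> j = bernoulli_pmf (\<epsilon> j) \<bind> (\<lambda>b. if b then \<eta> j else \<gamma> j (A j))" for j
            by (simp add: \<kappa>_def K_def)
          show "0 \<le> \<epsilon> j" "\<epsilon> j \<le> 1" for j using \<epsilon>(1,2)[of j] by auto
          show "\<epsilon> j \<le> \<epsilon> i" if "i \<le> j" for j by (rule \<epsilon>(3)[OF that])
          show "f' z = \<E> (\<tau> \<bind> \<kappa>) (\<lambda>g. f' (map (\<phi> g) z))" if "z \<in> Z (N i)" for z
            by (rule harm') (use ZY that in auto)
          show "Z m \<subseteq> Z (N i)" if "m \<le> N i" for m
            using reach_mono_steps[OF that, of \<phi> "A i" "p ` {..<i}"] by (auto simp: Z_def tuples_def)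
          show "map (\<phi> g) z \<in> Z (Suc m)" if "Suc m \<le> N i" "z \<in> Z m" "j < i" "g \<in> set_pmf (\<kappa> j)" for m z j g
            unfolding Z_def
          proof (rule maps)
            have gA: "g \<in> A i" using set\<kappa>[OF that(3)] that(4) by auto
            then show "g \<in> carrier H" using A by auto
            show "z \<in> tuples n (reach \<phi> (A i) (p ` {..<i}) m)" using that(2) by (simp add: Z_def)
            show "\<phi> g ` reach \<phi> (A i) (p ` {..<i}) m \<subseteq> reach \<phi> (A i) (p ` {..<i}) (Suc m)"
              using gA by auto
          qed (rule RO)
          show "map_pmf (\<lambda>g. map (\<phi> g) z) (\<gamma> j (A j)) = map_pmf (\<lambda>g. map (\<phi> g) z') (\<gamma> j (A j))"
            if j: "i \<le> j" and z: "z \<in> Z (N i)" "z' \<in> Z (N i)" for j z z'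
          proof -
            have "reach \<phi> (A i) (p ` {..<i}) (N i) \<subseteq> reach \<phi> (A j) (p ` {..<j}) (N i)"
              by (rule reach_mono) (use Amono[OF j] j in auto)
            also have "\<dots> \<subseteq> F j (A j)" unfolding F_def by (rule reach_mono_steps[OF Nmono[OF j]])
            finally have zz': "z \<in> tuples n (F j (A j))" "z' \<in> tuples n (F j (A j))"
              using z by (auto simp: Z_def tuples_def)
            have "\<forall>n. \<forall>y\<in>tuples n (F j (A j)). \<forall>y'\<in>tuples n (F j (A j)).
                map_pmf (\<lambda>g. map (\<phi> g) y) (\<gamma> j (A j)) = map_pmf (\<lambda>g. map (\<phi> g) y') (\<gamma> j (A j))"
              using P\<gamma>[of j] unfolding P_def by (elim conjE)
            from bspec[OF bspec[OF spec[OF this] zz'(1)] zz'(2)] show ?thesis .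
          qed
          have "set y \<union> set y' \<subseteq> p ` {..<i}" unfolding B(2) using i0 i by auto
          then show "y \<in> Z 0" "y' \<in> Z 0" using y by (auto simp: Z_def tuples_def)
        qed simp
        also have "\<dots> \<le> 2 * C * (1 / (real i + 1)) + 2 * C * (1 / (real i + 1))"
          using aN[of i] C by (intro add_mono mult_left_mono) (auto simp: a_def \<epsilon>_def field_simps)
        also have "\<dots> = 4 * C * inverse (real (Suc i))" by (simp add: divide_inverse add.commute)
        finally show ?thesis .
      qed
      have "(\<lambda>i. 4 * C * inverse (real (Suc i))) \<longlonglongrightarrow> 4 * C * 0"
        by (intro tendsto_mult tendsto_const LIMSEQ_inverse_real_of_nat)
      then have "\<bar>f' y - f' y'\<bar> \<le> 4 * C * 0"
        by (rule LIMSEQ_le_const) (use est in auto)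
      then show ?thesis using y by (simp add: f'_def)
    qed
    then show "f constant_on ?Y" unfolding constant_on_def by metis
  qed
  with sub sym nondeg show ?thesis by (intro exI[of _ \<nu>]) simp
qed

section \<open>Dense subgroups of the full group\<close>

lemma full_group_mapsD:
  assumes "T \<in> full_group_maps M R"
  shows "T \<in> M \<rightarrow>\<^sub>M M" "null_sets (distr M M T) = null_sets M" "AE x in M. (x, T x) \<in> R"
  using assms by (auto simp: full_group_maps_def borel_automorphisms_def)

lemma AE_full_group_map:
  assumes T: "T \<in> full_group_maps M R" and P: "AE x in M. P x"
  shows "AE x in M. P (T x)"
proof (rule AE_distrD[OF full_group_mapsD(1)[OF T]])
  obtain N where N: "N \<in> null_sets M" "{x \<in> space M. \<not> P x} \<subseteq> N"
    using P unfolding eventually_ae_filter by auto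
  show "AE x in distr M M T. P x"
    by (rule AE_I'[of N]) (use N full_group_mapsD(2)[OF T] in auto)
qed

lemma uniform_dist_commute: "uniform_dist M a b = uniform_dist M b a"
  unfolding uniform_dist_def by (rule arg_cong[where f = "measure M"]) auto

section \<open>The full group as a metric space\<close>

locale standard_relation =
  fixes M :: "'a measure" and R :: "'a rel"
  assumes standard: "standard_measure_space M" and R: "countable_borel_equiv M R"
begin

lemma borel: "standard_borel M" and prob: "prob_space M"
  using standard by (auto simp: standard_measure_space_def)

sublocale prob_space M by (rule prob)

lemma neq_sets:
  assumes "S \<in> M \<rightarrow>\<^sub>M M" "T \<in> M \<rightarrow>\<^sub>M M"
  shows "{x \<in> space M. S x \<noteq> T x} \<in> sets M"
proof -
  have "{x \<in> space M. S x \<noteq> T x} = space M - {x \<in> space M. S x = T x}" by auto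
  then show ?thesis using standard_borel_equality_sets[OF borel assms] by auto
qed

lemma equiv_ae_eq_rel: "equiv (full_group_maps M R) (ae_eq_rel M R)"
proof (rule equivI)
  show "ae_eq_rel M R \<subseteq> full_group_maps M R \<times> full_group_maps M R" by (auto simp: ae_eq_rel_def)
  show "refl_on (full_group_maps M R) (ae_eq_rel M R)" by (auto simp: refl_on_def ae_eq_rel_def)
  show "sym (ae_eq_rel M R)" by (auto simp: sym_def ae_eq_rel_def eq_commute)
  show "trans (ae_eq_rel M R)"
  proof (rule transI)
    fix S T U assume "(S, T) \<in> ae_eq_rel M R" "(T, U) \<in> ae_eq_rel M R"
    then have ST: "AE x in M. S x = T x" and TU: "AE x in M. T x = U x"
      and m: "S \<in> full_group_maps M R" "U \<in> full_group_maps M R" by (auto simp: ae_eq_rel_def)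
    from ST TU have "AE x in M. S x = U x" by eventually_elim simp
    then show "(S, U) \<in> ae_eq_rel M R" using m by (simp add: ae_eq_rel_def)
  qed
qed

lemma carrier_full_group: "carrier (full_group M R) = full_group_maps M R // ae_eq_rel M R"
  by (simp add: full_group_def)

lemma full_group_class:
  assumes "a \<in> carrier (full_group M R)"
  shows "S \<in> a \<Longrightarrow> S \<in> full_group_maps M R" "(SOME S. S \<in> a) \<in> a"
    "S \<in> a \<Longrightarrow> T \<in> a \<Longrightarrow> AE x in M. S x = T x"
proof -
  have a: "a \<in> full_group_maps M R // ae_eq_rel M R" using assms by (simp add: carrier_full_group)
  show "S \<in> full_group_maps M R" if "S \<in> a"
    using in_quotient_imp_subset[OF equiv_ae_eq_rel a] that by auto
  have "a \<noteq> {}" using in_quotient_imp_non_empty[OF equiv_ae_eq_rel a] .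
  then show "(SOME S. S \<in> a) \<in> a" by (simp add: some_in_eq)
  show "AE x in M. S x = T x" if "S \<in> a" "T \<in> a"
    using in_quotient_imp_in_rel[OF equiv_ae_eq_rel a, of S T] that by (simp add: ae_eq_rel_def)
qed

text \<open>Frees the distance from the representatives picked by \<open>SOME\<close>: other choices
  alter the set of disagreement by a null set only.\<close>

lemma uniform_dist_eq:
  assumes a: "a \<in> carrier (full_group M R)" and b: "b \<in> carrier (full_group M R)"
    and S: "S \<in> a" and T: "T \<in> b"
  shows "uniform_dist M a b = measure M {x \<in> space M. S x \<noteq> T x}"
proof -
  let ?S = "SOME S. S \<in> a" and ?T = "SOME T. T \<in> b"
  have m: "S \<in> M \<rightarrow>\<^sub>M M" "T \<in> M \<rightarrow>\<^sub>M M" "?S \<in> M \<rightarrow>\<^sub>M M" "?T \<in> M \<rightarrow>\<^sub>M M"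
    using full_group_class(1)[OF a S] full_group_class(1)[OF b T]
      full_group_class(1)[OF a full_group_class(2)[OF a]] full_group_class(1)[OF b full_group_class(2)[OF b]]
      full_group_mapsD(1) by metis+
  have eq: "AE x in M. S x = ?S x" "AE x in M. T x = ?T x"
    using full_group_class(3)[OF a S full_group_class(2)[OF a]]
      full_group_class(3)[OF b T full_group_class(2)[OF b]] by auto
  show ?thesis
    unfolding uniform_dist_def
  proof (rule finite_measure_eq_AE)
    show "AE x in M. (x \<in> {x \<in> space M. ?S x \<noteq> ?T x}) = (x \<in> {x \<in> space M. S x \<noteq> T x})"
      using eq by eventually_elim simp
  qed (intro neq_sets m)+
qed

text \<open>The metric axioms are what allows the closure of \<open>G\<close> in
  \<open>uniform_topology\<close> to be read as approximation in measure. Distance zero is equality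
  almost everywhere, hence equality of classes.\<close>

lemma Metric_space_full_group: "Metric_space (carrier (full_group M R)) (uniform_dist M)"
proof
  show "0 \<le> uniform_dist M a b" for a b by (simp add: uniform_dist_def)
  show "uniform_dist M a b = uniform_dist M b a" for a b by (rule uniform_dist_commute)
next
  fix a b assume a: "a \<in> carrier (full_group M R)" and b: "b \<in> carrier (full_group M R)"
  let ?S = "SOME S. S \<in> a" and ?T = "SOME T. T \<in> b"
  note S = full_group_class(2)[OF a] and T = full_group_class(2)[OF b]
  have fm: "?S \<in> full_group_maps M R" "?T \<in> full_group_maps M R"
    by (rule full_group_class(1)[OF a S], rule full_group_class(1)[OF b T])
  have d: "uniform_dist M a b = measure M {x \<in> space M. ?S x \<noteq> ?T x}"
    by (rule uniform_dist_eq[OF a b S T])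
  show "uniform_dist M a b = 0 \<longleftrightarrow> a = b"
  proof
    assume "uniform_dist M a b = 0"
    then have "measure M {x \<in> space M. ?S x \<noteq> ?T x} = 0" by (simp only: d)
    then have "{x \<in> space M. ?S x \<noteq> ?T x} \<in> null_sets M"
      using neq_sets[OF full_group_mapsD(1)[OF fm(1)] full_group_mapsD(1)[OF fm(2)]]
      by (simp add: null_sets_def emeasure_eq_measure)
    then have "AE x in M. ?S x = ?T x" by (rule AE_I') auto
    then have "(?S, ?T) \<in> ae_eq_rel M R" using fm by (simp add: ae_eq_rel_def)
    then show "a = b"
      using quotient_eq_iff[OF equiv_ae_eq_rel, of a b ?S ?T] a b S T by (simp add: carrier_full_group)
  next
    assume "a = b"
    then show "uniform_dist M a b = 0" unfolding uniform_dist_def by simp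
  qed
next
  fix a b c assume abc: "a \<in> carrier (full_group M R)" "b \<in> carrier (full_group M R)" "c \<in> carrier (full_group M R)"
  let ?S = "SOME S. S \<in> a" and ?T = "SOME T. T \<in> b" and ?U = "SOME U. U \<in> c"
  have m: "?S \<in> M \<rightarrow>\<^sub>M M" "?T \<in> M \<rightarrow>\<^sub>M M" "?U \<in> M \<rightarrow>\<^sub>M M"
    using abc full_group_class(1,2) full_group_mapsD(1) by metis+
  have "uniform_dist M a c \<le> measure M ({x \<in> space M. ?S x \<noteq> ?T x} \<union> {x \<in> space M. ?T x \<noteq> ?U x})"
    unfolding uniform_dist_def by (rule finite_measure_mono) (auto intro!: sets.Un neq_sets m)
  also have "\<dots> \<le> uniform_dist M a b + uniform_dist M b c"
    unfolding uniform_dist_def by (intro measure_Un_le neq_sets m)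
  finally show "uniform_dist M a c \<le> uniform_dist M a b + uniform_dist M b c" .
qed

text \<open>The swap pulls null sets back to null sets because \<open>f\<close>, \<open>g\<close>
  and the identity do; being its own inverse, it has the converse property as well.\<close>

lemma swap_map_full_group:
  assumes D: "D \<in> sets M" "D' \<in> sets M" "D \<inter> D' = {}"
    and f: "f \<in> full_group_maps M R" "\<And>x. x \<in> D \<Longrightarrow> f x \<in> D' \<and> g (f x) = x"
    and g: "g \<in> full_group_maps M R" "\<And>y. y \<in> D' \<Longrightarrow> g y \<in> D \<and> f (g y) = y"
  shows "swap_map D D' f g \<in> full_group_maps M R"
proof -
  let ?s = "swap_map D D' f g"
  note fm = full_group_mapsD[OF f(1)] and gm = full_group_mapsD[OF g(1)]
  have aut: "?s \<in> borel_automorphisms M"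
    by (rule swap_map_borel_automorphism[OF D fm(1) f(2) gm(1) g(2)])
  then have s: "?s \<in> M \<rightarrow>\<^sub>M M" by (simp add: borel_automorphisms_def)
  have inv: "?s (?s x) = x" for x by (rule swap_map_involution[OF D(3) f(2) g(2)])
  have null: "?s -` A \<inter> space M \<in> null_sets M" if A: "A \<in> null_sets M" for A
  proof -
    have "AE x in M. x \<notin> A" by (rule AE_not_in[OF A])
    moreover have "AE x in M. f x \<notin> A" by (rule AE_full_group_map[OF f(1) AE_not_in[OF A]])
    moreover have "AE x in M. g x \<notin> A" by (rule AE_full_group_map[OF g(1) AE_not_in[OF A]])
    ultimately have "AE x in M. x \<notin> ?s -` A \<inter> space M"
      by eventually_elim (auto simp: swap_map_def)
    then show ?thesis
      by (subst AE_iff_null_sets) (use measurable_sets[OF s] A in auto)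
  qed
  have "null_sets (distr M M ?s) = null_sets M"
  proof (intro equalityI subsetI)
    fix A assume A: "A \<in> null_sets M"
    then have "A \<in> sets M" by auto
    then show "A \<in> null_sets (distr M M ?s)"
      using null[OF A] by (simp add: null_sets_def emeasure_distr[OF s])
  next
    fix A assume "A \<in> null_sets (distr M M ?s)"
    then have A: "A \<in> sets M" "emeasure (distr M M ?s) A = 0" by auto
    then have "?s -` A \<inter> space M \<in> null_sets M"
      using measurable_sets[OF s A(1)] by (simp add: null_sets_def emeasure_distr[OF s])
    then have "?s -` (?s -` A \<inter> space M) \<inter> space M \<in> null_sets M" by (rule null)
    also have "?s -` (?s -` A \<inter> space M) \<inter> space M = A"
      using inv sets.sets_into_space[OF A(1)] measurable_space[OF s] by auto
    finally show "A \<in> null_sets M" .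
  qed
  moreover have "AE x in M. (x, ?s x) \<in> R"
  proof -
    have refl: "AE x in M. (x, x) \<in> R"
      by (rule AE_I2) (use R in \<open>auto simp: countable_borel_equiv_def equiv_def refl_on_def\<close>)
    from fm(3) gm(3) refl show ?thesis by eventually_elim (simp add: swap_map_def)
  qed
  ultimately show ?thesis using aut by (simp add: full_group_maps_def)
qed

end

section \<open>Pointwise approximation by a dense subgroup\<close>

locale dense_subgroup_action = standard_relation +
  fixes G :: "('a \<Rightarrow> 'a) set set" and E :: "'a set" and \<phi> :: "('a \<Rightarrow> 'a) set \<Rightarrow> 'a \<Rightarrow> 'a"
  assumes countable_G: "countable G" and subgroup_G: "subgroup G (full_group M R)"
    and dense: "uniform_topology M R closure_of G = carrier (full_group M R)"
    and genuine: "genuine_action M R G E \<phi>"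
begin

abbreviation "\<G> \<equiv> subgroup_of_full_group M R G"

sublocale group_action \<G> E \<phi>
  using genuine by (simp add: genuine_action_def)

sublocale group \<G>
  using group_hom by (rule group_hom.axioms(1))

lemma E_sets: "E \<in> sets M" and AE_E: "AE x in M. x \<in> E" and E_inv: "R `` E \<subseteq> E"
proof -
  show "E \<in> sets M" "R `` E \<subseteq> E"
    using genuine by (auto simp: genuine_action_def invariant_borel_set_def)
  show "AE x in M. x \<in> E"
    by (rule AE_I'[of "space M - E"]) (use genuine in \<open>auto simp: genuine_action_def\<close>)
qed

text \<open>\<open>\<phi> g\<close> is undefined off \<open>E\<close>. For \<open>g \<in> G\<close>,
  \<open>rep g\<close> is a representative agreeing with it on \<open>E\<close> that is measurable
  on all of \<open>space M\<close>.\<close>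

definition rep :: "('a \<Rightarrow> 'a) set \<Rightarrow> 'a \<Rightarrow> 'a" where
  "rep g = (SOME T. T \<in> g \<and> \<phi> g = restrict T E)"

lemma rep:
  assumes "g \<in> G"
  shows "rep g \<in> g" "x \<in> E \<Longrightarrow> \<phi> g x = rep g x" "rep g \<in> full_group_maps M R" "rep g \<in> M \<rightarrow>\<^sub>M M"
proof -
  have "\<exists>T. T \<in> g \<and> \<phi> g = restrict T E" using genuine assms by (auto simp: genuine_action_def)
  from someI_ex[OF this] have r: "rep g \<in> g" "\<phi> g = restrict (rep g) E" by (auto simp: rep_def)
  have "G \<subseteq> carrier (full_group M R)" by (rule subgroup.subset[OF subgroup_G])
  then have g: "g \<in> carrier (full_group M R)" using assms by auto
  show "rep g \<in> g" by (rule r)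
  show "\<phi> g x = rep g x" if "x \<in> E" using r(2) that by simp
  show fg: "rep g \<in> full_group_maps M R" by (rule full_group_class(1)[OF g r(1)])
  show "rep g \<in> M \<rightarrow>\<^sub>M M" by (rule full_group_mapsD(1)[OF fg])
qed

lemma AE_act:
  assumes g: "g \<in> G" and P: "AE x in M. P x"
  shows "AE x in M. P (\<phi> g x)"
  using AE_full_group_map[OF rep(3)[OF g] P] AE_E
  by eventually_elim (simp add: rep(2)[OF g])

lemma dense_approximation:
  assumes T: "T \<in> full_group_maps M R" and e: "0 < e"
  shows "\<exists>g\<in>G. measure M {x \<in> space M. T x \<noteq> rep g x} < e"
proof -
  interpret F: Metric_space "carrier (full_group M R)" "uniform_dist M" by (rule Metric_space_full_group)
  let ?a = "ae_eq_rel M R `` {T}"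
  have a: "?a \<in> carrier (full_group M R)"
    unfolding carrier_full_group using T by (rule quotientI)
  have Ta: "T \<in> ?a" using T by (simp add: ae_eq_rel_def)
  have "?a \<in> F.mtopology closure_of G" using a dense by (simp add: uniform_topology_def)
  then obtain g where g: "g \<in> G" "g \<in> F.mball ?a e" unfolding F.metric_closure_of using e by auto
  then have gc: "g \<in> carrier (full_group M R)" and d: "uniform_dist M ?a g < e" by auto
  show ?thesis
    by (rule bexI[OF _ g(1)]) (use d uniform_dist_eq[OF a gc Ta rep(1)[OF g(1)]] in simp)
qed

text \<open>Approximations with error below \<open>(1/2) ^ j\<close> have summable errors, so by
  Borel-Cantelli almost every point lies in only finitely many of the exceptional sets. At such a
  point the value of \<open>T\<close> is attained by an element of \<open>G\<close>.\<close>

lemma dense_sequence: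
  assumes T: "T \<in> full_group_maps M R"
  shows "\<exists>\<gamma> :: nat \<Rightarrow> ('a \<Rightarrow> 'a) set. (\<forall>j. \<gamma> j \<in> G) \<and>
    (AE x in M. \<forall>\<^sub>F j in sequentially. T x = \<phi> (\<gamma> j) x)"
proof -
  have "\<forall>j::nat. \<exists>g. g \<in> G \<and> measure M {x \<in> space M. T x \<noteq> rep g x} < (1/2) ^ j"
    using dense_approximation[OF T] by (metis half_gt_zero_iff zero_less_one zero_less_power)
  then obtain \<gamma> where \<gamma>: "\<forall>j. \<gamma> j \<in> G \<and> measure M {x \<in> space M. T x \<noteq> rep (\<gamma> j) x} < (1/2) ^ j"
    by (rule exE[OF choice])
  let ?A = "\<lambda>j. {x \<in> space M. T x \<noteq> rep (\<gamma> j) x}"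
  have A: "?A j \<in> sets M" for j
    by (intro neq_sets full_group_mapsD(1)[OF T] rep(4)) (use \<gamma> in simp)
  have "AE x in M. eventually (\<lambda>j. x \<in> space M - ?A j) sequentially"
  proof (rule borel_cantelli_AE1)
    show "emeasure M (?A j) < \<infinity>" for j by (simp add: emeasure_eq_measure)
    show "summable (\<lambda>j. measure M (?A j))"
      by (rule summable_comparison_test'[OF summable_geometric[of "1/2"], where N = 0])
        (use \<gamma> in \<open>auto intro: less_imp_le\<close>)
  qed (rule A)
  then have "AE x in M. \<forall>\<^sub>F j in sequentially. T x = \<phi> (\<gamma> j) x"
    using AE_E
  proof eventually_elim
    case (elim x)
    from elim(1) show ?case
      by eventually_elim (use elim(2) \<gamma> in \<open>simp add: rep(2)\<close>)
  qed
  then show ?thesis using \<gamma> by (intro exI[of _ \<gamma>]) simp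
qed

end

section \<open>Permutations of finite subsets of orbits\<close>

context dense_subgroup_action begin

text \<open>The involution exchanging \<open>D\<close> and \<open>g D\<close> lies in the full group; almost everywhere it is
  eventually followed by an approximating sequence in \<open>G\<close>.\<close>

lemma AE_local_transposition:
  assumes g: "g \<in> G" and hs: "finite hs" "hs \<subseteq> G"
  shows "AE u in M. \<phi> g u \<noteq> u \<and> (\<forall>h\<in>hs. \<phi> h u \<noteq> u \<and> \<phi> h u \<noteq> \<phi> g u) \<longrightarrow>
    (\<exists>g'\<in>G. \<phi> g' u = \<phi> g u \<and> \<phi> g' (\<phi> g u) = u \<and> (\<forall>h\<in>hs. \<phi> g' (\<phi> h u) = \<phi> h u))"
proof -
  let ?swaps = "\<lambda>u. \<exists>g'\<in>G. \<phi> g' u = \<phi> g u \<and> \<phi> g' (\<phi> g u) = u \<and> (\<forall>h\<in>hs. \<phi> g' (\<phi> h u) = \<phi> h u)"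
  let ?i = "m_inv \<G> g"
  have ig: "?i \<in> G" using inv_closed[of g] g by simp
  have gc: "g \<in> carrier \<G>" "?i \<in> carrier \<G>" using g ig by auto
  have EE: "\<phi> k x \<in> E" if "k \<in> G" "x \<in> E" for k x using element_image[of k x] that by simp
  have ig_g: "\<phi> ?i (\<phi> g x) = x" if "x \<in> E" for x using orbit_sym_aux[OF gc(1) that refl] .
  have g_ig: "\<phi> g (\<phi> ?i x) = x" if "x \<in> E" for x
    using orbit_sym_aux[OF gc(2) that refl] inv_inv[OF gc(1)] by simp
  obtain V :: "nat \<Rightarrow> 'a set" where V: "\<forall>n. V n \<in> sets M"
    and sep: "\<forall>u\<in>space M. \<forall>F. finite F \<longrightarrow> F \<subseteq> space M \<longrightarrow> u \<notin> F \<longrightarrow> (\<exists>n. u \<in> V n \<and> V n \<inter> F = {})"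
    using standard_borel_separating[OF borel] by (elim exE conjE) (rule that)
  have Esp: "E \<subseteq> space M" by (rule sets.sets_into_space[OF E_sets])
  have pre: "{x \<in> space M. f x \<in> B} \<in> sets M" if "f \<in> M \<rightarrow>\<^sub>M M" "B \<in> sets M" for f B
    using measurable_sets[OF that] by (simp add: vimage_def Int_def conj_commute)
  \<comment> \<open>A point of \<open>D n\<close> lies in \<open>V n\<close> and its image under
    \<open>g\<close> does not, so \<open>D n\<close> and \<open>g D n\<close> are disjoint. The
    conditions on \<open>rep h x\<close> and on its image under the inverse of \<open>g\<close> keep
    \<open>rep h x\<close> out of both sets, so the swap fixes it.\<close>
  define D where "D n = {x \<in> space M. x \<in> E \<inter> V n \<and> rep g x \<in> space M - V n \<and>
      (\<forall>h\<in>hs. rep h x \<in> space M - V n \<and> rep ?i (rep h x) \<in> space M - V n)}" for n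
  have D: "D n \<in> sets M" for n
  proof -
    have c: "space M - V n \<in> sets M" using V by auto
    have "{x \<in> space M. \<forall>h\<in>hs. rep h x \<in> space M - V n \<and> rep ?i (rep h x) \<in> space M - V n} \<in> sets M"
    proof (rule sets.sets_Collect_finite_All[OF _ hs(1)])
      fix h assume "h \<in> hs"
      then have h: "h \<in> G" using hs by auto
      show "{x \<in> space M. rep h x \<in> space M - V n \<and> rep ?i (rep h x) \<in> space M - V n} \<in> sets M"
      proof -
        have "{x \<in> space M. rep h x \<in> space M - V n \<and> rep ?i (rep h x) \<in> space M - V n} =
            {x \<in> space M. rep h x \<in> space M - V n} \<inter> {x \<in> space M. rep ?i (rep h x) \<in> space M - V n}"
          by auto
        then show ?thesis
          using pre[OF rep(4)[OF h] c] pre[OF measurable_compose[OF rep(4)[OF h] rep(4)[OF ig]] c] by simp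
      qed
    qed
    moreover have "{x \<in> space M. rep g x \<in> space M - V n} \<in> sets M" by (rule pre[OF rep(4)[OF g] c])
    moreover have "{x \<in> space M. x \<in> E \<inter> V n} \<in> sets M"
    proof -
      have "{x \<in> space M. x \<in> E \<inter> V n} = E \<inter> V n" using Esp by auto
      then show ?thesis using E_sets V by auto
    qed
    ultimately show ?thesis unfolding D_def by (intro sets.sets_Collect_conj)
  qed
  have DE: "x \<in> E" if "x \<in> D n" for x n using that by (simp add: D_def)
  define D' where "D' n = {x \<in> space M. x \<in> E \<and> rep ?i x \<in> D n}" for n
  have D': "D' n \<in> sets M" for n
  proof -
    have "D' n = E \<inter> {x \<in> space M. rep ?i x \<in> D n}" using Esp by (auto simp: D'_def)
    then show ?thesis using E_sets pre[OF rep(4)[OF ig] D] by auto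
  qed
  have fD: "rep g x \<in> D' n \<and> rep ?i (rep g x) = x" if x: "x \<in> D n" for x n
  proof -
    have xE: "x \<in> E" by (rule DE[OF x])
    have r: "rep g x = \<phi> g x" by (rule rep(2)[OF g xE, symmetric])
    have gE: "rep g x \<in> E" unfolding r by (rule EE[OF g xE])
    have "rep ?i (rep g x) = \<phi> ?i (\<phi> g x)" using rep(2)[OF ig gE] r by simp
    then have "rep ?i (rep g x) = x" using ig_g[OF xE] by simp
    then show ?thesis using x gE Esp by (auto simp: D'_def)
  qed
  have gD: "rep ?i y \<in> D n \<and> rep g (rep ?i y) = y" if y: "y \<in> D' n" for y n
  proof -
    have yE: "y \<in> E" and iy: "rep ?i y \<in> D n" using y by (auto simp: D'_def)
    have r: "rep ?i y = \<phi> ?i y" by (rule rep(2)[OF ig yE, symmetric])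
    have "rep g (rep ?i y) = \<phi> g (rep ?i y)" by (rule rep(2)[OF g DE[OF iy], symmetric])
    then show ?thesis using iy g_ig[OF yE] r by simp
  qed
  have disj: "D n \<inter> D' n = {}" for n
  proof -
    have False if "x \<in> D n" "x \<in> D' n" for x
    proof -
      have "rep ?i x \<in> D n" "rep g (rep ?i x) = x" using gD[OF that(2)] by auto
      then have "x \<notin> V n" unfolding D_def by auto
      then show False using that(1) by (simp add: D_def)
    qed
    then show ?thesis by auto
  qed
  define S where "S n = swap_map (D n) (D' n) (rep g) (rep ?i)" for n
  have S: "S n \<in> full_group_maps M R" for n
    unfolding S_def by (rule swap_map_full_group[OF D D' disj rep(3)[OF g] fD rep(3)[OF ig] gD])
  have main: "AE u in M. u \<in> D n \<longrightarrow>
    ?swaps u" for n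
  proof -
    obtain \<gamma> :: "nat \<Rightarrow> ('a \<Rightarrow> 'a) set" where \<gamma>': "\<forall>j. \<gamma> j \<in> G"
      and ev: "AE x in M. \<forall>\<^sub>F j in sequentially. S n x = \<phi> (\<gamma> j) x"
      using dense_sequence[OF S[of n]] by (elim exE conjE) (rule that)
    have \<gamma>: "\<gamma> j \<in> G" for j using \<gamma>' ..
    have "AE u in M. \<forall>h\<in>hs. \<forall>\<^sub>F j in sequentially. S n (\<phi> h u) = \<phi> (\<gamma> j) (\<phi> h u)"
      by (rule AE_ball_countable'[OF _ countable_finite[OF hs(1)]]) (rule AE_act[OF _ ev], use hs(2) in auto)
    with ev AE_act[OF g ev] show ?thesis
    proof eventually_elim
      case (elim u)
      show ?case
      proof
        assume u: "u \<in> D n"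
        have uE: "u \<in> E" by (rule DE[OF u])
        have gu: "rep g u = \<phi> g u" by (rule rep(2)[OF g uE, symmetric])
        \<comment> \<open>One index \<open>j\<close> must serve \<open>u\<close>, its image and all
          \<open>\<phi> h u\<close> together. Each agreement holds eventually, and there are
          finitely many of them.\<close>
        have ev': "\<forall>\<^sub>F j in sequentially. S n u = \<phi> (\<gamma> j) u \<and> S n (\<phi> g u) = \<phi> (\<gamma> j) (\<phi> g u) \<and>
            (\<forall>h\<in>hs. S n (\<phi> h u) = \<phi> (\<gamma> j) (\<phi> h u))"
          using elim hs(1) by (intro eventually_conj eventually_ball_finite) auto
        obtain j where j: "S n u = \<phi> (\<gamma> j) u \<and> S n (\<phi> g u) = \<phi> (\<gamma> j) (\<phi> g u) \<and>
            (\<forall>h\<in>hs. S n (\<phi> h u) = \<phi> (\<gamma> j) (\<phi> h u))"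
          by (rule exE[OF eventually_happens'[OF sequentially_bot ev']])
        have 1: "S n u = \<phi> g u" using u gu by (simp add: S_def swap_map_def)
        have "\<phi> g u \<in> D' n" "rep ?i (\<phi> g u) = u" using fD[OF u] gu by auto
        moreover from this have "\<phi> g u \<notin> D n" using disj[of n] by auto
        ultimately have 2: "S n (\<phi> g u) = u" by (simp add: S_def swap_map_def)
        have 3: "S n (\<phi> h u) = \<phi> h u" if h: "h \<in> hs" for h
        proof -
          have hG: "h \<in> G" using h hs by auto
          have r: "rep h u = \<phi> h u" by (rule rep(2)[OF hG uE, symmetric])
          have "\<phi> h u \<notin> V n" "rep ?i (\<phi> h u) \<notin> V n" using u h r by (auto simp: D_def)
          then have "\<phi> h u \<notin> D n" "\<phi> h u \<notin> D' n" by (auto simp: D_def D'_def)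
          then show ?thesis by (simp add: S_def swap_map_def)
        qed
        show "?swaps u"
        proof (intro bexI[OF _ \<gamma>[of j]] conjI ballI)
          show "\<phi> (\<gamma> j) u = \<phi> g u" using conjunct1[OF j] 1 by simp
          show "\<phi> (\<gamma> j) (\<phi> g u) = u" using conjunct1[OF conjunct2[OF j]] 2 by simp
          show "\<phi> (\<gamma> j) (\<phi> h u) = \<phi> h u" if "h \<in> hs" for h
            using bspec[OF conjunct2[OF conjunct2[OF j]] that] 3[OF that] by simp
        qed
      qed
    qed
  qed
  have "AE u in M. \<forall>n. u \<in> D n \<longrightarrow>
    ?swaps u"
    by (intro AE_all_countable[THEN iffD2] allI main)
  with AE_E show ?thesis
  proof eventually_elim
    case (elim u)
    show ?case
    proof
      assume a: "\<phi> g u \<noteq> u \<and> (\<forall>h\<in>hs. \<phi> h u \<noteq> u \<and> \<phi> h u \<noteq> \<phi> g u)"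
      \<comment> \<open>The points from which \<open>u\<close> has to be separated in order to lie
        in some \<open>D n\<close>.\<close>
      let ?F = "{\<phi> g u} \<union> (\<lambda>h. \<phi> h u) ` hs \<union> (\<lambda>h. \<phi> ?i (\<phi> h u)) ` hs"
      have hE: "\<phi> h u \<in> E" if "h \<in> hs" for h using EE[OF _ elim(1)] that hs(2) by auto
      have "u \<noteq> \<phi> ?i (\<phi> h u)" if h: "h \<in> hs" for h
      proof
        assume "u = \<phi> ?i (\<phi> h u)"
        then have "\<phi> h u = \<phi> g u" using g_ig[OF hE[OF h]] by simp
        then show False using a h by auto
      qed
      then have "u \<notin> ?F" using a by auto
      moreover have "?F \<subseteq> space M" using EE[OF g elim(1)] EE[OF ig hE] hE Esp by auto
      moreover have "finite ?F" using hs(1) by simp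
      moreover have u: "u \<in> space M" using elim(1) Esp by auto
      ultimately obtain n where n: "u \<in> V n" "V n \<inter> ?F = {}" using sep by metis
      have uD: "u \<in> D n"
        unfolding D_def
      proof (intro CollectI conjI ballI u)
        show "u \<in> E \<inter> V n" using n elim(1) by simp
        show "rep g u \<in> space M - V n"
          using n(2) EE[OF g elim(1)] Esp rep(2)[OF g elim(1)] by auto
        fix h assume h: "h \<in> hs"
        have hG: "h \<in> G" using h hs by auto
        have r: "rep h u = \<phi> h u" by (rule rep(2)[OF hG elim(1), symmetric])
        show "rep h u \<in> space M - V n" unfolding r using n(2) h hE[OF h] Esp by auto
        have r': "rep ?i (rep h u) = \<phi> ?i (\<phi> h u)" unfolding r by (rule rep(2)[OF ig hE[OF h], symmetric])
        show "rep ?i (rep h u) \<in> space M - V n" unfolding r' using n(2) h EE[OF ig hE[OF h]] Esp by auto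
      qed
      from mp[OF spec[OF elim(2)] uD]
      show "?swaps u" .
    qed
  qed
qed

text \<open>Transpositions generate the permutations of a finite set. The countably many local
  conditions are imposed along the entire orbit, since any point \<open>a\<close> of
  \<open>F\<close> may have to be the base point of a transposition.\<close>

lemma AE_highly_transitive:
  "AE x in M. \<forall>F \<sigma>. finite F \<longrightarrow> F \<subseteq> orbit \<G> \<phi> x \<longrightarrow> \<sigma> permutes F \<longrightarrow> (\<exists>g\<in>G. \<forall>d\<in>F. \<phi> g d = \<sigma> d)"
proof -
  define good where "good u \<longleftrightarrow> (\<forall>g\<in>G. \<forall>hs\<in>{hs. finite hs \<and> hs \<subseteq> G}.
    \<phi> g u \<noteq> u \<and> (\<forall>h\<in>hs. \<phi> h u \<noteq> u \<and> \<phi> h u \<noteq> \<phi> g u) \<longrightarrow>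
    (\<exists>g'\<in>G. \<phi> g' u = \<phi> g u \<and> \<phi> g' (\<phi> g u) = u \<and> (\<forall>h\<in>hs. \<phi> g' (\<phi> h u) = \<phi> h u)))" for u
  have "AE u in M. good u"
    unfolding good_def
    by (intro AE_ball_countable' countable_G countable_Collect_finite_subset AE_local_transposition) auto
  then have "AE x in M. \<forall>k\<in>G. good (\<phi> k x)"
    by (intro AE_ball_countable' AE_act countable_G)
  with AE_E show ?thesis
  proof eventually_elim
    case (elim x)
    have orb: "orbit \<G> \<phi> x \<subseteq> E" using element_image elim(1) by (auto simp: orbit_def)
    have transp: "\<exists>g'\<in>G. \<forall>d\<in>F. \<phi> g' d = Transposition.transpose a b d"
      if F: "finite F" "F \<subseteq> orbit \<G> \<phi> x" and ab: "a \<in> F" "b \<in> F" "a \<noteq> b" for F a b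
    proof -
      have aO: "a \<in> orbit \<G> \<phi> x" and aE: "a \<in> E" using ab(1) F(2) orb by auto
      have "good a" using elim(2) aO by (auto simp: orbit_def)
      have "\<forall>d. \<exists>h. d \<in> F \<longrightarrow> h \<in> G \<and> \<phi> h a = d"
      proof (intro allI)
        fix d
        have "\<exists>h\<in>G. \<phi> h a = d" if "d \<in> F"
        proof -
          have dE: "d \<in> E" using that F(2) orb by auto
          have "d \<in> orbit \<G> \<phi> x" using that F(2) by auto
          moreover have "x \<in> orbit \<G> \<phi> a" by (rule orbit_sym[OF elim(1) aE aO])
          ultimately have "d \<in> orbit \<G> \<phi> a" using orbit_trans[OF aE elim(1) dE] by simp
          then show ?thesis by (auto simp: orbit_def)
        qed
        then show "\<exists>h. d \<in> F \<longrightarrow> h \<in> G \<and> \<phi> h a = d" by auto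
      qed
      then obtain h where h: "\<forall>d. d \<in> F \<longrightarrow> h d \<in> G \<and> \<phi> (h d) a = d" by (rule exE[OF choice])
      \<comment> \<open>These elements carry \<open>a\<close> to the points of \<open>F\<close> that
        the transposition must fix.\<close>
      let ?hs = "h ` (F - {a, b})"
      have hs: "?hs \<in> {hs. finite hs \<and> hs \<subseteq> G}" and hbG: "h b \<in> G" using F(1) h ab by auto
      have ne: "\<phi> (h b) a \<noteq> a \<and> (\<forall>k\<in>?hs. \<phi> k a \<noteq> a \<and> \<phi> k a \<noteq> \<phi> (h b) a)"
        using h ab by auto
      obtain g' where g': "g' \<in> G" "\<phi> g' a = \<phi> (h b) a" "\<phi> g' (\<phi> (h b) a) = a"
          "\<forall>k\<in>?hs. \<phi> g' (\<phi> k a) = \<phi> k a"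
        using mp[OF bspec[OF bspec[OF \<open>good a\<close>[unfolded good_def] hbG] hs] ne]
        by (elim bexE conjE) (rule that)
      have hb: "\<phi> (h b) a = b" using h ab by auto
      have "\<phi> g' d = Transposition.transpose a b d" if d: "d \<in> F" for d
      proof -
        consider "d = a" | "d = b" | "d \<noteq> a" "d \<noteq> b" by auto
        then show ?thesis
        proof cases
          case 3
          then have "\<phi> g' (\<phi> (h d) a) = \<phi> (h d) a" using g'(4) d by auto
          then show ?thesis using h d 3 by simp
        qed (use g' hb ab(3) in simp_all)
      qed
      then show ?thesis using g'(1) by auto
    qed
    show ?case
    proof (intro allI impI)
      fix F \<sigma> assume F: "finite F" "F \<subseteq> orbit \<G> \<phi> x" and \<sigma>: "\<sigma> permutes F"
      from \<sigma> F(1) show "\<exists>g\<in>G. \<forall>d\<in>F. \<phi> g d = \<sigma> d"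
      proof (induction rule: permutes_induct)
        case id
        have "\<phi> \<one>\<^bsub>\<G>\<^esub> d = d" if "d \<in> F" for d
        proof -
          have "d \<in> E" using that F(2) orb by auto
          then show ?thesis using id_eq_one by (metis restrict_apply')
        qed
        then show ?case using one_closed by auto
      next
        case (swap a b p)
        obtain g where g: "g \<in> G" "\<forall>d\<in>F. \<phi> g d = p d" using swap.IH by auto
        obtain g' where g': "g' \<in> G" "\<forall>d\<in>F. \<phi> g' d = Transposition.transpose a b d"
          using transp[OF F swap.hyps(1-3)] by auto
        have "\<phi> (g' \<otimes>\<^bsub>\<G>\<^esub> g) d = (Transposition.transpose a b \<circ> p) d" if d: "d \<in> F" for d
        proof -
          have dE: "d \<in> E" using d F(2) orb by auto
          have "\<phi> (g' \<otimes>\<^bsub>\<G>\<^esub> g) d = \<phi> g' (\<phi> g d)"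
            using composition_rule[OF dE, of g' g] g g' by simp
          moreover have "p d \<in> F" using permutes_in_image[OF swap.hyps(4)] d by simp
          ultimately show ?thesis using g g' d by simp
        qed
        moreover have "g' \<otimes>\<^bsub>\<G>\<^esub> g \<in> G" using m_closed[of g' g] g g' by simp
        ultimately show ?case by metis
      qed
    qed
  qed
qed

theorem AE_exists_liouville_measure:
  "AE x in M. \<exists>\<nu>. set_pmf \<nu> \<subseteq> G \<and> symmetric_measure \<G> \<nu> \<and> nondegenerate_measure \<G> \<nu> \<and>
    (\<forall>n. liouville \<G> (diagonal_action \<phi>) (tuples n (orbit \<G> \<phi> x)) \<nu>)"
  using AE_highly_transitive AE_E
proof eventually_elim
  case (elim x)
  have "\<exists>\<nu>. set_pmf \<nu> \<subseteq> carrier \<G> \<and> symmetric_measure \<G> \<nu> \<and> nondegenerate_measure \<G> \<nu> \<and>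
    (\<forall>n. liouville \<G> (diagonal_action \<phi>) (tuples n (orbit \<G> \<phi> x)) \<nu>)"
  proof (rule exists_liouville_measure[OF group_action_axioms _ elim(2)])
    show "countable (carrier \<G>)" using countable_G by simp
    show "\<exists>g\<in>carrier \<G>. \<forall>d\<in>F. \<phi> g d = \<sigma> d" if "finite F" "F \<subseteq> orbit \<G> \<phi> x" "\<sigma> permutes F" for F \<sigma>
      using elim(1) that by simp
  qed
  then show ?case by simp
qed

end

section \<open>Liouville orbits and amenability\<close>

text \<open>Turns integrals against \<open>\<nu>\<close> into series over the naturals, whose
  measurability in a further variable can be checked term by term.\<close>

lemma pmf_countable_enumeration:
  "\<exists>(\<rho> :: nat pmf) e. \<nu> = map_pmf e \<rho> \<and> (\<forall>n. e n \<in> set_pmf \<nu>)"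
proof (intro exI conjI allI)
  let ?S = "set_pmf \<nu>"
  have c: "countable ?S" by (rule countable_set_pmf)
  show "\<nu> = map_pmf (from_nat_into ?S) (map_pmf (to_nat_on ?S) \<nu>)"
    unfolding pmf.map_comp by (rule map_pmf_idI[symmetric]) (simp add: from_nat_into_to_nat_on[OF c])
  show "from_nat_into ?S n \<in> ?S" for n by (rule from_nat_into[OF set_pmf_not_empty])
qed

lemma set_pmf_walk:
  assumes K: "\<And>y. y \<in> Y \<Longrightarrow> set_pmf (K y) \<subseteq> Y" and y: "y \<in> Y"
  shows "set_pmf (walk K n y) \<subseteq> Y"
  using y
proof (induction n arbitrary: y)
  case (Suc n)
  have "set_pmf (walk K (Suc n) y) = (\<Union>z\<in>set_pmf (K y). set_pmf (walk K n z))"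
    by (simp add: set_bind_pmf)
  then show ?case using Suc K[OF Suc.prems] by auto
qed simp

lemma set_pmf_cesaro_walk:
  assumes "\<And>y. y \<in> Y \<Longrightarrow> set_pmf (K y) \<subseteq> Y" and "y \<in> Y"
  shows "set_pmf (cesaro_walk K n y) \<subseteq> Y"
  unfolding cesaro_walk_def set_bind_pmf using set_pmf_walk[of Y K, OF assms] by auto

lemma pmf_cesaro_walk: "pmf (cesaro_walk K n y) z = (\<Sum>k\<le>n. pmf (walk K k y) z) / real (Suc n)"
  unfolding cesaro_walk_def pmf_bind by (simp add: integral_pmf_of_set)

section \<open>Transition probabilities, orbits and classes\<close>

lemma (in dense_subgroup_action) borel_full_group_subset_full_group:
  assumes "invariant_measure M R" "T \<in> borel_full_group M R"
  shows "T \<in> full_group_maps M R"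
proof -
  have "distr M M T = M" using assms by (simp add: invariant_measure_def)
  then have "null_sets (distr M M T) = null_sets M" by simp
  then show ?thesis using assms(2) by (auto simp: full_group_maps_def borel_full_group_def)
qed

text \<open>Splitting off the first step expresses time \<open>Suc k\<close> as a series of time
  \<open>k\<close> composed with the maps \<open>rep (e n)\<close>. The indicator restricts to
  \<open>E\<close>, where \<open>rep\<close> and \<open>\<phi>\<close> agree, and values in
  \<open>ennreal\<close> spare any question of convergence.\<close>

lemma (in dense_subgroup_action) walk_density_measurable:
  fixes \<nu> :: "('a \<Rightarrow> 'a) set pmf"
  assumes \<nu>: "set_pmf \<nu> \<subseteq> G"
  defines "K \<equiv> \<lambda>y. if y \<in> E then map_pmf (\<lambda>g. \<phi> g y) \<nu> else return_pmf y"
  shows "(\<lambda>p. indicator E (fst p) * ennreal (pmf (walk K k (fst p)) (snd p))) \<in> borel_measurable (M \<Otimes>\<^sub>M M)"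
proof (induction k)
  case 0
  have "{p \<in> space (M \<Otimes>\<^sub>M M). fst p = snd p} \<in> sets (M \<Otimes>\<^sub>M M)"
    by (rule standard_borel_equality_sets[OF borel measurable_fst measurable_snd])
  then have "(\<lambda>p. indicator {p \<in> space (M \<Otimes>\<^sub>M M). fst p = snd p} p :: ennreal) \<in> borel_measurable (M \<Otimes>\<^sub>M M)"
    by (rule borel_measurable_indicator)
  then have m: "(\<lambda>p. indicator E (fst p) * indicator {p \<in> space (M \<Otimes>\<^sub>M M). fst p = snd p} p :: ennreal) \<in> borel_measurable (M \<Otimes>\<^sub>M M)"
    using E_sets by (intro borel_measurable_times_ennreal measurable_compose[OF measurable_fst borel_measurable_indicator])
  show ?case
    by (rule measurable_cong[THEN iffD1, OF _ m]) (auto simp: indicator_def)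
next
  case (Suc k)
  obtain \<rho> :: "nat pmf" and e where \<rho>: "\<nu> = map_pmf e \<rho>" and e\<nu>: "\<forall>n. e n \<in> set_pmf \<nu>"
    using pmf_countable_enumeration[of \<nu>] by (elim exE conjE) (rule that)
  have e: "e n \<in> G" for n using e\<nu> \<nu> by auto
  let ?F = "\<lambda>k p. indicator E (fst p) * ennreal (pmf (walk K k (fst p)) (snd p))"
  have eq: "?F (Suc k) p = indicator E (fst p) * (\<Sum>n. ennreal (pmf \<rho> n) * ?F k (rep (e n) (fst p), snd p))" for p
  proof (cases "fst p \<in> E")
    case True
    obtain x z where p: "p = (x, z)" by (cases p)
    have x: "x \<in> E" using True p by simp
    have ex: "\<phi> (e n) x = rep (e n) x" "\<phi> (e n) x \<in> E" for n
      using rep(2)[OF e x] element_image[of "e n" x] e x by auto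
    have "ennreal (pmf (walk K (Suc k) x) z) = (\<integral>\<^sup>+ y. ennreal (pmf (walk K k y) z) \<partial>measure_pmf (K x))"
      unfolding walk.simps by (rule ennreal_pmf_bind)
    also have "K x = map_pmf (\<lambda>n. \<phi> (e n) x) \<rho>" using x by (simp add: K_def \<rho> pmf.map_comp o_def)
    also have "(\<integral>\<^sup>+ y. ennreal (pmf (walk K k y) z) \<partial>measure_pmf (map_pmf (\<lambda>n. \<phi> (e n) x) \<rho>))
        = (\<integral>\<^sup>+ n. ennreal (pmf (walk K k (\<phi> (e n) x)) z) \<partial>measure_pmf \<rho>)" by simp
    also have "\<dots> = (\<Sum>n. ennreal (pmf \<rho> n) * ennreal (pmf (walk K k (\<phi> (e n) x)) z))"
      unfolding nn_integral_measure_pmf by (rule nn_integral_count_space_nat)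
    finally show ?thesis using x ex p by simp
  qed simp
  have meas: "(\<lambda>p. ?F k (rep (e n) (fst p), snd p)) \<in> borel_measurable (M \<Otimes>\<^sub>M M)" for n
    by (rule measurable_compose[OF measurable_Pair[OF measurable_compose[OF measurable_fst rep(4)[OF e]] measurable_snd] Suc])
  have "(\<lambda>p. \<Sum>n. ennreal (pmf \<rho> n) * ?F k (rep (e n) (fst p), snd p)) \<in> borel_measurable (M \<Otimes>\<^sub>M M)"
    by (intro borel_measurable_suminf_order borel_measurable_times_ennreal[OF borel_measurable_const meas])
  then have "(\<lambda>p. indicator E (fst p) * (\<Sum>n. ennreal (pmf \<rho> n) * ?F k (rep (e n) (fst p), snd p))) \<in> borel_measurable (M \<Otimes>\<^sub>M M)"
    by (rule borel_measurable_times_ennreal[OF measurable_compose[OF measurable_fst borel_measurable_indicator[OF E_sets]]])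
  then show ?case by (simp only: eq)
qed

text \<open>Invariance of the measure puts the maps \<open>T k\<close> into the full group, so by
  density each value \<open>T k x\<close> is almost surely in the orbit; the countably many
  \<open>T k\<close> exhaust the class. Conversely, elements of \<open>G\<close> move almost every
  point within its class.\<close>

lemma (in dense_subgroup_action) AE_orbit_eq_class:
  assumes inv: "invariant_measure M R"
  shows "AE x in M. R `` {x} = orbit \<G> \<phi> x"
proof -
  obtain T :: "nat \<Rightarrow> 'a \<Rightarrow> 'a" where T: "\<forall>k. T k \<in> borel_full_group M R"
    and AT: "AE x in M. \<forall>y. (x, y) \<in> R \<longrightarrow> (\<exists>k. y = T k x)"
    using ae_feldman_moore[OF borel prob R] by (elim exE conjE) (rule that)
  have fg: "T k \<in> full_group_maps M R" for k using borel_full_group_subset_full_group[OF inv] T by simp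
  have "AE x in M. T k x \<in> orbit \<G> \<phi> x" for k
  proof -
    obtain \<gamma> where \<gamma>: "\<forall>j. \<gamma> j \<in> G" and ev: "AE x in M. \<forall>\<^sub>F j in sequentially. T k x = \<phi> (\<gamma> j) x"
      using dense_sequence[OF fg[of k]] by (elim exE conjE) (rule that)
    from ev show ?thesis
    proof eventually_elim
      case (elim x)
      obtain j where "T k x = \<phi> (\<gamma> j) x"
        by (rule exE[OF eventually_happens'[OF sequentially_bot elim]])
      then show ?case using \<gamma> by (auto simp: orbit_def)
    qed
  qed
  then have 1: "AE x in M. \<forall>k. T k x \<in> orbit \<G> \<phi> x" unfolding AE_all_countable ..
  have "AE x in M. \<forall>g\<in>G. (x, rep g x) \<in> R"
    by (intro AE_ball_countable' countable_G) (rule full_group_mapsD(3)[OF rep(3)])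
  with 1 AT AE_E show ?thesis
  proof eventually_elim
    case (elim x)
    show ?case
    proof (intro equalityI subsetI)
      fix y assume "y \<in> R `` {x}"
      then obtain k where "y = T k x" using elim(2) by auto
      then show "y \<in> orbit \<G> \<phi> x" using elim(1) by simp
    next
      fix y assume "y \<in> orbit \<G> \<phi> x"
      then obtain g where "g \<in> G" "y = \<phi> g x" by (auto simp: orbit_def)
      then show "y \<in> R `` {x}" using elim(3,4) rep(2) by simp
    qed
  qed
qed

text \<open>The null set of bad points is saturated under preimages by the \<open>T k\<close>.
  Points where the \<open>T k\<close> fail to exhaust the class count as bad, so for
  \<open>x\<close> outside the saturation every equivalent point is some \<open>T k x\<close> and is
  outside too.\<close>

lemma (in dense_subgroup_action) AE_invariant_conull:
  assumes inv: "invariant_measure M R" and P: "AE x in M. P x"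
  obtains A where "invariant_borel_set M R A" "space M - A \<in> null_sets M" "\<forall>x\<in>A. P x"
proof -
  obtain T :: "nat \<Rightarrow> 'a \<Rightarrow> 'a" where T: "\<forall>k. T k \<in> borel_full_group M R"
    and AT: "AE x in M. \<forall>y. (x, y) \<in> R \<longrightarrow> (\<exists>k. y = T k x)"
    using ae_feldman_moore[OF borel prob R] by (elim exE conjE) (rule that)
  have fg: "T k \<in> full_group_maps M R" for k using borel_full_group_subset_full_group[OF inv] T by simp
  note Tm = full_group_mapsD(1)[OF fg]
  have "AE x in M. P x \<and> (\<forall>y. (x, y) \<in> R \<longrightarrow> (\<exists>k. y = T k x))" using P AT by eventually_elim simp
  then obtain N where N: "N \<in> null_sets M"
    "{x \<in> space M. \<not> (P x \<and> (\<forall>y. (x, y) \<in> R \<longrightarrow> (\<exists>k. y = T k x)))} \<subseteq> N"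
    unfolding eventually_ae_filter by auto
  \<comment> \<open>The union of these sets contains its own preimage under every \<open>T k\<close>
    and remains null.\<close>
  define Z where "Z = rec_nat N (\<lambda>_ B. B \<union> (\<Union>k. T k -` B \<inter> space M))"
  have Z0: "Z 0 = N" and ZS: "Z (Suc j) = Z j \<union> (\<Union>k. T k -` Z j \<inter> space M)" for j
    by (simp_all add: Z_def)
  have Z: "Z j \<in> null_sets M" for j
  proof (induction j)
    case (Suc j)
    have "T k -` Z j \<inter> space M \<in> null_sets M" for k
    proof (subst AE_iff_null_sets)
      show "T k -` Z j \<inter> space M \<in> sets M" using measurable_sets[OF Tm] Suc by auto
      show "AE x in M. x \<notin> T k -` Z j \<inter> space M"
        using AE_full_group_map[OF fg AE_not_in[OF Suc], of k] by eventually_elim simp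
    qed
    then show ?case unfolding ZS using Suc by (intro null_sets.Un null_sets_UN) auto
  qed (simp add: Z0 N)
  define U where "U = (\<Union>j. Z j)"
  have U: "U \<in> null_sets M" unfolding U_def using Z by (intro null_sets_UN)
  have Rsub: "R \<subseteq> space M \<times> space M" using R by (auto simp: countable_borel_equiv_def equiv_def refl_on_def)
  have NU: "N \<subseteq> U" using Z0 by (auto simp: U_def)
  show thesis
  proof (rule that[of "space M - U"])
    show "invariant_borel_set M R (space M - U)"
      unfolding invariant_borel_set_def
    proof (intro conjI subsetI)
      show "space M - U \<in> sets M" using U by auto
      fix y assume "y \<in> R `` (space M - U)"
      then obtain x where x: "x \<in> space M" "x \<notin> U" "(x, y) \<in> R" by auto
      then obtain k where k: "y = T k x" using N(2) NU by blast
      have "y \<notin> Z j" for j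
      proof
        assume "y \<in> Z j"
        then have "x \<in> Z (Suc j)" using k x(1) by (auto simp: ZS)
        then show False using x(2) by (auto simp: U_def)
      qed
      then show "y \<in> space M - U" using x(3) Rsub by (auto simp: U_def)
    qed
    show "space M - (space M - U) \<in> null_sets M"
    proof -
      have "space M - (space M - U) = U" using sets.sets_into_space[OF null_setsD2[OF U]] by auto
      then show ?thesis using U by simp
    qed
    show "\<forall>x\<in>space M - U. P x" using N(2) NU by blast
  qed
qed

text \<open>The law of the averaged walk from \<open>x\<close> lives on the orbit of
  \<open>x\<close>, hence has norm 1 on the class. An invariant conull set makes orbits and classes
  agree and contains both points of every pair that matters, so \<open>liouville_cesaro_walk\<close>
  yields the convergence.\<close>

theorem (in dense_subgroup_action) AE_liouville_imp_amenable:
  assumes inv: "invariant_measure M R" and \<nu>: "set_pmf \<nu> \<subseteq> G"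
    and L: "AE x in M. liouville \<G> \<phi> (orbit \<G> \<phi> x) \<nu>"
  shows "amenable_equiv M R"
proof -
  have "AE x in M. x \<in> E \<and> R `` {x} = orbit \<G> \<phi> x \<and> liouville \<G> \<phi> (orbit \<G> \<phi> x) \<nu>"
    using AE_E AE_orbit_eq_class[OF inv] L by eventually_elim simp
  then obtain A where A: "invariant_borel_set M R A" "space M - A \<in> null_sets M"
    and good: "\<forall>x\<in>A. x \<in> E \<and> R `` {x} = orbit \<G> \<phi> x \<and> liouville \<G> \<phi> (orbit \<G> \<phi> x) \<nu>"
    by (rule AE_invariant_conull[OF inv])
  have As: "A \<in> sets M" and Ai: "R `` A \<subseteq> A" using A(1) by (auto simp: invariant_borel_set_def)
  define K where "K = (\<lambda>y. if y \<in> E then map_pmf (\<lambda>g. \<phi> g y) \<nu> else return_pmf y)"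
  \<comment> \<open>The value 0 off \<open>A\<close> affects the normalisation only on a null set.
    On \<open>A\<close>, which is contained in \<open>E\<close>, the indicator in
    \<open>walk_density_measurable\<close> equals 1.\<close>
  define l where "l n p = (if fst p \<in> A then pmf (cesaro_walk K n (fst p)) (snd p) else 0)" for n p
  have orbE: "orbit \<G> \<phi> x \<subseteq> E" if "x \<in> E" for x using element_image that by (auto simp: orbit_def)
  have Kset: "set_pmf (K y) \<subseteq> orbit \<G> \<phi> x" if x: "x \<in> E" and y: "y \<in> orbit \<G> \<phi> x" for x y
  proof
    fix z assume "z \<in> set_pmf (K y)"
    have yE: "y \<in> E" using orbE[OF x] y by auto
    obtain h where h: "h \<in> G" "y = \<phi> h x" using y by (auto simp: orbit_def)
    obtain g where g: "g \<in> G" "z = \<phi> g y" using \<open>z \<in> set_pmf (K y)\<close> yE \<nu> by (auto simp: K_def)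
    have "z = \<phi> (g \<otimes>\<^bsub>\<G>\<^esub> h) x" using composition_rule[OF x, of g h] g h by simp
    moreover have "g \<otimes>\<^bsub>\<G>\<^esub> h \<in> carrier \<G>" using m_closed[of g h] g(1) h(1) by simp
    ultimately show "z \<in> orbit \<G> \<phi> x" unfolding orbit_def by blast
  qed
  have meas: "l n \<in> borel_measurable (restrict_space (M \<Otimes>\<^sub>M M) R)" for n
  proof (rule measurable_restrict_space1)
    let ?F = "\<lambda>k p. indicator E (fst p) * ennreal (pmf (walk K k (fst p)) (snd p))"
    have "(\<lambda>p. indicator A (fst p) * ((\<Sum>k\<le>n. enn2real (?F k p)) / real (Suc n))) \<in> borel_measurable (M \<Otimes>\<^sub>M M)"
      using As walk_density_measurable[OF \<nu>, folded K_def]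
      by (intro borel_measurable_times borel_measurable_divide borel_measurable_sum borel_measurable_const
          measurable_compose[OF measurable_fst borel_measurable_indicator] borel_measurable_enn2real)
    moreover have "indicator A (fst p) * ((\<Sum>k\<le>n. enn2real (?F k p)) / real (Suc n)) = l n p" for p
    proof (cases "fst p \<in> A")
      case True
      then have "fst p \<in> E" using good by simp
      then show ?thesis using True by (simp add: l_def pmf_cesaro_walk)
    qed (simp add: l_def)
    ultimately show "l n \<in> borel_measurable (M \<Otimes>\<^sub>M M)" by (simp cong: measurable_cong)
  qed
  have norm: "l1_norm (R `` {x}) (\<lambda>z. l n (x, z)) = 1" if x: "x \<in> A" for x n
  proof -
    have xE: "x \<in> E" and Rx: "R `` {x} = orbit \<G> \<phi> x" using good x by auto
    have "set_pmf (cesaro_walk K n x) \<subseteq> R `` {x}"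
      unfolding Rx by (rule set_pmf_cesaro_walk[OF Kset[OF xE] orbit_refl[OF xE]])
    then have "emeasure (measure_pmf (cesaro_walk K n x)) (R `` {x}) = 1"
      by (intro measure_pmf.emeasure_eq_1_AE) (auto intro!: AE_pmfI)
    then show ?thesis using x by (simp add: l1_norm_def l_def nn_integral_pmf)
  qed
  have conv: "(\<lambda>n. l1_norm (R `` {x}) (\<lambda>z. l n (x, z) - l n (y, z))) \<longlonglongrightarrow> 0" if x: "x \<in> A" and xy: "(x, y) \<in> R" for x y
  proof -
    have yA: "y \<in> A" using Ai x xy by auto
    have xE: "x \<in> E" and Rx: "R `` {x} = orbit \<G> \<phi> x" and Lx: "liouville \<G> \<phi> (orbit \<G> \<phi> x) \<nu>"
      using good x by auto
    let ?Y = "orbit \<G> \<phi> x"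
    have yY: "y \<in> ?Y" using Rx xy by auto
    have cY: "countable ?Y"
    proof -
      have "?Y = (\<lambda>g. \<phi> g x) ` G" by (auto simp: orbit_def)
      then show ?thesis using countable_G by simp
    qed
    have lim: "(\<lambda>n. pmf_l1 (cesaro_walk K n x) (cesaro_walk K n y)) \<longlonglongrightarrow> 0"
    proof (rule liouville_cesaro_walk[OF cY Kset[OF xE] _ orbit_refl[OF xE] yY])
      fix f :: "'a \<Rightarrow> real" and C
      assume fC: "\<And>y. \<bar>f y\<bar> \<le> C" and fK: "\<And>y. y \<in> ?Y \<Longrightarrow> f y = \<E> (K y) f"
      have "harmonic \<G> \<phi> ?Y \<nu> f"
        unfolding harmonic_def
      proof
        fix u assume u: "u \<in> ?Y"
        have uE: "u \<in> E" using u orbE[OF xE] by auto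
        have "((\<lambda>g. f (\<phi> g u) * pmf \<nu> g) has_sum \<E> \<nu> (\<lambda>g. f (\<phi> g u))) (carrier \<G>)"
          by (rule expectation_pmf_has_sum) (use fC \<nu> in auto)
        moreover have "\<E> \<nu> (\<lambda>g. f (\<phi> g u)) = f u"
          using fK[OF u] uE by (simp add: K_def)
        ultimately show "((\<lambda>g. f (\<phi> g u) * pmf \<nu> g) has_sum f u) (carrier \<G>)" by simp
      qed
      moreover have "bounded (f ` ?Y)" unfolding bounded_iff using fC by (auto intro!: exI[of _ C])
      ultimately show "f constant_on ?Y" using Lx unfolding liouville_def by simp
    qed
    have le: "l1_norm (R `` {x}) (\<lambda>z. l n (x, z) - l n (y, z)) \<le>
        pmf_l1 (cesaro_walk K n x) (cesaro_walk K n y)" for n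
    proof -
      have "l1_norm (R `` {x}) (\<lambda>z. l n (x, z) - l n (y, z)) =
          (\<integral>\<^sup>+ z. ennreal \<bar>pmf (cesaro_walk K n x) z - pmf (cesaro_walk K n y) z\<bar> * indicator (R `` {x}) z \<partial>count_space UNIV)"
        using x yA by (simp add: l1_norm_def l_def nn_integral_count_space_indicator)
      also have "\<dots> \<le> pmf_l1 (cesaro_walk K n x) (cesaro_walk K n y)"
        by (rule nn_integral_mono) (simp add: indicator_def)
      finally show ?thesis .
    qed
    show ?thesis
      by (rule tendsto_sandwich[OF _ _ tendsto_const lim]) (use le in auto)
  qed
  have AA: "AE x in M. x \<in> A" by (rule AE_I'[OF A(2)]) auto
  show ?thesis
    unfolding amenable_equiv_def
  proof (intro exI[of _ l] conjI allI ballI)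
    show "l n \<in> borel_measurable (restrict_space (M \<Otimes>\<^sub>M M) R)" for n by (rule meas)
    show "0 \<le> l n p" for n p by (simp add: l_def)
    show "AE x in M. l1_norm (R `` {x}) (\<lambda>z. l n (x, z)) = 1" for n
      using AA by eventually_elim (rule norm)
    show "\<exists>A. invariant_borel_set M R A \<and> space M - A \<in> null_sets M \<and>
             (\<forall>(x, y)\<in>R. x \<in> A \<longrightarrow>
                (\<lambda>n. l1_norm (R `` {x}) (\<lambda>z. l n (x, z) - l n (y, z))) \<longlonglongrightarrow> 0)"
      using A conv by (intro exI[of _ A]) auto
  qed
qed

theorem corollary3p4:
  fixes M :: "'a measure" and R :: "'a rel"
    and G :: "('a \<Rightarrow> 'a) set set"
    and E :: "'a set" and \<phi> :: "('a \<Rightarrow> 'a) set \<Rightarrow> 'a \<Rightarrow> 'a"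
  defines "H \<equiv> subgroup_of_full_group M R G"
  assumes "standard_measure_space M"
    and "countable_borel_equiv M R"
    and "invariant_measure M R"
    and "ergodic_measure M R"
    and "\<not> amenable_equiv M R"
    and "subgroup G (full_group M R)"
    and "countable G"
    and "uniform_topology M R closure_of G = carrier (full_group M R)"
    and "genuine_action M R G E \<phi>"
  shows "(AE x in M. \<exists>\<nu>. set_pmf \<nu> \<subseteq> G \<and> symmetric_measure H \<nu> \<and> nondegenerate_measure H \<nu> \<and>
            (\<forall>n. liouville H (diagonal_action \<phi>) (tuples n (orbit H \<phi> x)) \<nu>)) \<and>
         \<not> (\<exists>\<nu>. set_pmf \<nu> \<subseteq> G \<and> symmetric_measure H \<nu> \<and> nondegenerate_measure H \<nu> \<and>
            (AE x in M. liouville H \<phi> (orbit H \<phi> x) \<nu>))"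
proof (intro conjI notI)
  interpret dense_subgroup_action M R G E \<phi>
    by (intro dense_subgroup_action.intro standard_relation.intro dense_subgroup_action_axioms.intro; fact)
  show "AE x in M. \<exists>\<nu>. set_pmf \<nu> \<subseteq> G \<and> symmetric_measure H \<nu> \<and> nondegenerate_measure H \<nu> \<and>
      (\<forall>n. liouville H (diagonal_action \<phi>) (tuples n (orbit H \<phi> x)) \<nu>)"
    unfolding H_def by (rule AE_exists_liouville_measure)
  assume "\<exists>\<nu>. set_pmf \<nu> \<subseteq> G \<and> symmetric_measure H \<nu> \<and> nondegenerate_measure H \<nu> \<and>
      (AE x in M. liouville H \<phi> (orbit H \<phi> x) \<nu>)"
  then obtain \<nu> where "set_pmf \<nu> \<subseteq> G" "AE x in M. liouville H \<phi> (orbit H \<phi> x) \<nu>"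
    by (elim exE conjE) (rule that)
  then have "amenable_equiv M R"
    unfolding H_def by (rule AE_liouville_imp_amenable[OF \<open>invariant_measure M R\<close>])
  then show False using \<open>\<not> amenable_equiv M R\<close> by simp
qed

end
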